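(* Let $\Omega\subset\mathbb{R}^n$ ($n=2$ or $3$) be a bounded, open, convex polytope with a conforming, shape-regular simplicial triangulation $\mathcal{T}_h$, and let $V_h$ be the finite element space defined in the context (with degree $k\ge3$ if $n=2$, $k\ge5$ if $n=3$). Let $A\in L^\infty(\Omega;\mathbb{R}^{n\times n})$ be uniformly elliptic and satisfy the Cordes condition $$\frac{|A|^2}{(\mathrm{tr}\,A)^2}\le\frac{1}{n-1+\varepsilon}\quad\text{a.e. in }\Omega$$ for some $\varepsilon\in(0,1]$. Let $\gamma=\mathrm{tr}\,A/|A|^2$, $Lv=A:D^2v$, and $$B_{0,h}(w,v_h)=\sum_{K\in\mathcal{T}_h}(\gamma Lw,\Delta v_h)_K-(2-\sqrt{1-\varepsilon})\sum_{F\in\mathcal{F}_h^i}\langle\llbracket\nabla w\rrbracket,\Delta_Tv_h\rangle_F .$$ Then $$B_{0,h}(v_h,v_h)\ge(1-\sqrt{1-\varepsilon})\,\|v_h\|_{0,h}^2\qquad\forall v_h\in V_h,$$ where $\|v\|_{0,h}^2=\sum_{K\in\mathcal{T}_h}\|D^2v\|_{L^2(K)}^2$.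
   Context: Uniform ellipticity: there exist $\underline{\nu},\bar{\nu}>0$ with $\underline{\nu}|\bm{\xi}|^2\le\bm{\xi}^tA(x)\bm{\xi}\le\bar{\nu}|\bm{\xi}|^2$ for all $\bm{\xi}\in\mathbb{R}^n$ and a.e. $x\in\Omega$. For matrices, $|\cdot|$ is the Frobenius norm and $A:B=\sum_{i,j}A_{ij}B_{ij}$. $D^2v$ is the Hessian; on $V_h$ second derivatives are taken elementwise. $(\cdot,\cdot)_K$ and $\langle\cdot,\cdot\rangle_F$ are the $L^2(K)$ and $L^2(F)$ inner products. A face is an $(n-1)$-dimensional subsimplex of some $K\in\mathcal{T}_h$; $\mathcal{F}_h^i$ is the set of faces not contained in $\partial\Omega$, each of the form $F=\partial K^+\cap\partial K^-$. Finite element space ($\mathcal{P}_k(K)$ = polynomials of total degree at most $k$ on $K$): - For $n=2$, $k\ge3$: $V_h=\{v\in H_0^1(\Omega): v|_K\in\mathcal{P}_k(K)\ \forall K\in\mathcal{T}_h,\ v\text{ is }C^1\text{ at all vertices}\}$. - For $n=3$, $k\ge5$: $V_h=\{v\in H_0^1(\Omega): v|_K\in\mathcal{P}_k(K)\ \forall K\in\mathcal{T}_h,\ v\text{ is }C^1\text{ on all edges},\ v\text{ is }C^2\text{ at all vertices}\}$. Here "$C^1$ at a vertex / on an edge" means that the values of $v$ and $\nabla v$ there, computed from all elements containing it, coincide; "$C^2$ at a vertex" means that in addition the values of $D^2v$ there coincide. Jump: $\llbracket\bm{w}\rrbracket|_F=\bm{w}^+\cdot\bm{n}^+|_F+\bm{w}^-\cdot\bm{n}^-|_F$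 for $F=\partial K^+\cap\partial K^-$, with $\bm{w}^\pm=\bm{w}|_{K^\pm}$ and $\bm{n}^\pm$ the outward unit normal of $K^\pm$. Tangential Laplacian: on a flat face $F$ with orthonormal tangential directions $\bm{t}_1,\dots,\bm{t}_{n-1}$, $\Delta_Tw=\sum_{i=1}^{n-1}\partial^2w/\partial\bm{t}_i^2$. *)

theory Defs
  imports "HOL-Analysis.Analysis"
begin

section \<open>Matrices\<close>

text \<open>
  On \<^typ>\<open>real^'n^'n\<close> the library norm is the Frobenius norm and the library inner product
  is the contraction \<open>A : B\<close>.  Both are used below without further notation.
\<close>

lemma norm_matrix_Frobenius:
  "norm (A :: real^'n^'n) = sqrt (\<Sum>i\<in>UNIV. \<Sum>j\<in>UNIV. (A $ i $ j)\<^sup>2)"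
  by (simp add: norm_eq_sqrt_inner inner_vec_def power2_eq_square)

lemma inner_matrix_contraction:
  "(A :: real^'n^'n) \<bullet> B = (\<Sum>i\<in>UNIV. \<Sum>j\<in>UNIV. A $ i $ j * B $ i $ j)"
  by (simp add: inner_vec_def)

definition ess_bounded :: "(real^'n) set \<Rightarrow> (real^'n \<Rightarrow> real^'n^'n) \<Rightarrow> bool" where
  "ess_bounded \<Omega> A \<longleftrightarrow> A \<in> borel_measurable (lebesgue_on \<Omega>) \<and>
     (\<exists>M. AE x in lebesgue_on \<Omega>. norm (A x) \<le> M)"

definition uniformly_elliptic :: "(real^'n) set \<Rightarrow> (real^'n \<Rightarrow> real^'n^'n) \<Rightarrow> bool" where
  "uniformly_elliptic \<Omega> A \<longleftrightarrow> (\<exists>\<nu>\<^sub>1>0. \<exists>\<nu>\<^sub>2>0. AE x in lebesgue_on \<Omega>. \<forall>\<xi>.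
     \<nu>\<^sub>1 * (norm \<xi>)\<^sup>2 \<le> \<xi> \<bullet> (A x *v \<xi>) \<and> \<xi> \<bullet> (A x *v \<xi>) \<le> \<nu>\<^sub>2 * (norm \<xi>)\<^sup>2)"

definition cordes :: "(real^'n) set \<Rightarrow> (real^'n \<Rightarrow> real^'n^'n) \<Rightarrow> real \<Rightarrow> bool" where
  "cordes \<Omega> A \<epsilon> \<longleftrightarrow> (AE x in lebesgue_on \<Omega>.
     (norm (A x))\<^sup>2 / (trace (A x))\<^sup>2 \<le> 1 / (real CARD('n) - 1 + \<epsilon>))"

definition cordes_gamma :: "(real^'n \<Rightarrow> real^'n^'n) \<Rightarrow> real^'n \<Rightarrow> real" where
  "cordes_gamma A x = trace (A x) / (norm (A x))\<^sup>2"


section \<open>Classical derivatives\<close>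

definition dir_deriv :: "real^'n \<Rightarrow> (real^'n \<Rightarrow> real) \<Rightarrow> real^'n \<Rightarrow> real" where
  "dir_deriv e f x = frechet_derivative f (at x) e"

definition partial :: "'n \<Rightarrow> (real^'n \<Rightarrow> real) \<Rightarrow> real^'n \<Rightarrow> real" where
  "partial i f = dir_deriv (axis i 1) f"

definition grad :: "(real^'n \<Rightarrow> real) \<Rightarrow> real^'n \<Rightarrow> real^'n" where
  "grad f x = (\<chi> i. partial i f x)"

definition hess :: "(real^'n \<Rightarrow> real) \<Rightarrow> real^'n \<Rightarrow> real^'n^'n" where
  "hess f x = (\<chi> i j. partial i (partial j f) x)"

definition laplacian :: "(real^'n \<Rightarrow> real) \<Rightarrow> real^'n \<Rightarrow> real" where
  "laplacian f x = (\<Sum>i\<in>UNIV. partial i (partial i f) x)"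

fun Ck :: "nat \<Rightarrow> (real^'n \<Rightarrow> real) \<Rightarrow> bool" where
  "Ck 0 f \<longleftrightarrow> continuous_on UNIV f"
| "Ck (Suc m) f \<longleftrightarrow> (\<forall>x. f differentiable at x) \<and> (\<forall>i. Ck m (partial i f))"


section \<open>The space \<open>H\<^sub>0\<^sup>1(\<Omega>)\<close>\<close>

definition test_function :: "(real^'n) set \<Rightarrow> (real^'n \<Rightarrow> real) \<Rightarrow> bool" where
  "test_function \<Omega> \<phi> \<longleftrightarrow> (\<forall>m. Ck m \<phi>) \<and> (\<exists>S. compact S \<and> S \<subseteq> \<Omega> \<and> (\<forall>x. x \<notin> S \<longrightarrow> \<phi> x = 0))"

definition L2_on :: "(real^'n) set \<Rightarrow> (real^'n \<Rightarrow> real) \<Rightarrow> bool" where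
  "L2_on \<Omega> f \<longleftrightarrow> f \<in> borel_measurable (lebesgue_on \<Omega>) \<and> integrable (lebesgue_on \<Omega>) (\<lambda>x. (f x)\<^sup>2)"

definition weak_grad :: "(real^'n) set \<Rightarrow> (real^'n \<Rightarrow> real) \<Rightarrow> (real^'n \<Rightarrow> real^'n) \<Rightarrow> bool" where
  "weak_grad \<Omega> v g \<longleftrightarrow> (\<forall>\<phi> i. test_function \<Omega> \<phi> \<longrightarrow>
     integral\<^sup>L (lebesgue_on \<Omega>) (\<lambda>x. v x * partial i \<phi> x) =
     - integral\<^sup>L (lebesgue_on \<Omega>) (\<lambda>x. g x $ i * \<phi> x))"

text \<open>
  \<open>H\<^sub>0\<^sup>1(\<Omega>)\<close> is the closure of the test functions in the \<open>H\<^sup>1(\<Omega>)\<close> norm.  Membership does not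
  depend on the values of \<open>v\<close> on null sets or outside \<open>\<Omega>\<close>.
\<close>

definition H10 :: "(real^'n) set \<Rightarrow> (real^'n \<Rightarrow> real) \<Rightarrow> bool" where
  "H10 \<Omega> v \<longleftrightarrow> L2_on \<Omega> v \<and> (\<exists>g. (\<forall>i. L2_on \<Omega> (\<lambda>x. g x $ i)) \<and> weak_grad \<Omega> v g \<and>
     (\<exists>\<phi>. (\<forall>m :: nat. test_function \<Omega> (\<phi> m)) \<and>
        (\<lambda>m. integral\<^sup>L (lebesgue_on \<Omega>) (\<lambda>x. (\<phi> m x - v x)\<^sup>2 + (norm (grad (\<phi> m) x - g x))\<^sup>2))
          \<longlonglongrightarrow> 0))"


section \<open>Meshes\<close>

text \<open>
  Elements are closed simplices of full dimension; conformity (two elements meet in a common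
  face, possibly empty) is part of the library notion \<^const>\<open>triangulation\<close>.
\<close>

definition conforming_mesh :: "(real^'n) set \<Rightarrow> (real^'n) set set \<Rightarrow> bool" where
  "conforming_mesh \<Omega> T \<longleftrightarrow>
     triangulation T \<and> (\<forall>K\<in>T. int CARD('n) simplex K) \<and> \<Union>T = closure \<Omega>"

definition inradius :: "(real^'n) set \<Rightarrow> real" where
  "inradius K = Sup {r. \<exists>x. cball x r \<subseteq> K}"

definition shape_regular :: "real \<Rightarrow> (real^'n) set set \<Rightarrow> bool" where
  "shape_regular \<sigma> T \<longleftrightarrow> (\<forall>K\<in>T. diameter K \<le> \<sigma> * inradius K)"

definition mesh_vertices :: "(real^'n) set set \<Rightarrow> (real^'n) set" where
  "mesh_vertices T = {z. \<exists>K\<in>T. z extreme_point_of K}"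

definition mesh_edges :: "(real^'n) set set \<Rightarrow> (real^'n) set set" where
  "mesh_edges T = {E. \<exists>K\<in>T. E face_of K \<and> aff_dim E = 1}"

definition interior_faces :: "(real^'n) set \<Rightarrow> (real^'n) set set \<Rightarrow> (real^'n) set set" where
  "interior_faces \<Omega> T = {F. (\<exists>K\<in>T. F facet_of K) \<and> \<not> F \<subseteq> frontier \<Omega>}"

definition outer_normal :: "(real^'n) set \<Rightarrow> (real^'n) set \<Rightarrow> real^'n" where
  "outer_normal K F = (THE \<nu>. norm \<nu> = 1 \<and> (\<forall>x\<in>F. \<forall>y\<in>K. \<nu> \<bullet> (y - x) \<le> 0))"


section \<open>Integration and differentiation on flat faces\<close>

text \<open>
  A frame of \<open>F\<close> is an orthonormal basis \<open>t\<^sub>1, \<dots>, t\<^bsub>n-1\<^esub>\<close> of the linear space parallel to \<open>F\<close>.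
  The surface measure on \<open>F\<close> is Lebesgue measure in the isometric coordinates
  \<open>y \<mapsto> a + y\<^sub>1 t\<^sub>1 + \<dots> + y\<^bsub>n-1\<^esub> t\<^bsub>n-1\<^esub>\<close> with \<open>a \<in> F\<close>.  Neither the integral nor the tangential
  Laplacian depends on the frame or on \<open>a\<close>.
\<close>

definition tangent_frame :: "(real^'n) set \<Rightarrow> (real^'n) set" where
  "tangent_frame F = (SOME B. pairwise orthogonal B \<and> (\<forall>t\<in>B. norm t = 1) \<and>
     span B = span {x - y | x y. x \<in> F \<and> y \<in> F})"

definition face_integral :: "(real^'n) set \<Rightarrow> (real^'n \<Rightarrow> real) \<Rightarrow> real" where
  "face_integral F f = (let B = tangent_frame F; a = (SOME a. a \<in> F) in
     integral\<^sup>L (Pi\<^sub>M B (\<lambda>_. lborel))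
       (\<lambda>y. indicator F (a + (\<Sum>t\<in>B. y t *\<^sub>R t)) * f (a + (\<Sum>t\<in>B. y t *\<^sub>R t))))"

definition tangential_laplacian :: "(real^'n) set \<Rightarrow> (real^'n \<Rightarrow> real) \<Rightarrow> real^'n \<Rightarrow> real" where
  "tangential_laplacian F w x = (\<Sum>t\<in>tangent_frame F. dir_deriv t (dir_deriv t w) x)"


section \<open>The finite element space\<close>

definition Pk :: "nat \<Rightarrow> (real^'n \<Rightarrow> real) set" where
  "Pk k = {p. \<exists>c. p = (\<lambda>x. \<Sum>\<alpha> | sum \<alpha> UNIV \<le> k. c \<alpha> * (\<Prod>i\<in>UNIV. (x $ i) ^ \<alpha> i))}"

text \<open>
  \<open>piece v K\<close> is the polynomial representing \<open>v|\<^sub>K\<close>.  It is unique for a piecewise polynomial \<open>v\<close>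
  since \<open>K\<close> has nonempty interior.  All elementwise derivatives of \<open>v\<close> and all its one-sided
  values on vertices, edges and faces are taken from it, so they do not depend on the choice
  of \<open>v\<close> within its class modulo null sets.
\<close>

definition piece :: "(real^'n \<Rightarrow> real) \<Rightarrow> (real^'n) set \<Rightarrow> real^'n \<Rightarrow> real" where
  "piece v K = (THE p. real_polynomial_function p \<and> (AE x in lebesgue_on K. v x = p x))"

text \<open>
  \<open>S\<close> is a single vertex or an edge; the elements containing it are compared pointwise on it.
\<close>

definition C1_on :: "(real^'n) set set \<Rightarrow> (real^'n \<Rightarrow> real) \<Rightarrow> (real^'n) set \<Rightarrow> bool" where
  "C1_on T v S \<longleftrightarrow> (\<forall>K\<in>T. \<forall>K'\<in>T. S \<subseteq> K \<and> S \<subseteq> K' \<longrightarrow>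
     (\<forall>x\<in>S. piece v K x = piece v K' x \<and> grad (piece v K) x = grad (piece v K') x))"

definition C2_on :: "(real^'n) set set \<Rightarrow> (real^'n \<Rightarrow> real) \<Rightarrow> (real^'n) set \<Rightarrow> bool" where
  "C2_on T v S \<longleftrightarrow> C1_on T v S \<and> (\<forall>K\<in>T. \<forall>K'\<in>T. S \<subseteq> K \<and> S \<subseteq> K' \<longrightarrow>
     (\<forall>x\<in>S. hess (piece v K) x = hess (piece v K') x))"

text \<open>Only the dimensions \<open>n = 2\<close> and \<open>n = 3\<close> are meant.\<close>

definition Vh :: "(real^'n) set \<Rightarrow> (real^'n) set set \<Rightarrow> nat \<Rightarrow> (real^'n \<Rightarrow> real) set" where
  "Vh \<Omega> T k = {v. H10 \<Omega> v \<and>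
     (\<forall>K\<in>T. \<exists>p\<in>Pk k. AE x in lebesgue_on K. v x = p x) \<and>
     (if CARD('n) = 2 then \<forall>z\<in>mesh_vertices T. C1_on T v {z}
      else (\<forall>E\<in>mesh_edges T. C1_on T v E) \<and> (\<forall>z\<in>mesh_vertices T. C2_on T v {z}))}"


section \<open>The bilinear form\<close>

text \<open>
  An interior face is a facet of exactly two elements \<open>K\<^sup>+\<close>, \<open>K\<^sup>-\<close>; the jump is written as the
  sum over these two.
\<close>

definition jump_grad ::
  "(real^'n) set set \<Rightarrow> (real^'n \<Rightarrow> real) \<Rightarrow> (real^'n) set \<Rightarrow> real^'n \<Rightarrow> real" where
  "jump_grad T w F x = (\<Sum>K | K \<in> T \<and> F facet_of K. grad (piece w K) x \<bullet> outer_normal K F)"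

text \<open>
  On an interior face \<open>F\<close> the tangential derivatives of a function from \<^const>\<open>Vh\<close> are the same
  from both sides, because the function itself is; hence any element with facet \<open>F\<close> may be used.
\<close>

definition face_laplacian ::
  "(real^'n) set set \<Rightarrow> (real^'n \<Rightarrow> real) \<Rightarrow> (real^'n) set \<Rightarrow> real^'n \<Rightarrow> real" where
  "face_laplacian T v F = tangential_laplacian F (piece v (SOME K. K \<in> T \<and> F facet_of K))"

definition B0h :: "(real^'n) set \<Rightarrow> (real^'n) set set \<Rightarrow> (real^'n \<Rightarrow> real^'n^'n) \<Rightarrow> real \<Rightarrow>
    (real^'n \<Rightarrow> real) \<Rightarrow> (real^'n \<Rightarrow> real) \<Rightarrow> real" where
  "B0h \<Omega> T A \<epsilon> w v =
     (\<Sum>K\<in>T. integral\<^sup>L (lebesgue_on K)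
        (\<lambda>x. cordes_gamma A x * (A x \<bullet> hess (piece w K) x) * laplacian (piece v K) x))
     - (2 - sqrt (1 - \<epsilon>)) *
       (\<Sum>F\<in>interior_faces \<Omega> T. face_integral F (\<lambda>x. jump_grad T w F x * face_laplacian T v F x))"

definition norm0h :: "(real^'n) set set \<Rightarrow> (real^'n \<Rightarrow> real) \<Rightarrow> real" where
  "norm0h T v = sqrt (\<Sum>K\<in>T. integral\<^sup>L (lebesgue_on K) (\<lambda>x. (norm (hess (piece v K) x))\<^sup>2))"

end

theory Submission
  imports Defs
begin

text \<open>
  Write \<open>s = sqrt (1 - \<epsilon>)\<close>. The Cordes condition says that \<open>|\<gamma> A - I| \<le> s\<close> almost
  everywhere, so for \<open>H = D\<^sup>2v\<close> the element terms satisfy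
  \<open>(\<gamma> A : H) tr H \<ge> (tr H)\<^sup>2 - s |H| |tr H| \<ge> (1 - s/2) (tr H)\<^sup>2 - (s/2) |H|\<^sup>2\<close>. Let \<open>X\<close>,
  \<open>Y\<close> and \<open>J\<close> be the sums of the integrals of \<open>(\<Delta>v)\<^sup>2\<close>, of \<open>|D\<^sup>2v|\<^sup>2\<close> and of \<open>\<lbrakk>\<nabla>v\<rbrakk> \<Delta>\<^sub>Tv\<close>
  over elements and interior faces. If \<open>X - Y = 2 J\<close>, then
  \<open>(1 - s/2) X - (s/2) Y - (2 - s) J = (1 - s) Y\<close>, which is the assertion.

  The identity \<open>X - Y = 2 J\<close> is the discrete Miranda-Talenti identity
  (\<open>discrete_Miranda_Talenti\<close>). On one simplex, \<open>(\<Delta>p)\<^sup>2 - |D\<^sup>2p|\<^sup>2\<close> is the divergence of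
  \<open>\<Delta>p \<nabla>p - D\<^sup>2p \<nabla>p\<close>, whose flux through a flat facet with normal \<open>\<nu>\<close> is the integral of
  \<open>\<Delta>\<^sub>Tp \<partial>\<^sub>\<nu>p - \<nabla>\<^sub>Tp \<bullet> \<nabla>\<^sub>T\<partial>\<^sub>\<nu>p\<close> (\<open>simplex_Miranda_Talenti\<close>). On a boundary facet \<open>p\<close>
  vanishes together with its tangential derivatives, and there is no flux. On an interior
  facet \<open>F\<close> the tangential derivatives from the two sides agree, and the two fluxes add up to
  the integral of \<open>w \<Delta>\<^sub>Tp - \<nabla>\<^sub>Tp \<bullet> \<nabla>\<^sub>Tw\<close> with the jump \<open>w = \<lbrakk>\<nabla>v\<rbrakk>\<close>. Here the smoothness of
  the finite element space at vertices or edges enters: it makes \<open>w\<close> vanish on the relative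
  boundary of \<open>F\<close>, so that integration by parts on \<open>F\<close> gives twice the integral of \<open>w \<Delta>\<^sub>Tp\<close>
  (\<open>facet_flux_pair\<close>).

  Two tools carry this. The first is the divergence theorem on a simplex
  (\<open>simplex_divergence\<close>). Integrating the divergence of \<open>q(x) (x - u)\<close> in polar coordinates
  around a vertex \<open>u\<close> leaves a multiple of the integral of \<open>q\<close> over the opposite facet
  (\<open>cone_divergence\<close>); taking differences of this formula for two vertices gives the theorem
  for constant directions. Surface integrals are defined by orthonormal coordinates, so this
  rests on the invariance of Lebesgue measure under isometries. The second tool is a weak
  trace theorem (\<open>facet_trace_tendsto\<close>): the test functions approximating \<open>v\<close> in \<open>H\<^sup>1\<close> have
  traces that converge weakly to that of the polynomial piece of either adjacent element.
  Hence the pieces match across interior facets and vanish on boundary facets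
  (\<open>interior_facet_pieces_eq\<close>, \<open>boundary_facet_piece_zero\<close>). The geometric input, that an
  interior face lies in exactly two elements with opposite normals, is
  \<open>interior_face_elements\<close>.
\<close>

section \<open>Directional derivatives and polynomials\<close>

abbreviation rpf :: "('a::real_normed_vector \<Rightarrow> real) \<Rightarrow> bool" where
  "rpf \<equiv> real_polynomial_function"

text \<open>
  Gradients enter only through directional derivatives, so continuity of the derivative is
  asked of each of them separately.
\<close>

definition C1_fun :: "(real^'n \<Rightarrow> real) \<Rightarrow> bool" where
  "C1_fun f \<longleftrightarrow> (\<forall>x. f differentiable at x) \<and> (\<forall>e. continuous_on UNIV (dir_deriv e f))"

lemma has_derivative_dir_deriv:
  assumes "f differentiable at x"
  shows "(f has_derivative (\<lambda>e. dir_deriv e f x)) (at x)"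
  using assms unfolding dir_deriv_def by (simp add: frechet_derivative_works)

lemma dir_deriv_eqI:
  assumes "(f has_derivative f') (at x)"
  shows "dir_deriv e f x = f' e"
  using frechet_derivative_at[OF assms] by (simp add: dir_deriv_def)

lemma linear_dir_deriv:
  assumes "f differentiable at x"
  shows "linear (\<lambda>e. dir_deriv e f x)"
  using has_derivative_linear[OF has_derivative_dir_deriv[OF assms]] .

lemma dir_deriv_diff_direction:
  "f differentiable at x \<Longrightarrow> dir_deriv (a - b) f x = dir_deriv a f x - dir_deriv b f x"
  by (rule linear_diff[OF linear_dir_deriv])

lemma dir_deriv_minus_direction:
  "f differentiable at x \<Longrightarrow> dir_deriv (- a) f x = - dir_deriv a f x"
  by (rule linear_neg[OF linear_dir_deriv])

lemma dir_deriv_eq_partials: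
  assumes "f differentiable at x"
  shows "dir_deriv e f x = (\<Sum>i\<in>UNIV. e $ i * partial i f x)"
proof -
  have "dir_deriv (\<Sum>i\<in>UNIV. e $ i *\<^sub>R axis i 1) f x = (\<Sum>i\<in>UNIV. e $ i * partial i f x)"
    unfolding partial_def
    by (simp add: linear_sum[OF linear_dir_deriv[OF assms]] linear_scale[OF linear_dir_deriv[OF assms]])
  moreover have "(\<Sum>i\<in>UNIV. e $ i *\<^sub>R axis i 1) = e"
    using basis_expansion[of e] by (simp add: scalar_mult_eq_scaleR)
  ultimately show ?thesis by simp
qed

lemma grad_inner_dir_deriv:
  "f differentiable at x \<Longrightarrow> grad f x \<bullet> e = dir_deriv e f x"
  by (simp add: dir_deriv_eq_partials grad_def inner_vec_def mult.commute)

lemma dir_deriv_mult: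
  assumes "f differentiable at x" "g differentiable at x"
  shows "dir_deriv e (\<lambda>x. f x * g x) x = f x * dir_deriv e g x + dir_deriv e f x * g x"
  by (rule dir_deriv_eqI) (auto intro!: derivative_eq_intros has_derivative_dir_deriv assms)

lemma dir_deriv_add:
  assumes "f differentiable at x" "g differentiable at x"
  shows "dir_deriv e (\<lambda>x. f x + g x) x = dir_deriv e f x + dir_deriv e g x"
  by (rule dir_deriv_eqI) (auto intro!: derivative_eq_intros has_derivative_dir_deriv assms)

lemma dir_deriv_diff:
  assumes "f differentiable at x" "g differentiable at x"
  shows "dir_deriv e (\<lambda>x. f x - g x) x = dir_deriv e f x - dir_deriv e g x"
  by (rule dir_deriv_eqI) (auto intro!: derivative_eq_intros has_derivative_dir_deriv assms)

lemma dir_deriv_const: "dir_deriv e (\<lambda>x. c) x = 0"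
  by (rule dir_deriv_eqI) (auto intro!: derivative_eq_intros)

lemma dir_deriv_linear: "bounded_linear f \<Longrightarrow> dir_deriv e f x = f e"
  by (rule dir_deriv_eqI) (rule bounded_linear_imp_has_derivative)

lemma rpf_differentiable: "rpf p \<Longrightarrow> p differentiable at x"
  by (rule differentiable_at_real_polynomial_function)

lemma rpf_continuous_on: "rpf p \<Longrightarrow> continuous_on S p"
  by (simp add: continuous_at_imp_continuous_on rpf_differentiable differentiable_imp_continuous_within)

lemma rpf_dir_deriv:
  "rpf p \<Longrightarrow> rpf (dir_deriv e p)"
proof (induction rule: real_polynomial_function.induct)
  case (linear f)
  then have "dir_deriv e f = (\<lambda>x. f e)" by (auto simp: dir_deriv_linear)
  then show ?case by auto
next
  case (const c)
  have "dir_deriv e (\<lambda>x. c) = (\<lambda>x. 0)" by (auto simp: dir_deriv_const)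
  then show ?case by auto
next
  case (add f g)
  then have "dir_deriv e (\<lambda>x. f x + g x) = (\<lambda>x. dir_deriv e f x + dir_deriv e g x)"
    by (auto simp: dir_deriv_add rpf_differentiable)
  then show ?case using add by auto
next
  case (mult f g)
  then have "dir_deriv e (\<lambda>x. f x * g x) = (\<lambda>x. f x * dir_deriv e g x + dir_deriv e f x * g x)"
    by (auto simp: dir_deriv_mult rpf_differentiable)
  then show ?case using mult by auto
qed

lemma rpf_partial: "rpf p \<Longrightarrow> rpf (partial i p)"
  unfolding partial_def by (rule rpf_dir_deriv)

text \<open>
  For polynomials symmetry of the second derivative follows by structural induction from the
  product rule.
\<close>

lemma dir_deriv_commute:
  "rpf p \<Longrightarrow> dir_deriv d (dir_deriv e p) = dir_deriv e (dir_deriv d p)"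
proof (induction rule: real_polynomial_function.induct)
  case (linear f)
  then have "\<And>e. dir_deriv e f = (\<lambda>x. f e)" by (auto simp: dir_deriv_linear)
  then show ?case by (auto simp: dir_deriv_const)
next
  case (const c)
  have "\<And>e. dir_deriv e (\<lambda>x. c) = (\<lambda>x. 0)" by (auto simp: dir_deriv_const)
  then show ?case by (auto simp: dir_deriv_const)
next
  case (add f g)
  then have 1: "\<And>e. dir_deriv e (\<lambda>x. f x + g x) = (\<lambda>x. dir_deriv e f x + dir_deriv e g x)"
    by (auto simp: dir_deriv_add rpf_differentiable)
  show ?case using add
    by (auto simp: 1 dir_deriv_add rpf_differentiable rpf_dir_deriv)
next
  case (mult f g)
  then have 1: "\<And>e. dir_deriv e (\<lambda>x. f x * g x) = (\<lambda>x. f x * dir_deriv e g x + dir_deriv e f x * g x)"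
    by (auto simp: dir_deriv_mult rpf_differentiable)
  have 2: "dir_deriv d (\<lambda>x. f x * dir_deriv e g x + dir_deriv e f x * g x) x =
     f x * dir_deriv d (dir_deriv e g) x + dir_deriv d f x * dir_deriv e g x +
     (dir_deriv e f x * dir_deriv d g x + dir_deriv d (dir_deriv e f) x * g x)" for d e x
    using mult(1,2)
    by (subst dir_deriv_add) (auto simp: dir_deriv_mult rpf_differentiable rpf_dir_deriv
        intro!: differentiable_mult)
  show ?case using mult by (auto simp: 1 2)
qed

lemma rpf_C1_fun: "rpf p \<Longrightarrow> C1_fun p"
  by (simp add: C1_fun_def rpf_differentiable rpf_continuous_on rpf_dir_deriv)

lemma C1_fun_continuous: "C1_fun f \<Longrightarrow> continuous_on S f"
  by (simp add: C1_fun_def continuous_at_imp_continuous_on differentiable_imp_continuous_within)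

lemma C1_fun_mult:
  assumes "C1_fun f" "C1_fun g" shows "C1_fun (\<lambda>x. f x * g x)"
proof -
  have "dir_deriv e (\<lambda>x. f x * g x) = (\<lambda>x. f x * dir_deriv e g x + dir_deriv e f x * g x)" for e
    using assms by (auto simp: C1_fun_def dir_deriv_mult)
  then show ?thesis using assms C1_fun_continuous[OF assms(1), of UNIV] C1_fun_continuous[OF assms(2), of UNIV]
    unfolding C1_fun_def by (auto intro!: differentiable_mult continuous_intros)
qed

lemma Ck_C1_fun:
  assumes "Ck (Suc 0) f" shows "C1_fun f"
proof -
  have d: "\<And>x. f differentiable at x" and c: "\<And>i. continuous_on UNIV (partial i f)"
    using assms by auto
  have "dir_deriv e f = (\<lambda>x. \<Sum>i\<in>UNIV. e $ i * partial i f x)" for e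
    using d by (auto simp: dir_deriv_eq_partials)
  then show ?thesis unfolding C1_fun_def using d c by (auto intro!: continuous_intros)
qed

lemma has_real_derivative_along_line:
  assumes "f differentiable at (x + s *\<^sub>R t)"
  shows "((\<lambda>s. f (x + s *\<^sub>R t)) has_real_derivative dir_deriv t f (x + s *\<^sub>R t)) (at s)"
proof -
  let ?D = "\<lambda>e. dir_deriv e f (x + s *\<^sub>R t)"
  have "((\<lambda>s. f (x + s *\<^sub>R t)) has_derivative (\<lambda>r. ?D (r *\<^sub>R t))) (at s)"
    by (rule has_derivative_compose[of "\<lambda>s. x + s *\<^sub>R t" _ _ _ f, OF _ has_derivative_dir_deriv[OF assms]])
      (auto intro!: derivative_eq_intros)
  moreover have "(\<lambda>r. ?D (r *\<^sub>R t)) = (*) (?D t)"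
    using linear_scale[OF linear_dir_deriv[OF assms]] by (auto simp: fun_eq_iff)
  ultimately show ?thesis
    by (simp add: has_field_derivative_def)
qed

text \<open>
  Along a line the polynomial is one in a single variable, with finitely many zeros unless all
  its coefficients vanish.
\<close>

lemma rpf_line_zero:
  fixes p :: "real^'n \<Rightarrow> real"
  assumes "rpf p"
    and inf: "infinite {s. p (x + s *\<^sub>R t) = 0}"
  shows "p (x + s *\<^sub>R t) = 0"
proof -
  have "rpf (p \<circ> (\<lambda>s. x + s *\<^sub>R t))"
  proof (rule real_polynomial_function_compose[OF _ assms(1)])
    have "polynomial_function (\<lambda>s::real. s *\<^sub>R t)"
      by (rule polynomial_function_bounded_linear) (rule bounded_linear_scaleR_left)
    then show "polynomial_function (\<lambda>s::real. x + s *\<^sub>R t)"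
      by auto
  qed
  then obtain a n where an: "p \<circ> (\<lambda>s. x + s *\<^sub>R t) = (\<lambda>s. \<Sum>i\<le>n. a i * s ^ i)"
    by (auto simp: real_polynomial_function_iff_sum)
  have e: "p (x + s *\<^sub>R t) = (\<Sum>i\<le>n. a i * s ^ i)" for s
    using fun_cong[OF an, of s] by simp
  have "infinite {s. (\<Sum>i\<le>n. a i * s ^ i) = 0}" using inf by (simp add: e)
  then have "\<forall>i\<le>n. a i = 0"
    using polyfun_rootbound by blast
  then show ?thesis by (simp add: e)
qed

text \<open>
  Join \<open>x\<close> to a point \<open>a\<close> of the relative interior. The line through them stays in \<open>S\<close> near
  \<open>a\<close>, which gives infinitely many zeros on it.
\<close>

lemma rpf_zero_affine_hull:
  fixes p :: "real^'n \<Rightarrow> real"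
  assumes p: "rpf p"
    and "convex S" "\<And>x. x \<in> S \<Longrightarrow> p x = 0" "x \<in> affine hull S"
  shows "p x = 0"
proof -
  have "S \<noteq> {}" using assms(4) by auto
  then obtain a where a: "a \<in> rel_interior S" using assms(2) rel_interior_eq_empty by blast
  obtain e where e: "e > 0" "cball a e \<inter> affine hull S \<subseteq> S"
    using a by (auto simp: mem_rel_interior_cball)
  have aS: "a \<in> affine hull S"
    using a hull_subset[of S affine] rel_interior_subset by blast
  have "p (a + s *\<^sub>R (x - a)) = 0" if s: "\<bar>s\<bar> * norm (x - a) \<le> e" for s
  proof -
    have "a + s *\<^sub>R (x - a) \<in> affine hull S"
      by (simp add: affine_affine_hull mem_affine_3_minus aS assms(4))
    moreover have "a + s *\<^sub>R (x - a) \<in> cball a e" using s by (simp add: dist_norm)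
    ultimately show ?thesis using e assms(3) by blast
  qed
  \<comment> \<open>adding 1 to the norm avoids a separate case \<open>x = a\<close>\<close>
  moreover have "s \<in> {0..e / (norm (x - a) + 1)} \<Longrightarrow> \<bar>s\<bar> * norm (x - a) \<le> e" for s
  proof -
    assume s: "s \<in> {0..e / (norm (x - a) + 1)}"
    have "s * norm (x - a) \<le> s * (norm (x-a) + 1)" using s by (simp add: mult_left_mono)
    also have "\<dots> \<le> e" using s by (simp add: pos_le_divide_eq add_nonneg_pos)
    finally show ?thesis using s by simp
  qed
  ultimately have "{0..e / (norm (x - a) + 1)} \<subseteq> {s. p (a + s *\<^sub>R (x - a)) = 0}" by auto
  moreover have "infinite {0..e / (norm (x - a) + 1)}"
    using e(1) by (simp add: infinite_Icc add_nonneg_pos)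
  ultimately have "p (a + 1 *\<^sub>R (x - a)) = 0"
    by (intro rpf_line_zero[OF p]) (meson finite_subset)
  then show ?thesis by simp
qed

abbreviation directions :: "'a::real_vector set \<Rightarrow> 'a set" where
  "directions F \<equiv> {x - y | x y. x \<in> F \<and> y \<in> F}"

lemma affine_hull_add_direction:
  assumes "t \<in> span (directions F)" "x \<in> affine hull F"
  shows "x + t \<in> affine hull F"
proof -
  have "\<forall>x\<in>affine hull F. x + t \<in> affine hull F" using assms(1)
  proof (induction rule: span_induct_alt)
    case base then show ?case by simp
  next
    case (step c u w)
    then obtain r s where "u = r - s" "r \<in> affine hull F" "s \<in> affine hull F" by (auto intro: hull_inc)
    then have "z + c *\<^sub>R u \<in> affine hull F" if "z \<in> affine hull F" for z
      using that by (auto intro!: mem_affine_3_minus[OF affine_affine_hull])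
    then show ?case using step(2) by (metis add.assoc)
  qed
  then show ?thesis using assms(2) by blast
qed

text \<open>
  A function that vanishes on a flat set has no derivative along it. Applied to the difference
  of two polynomials that agree on a face, this makes all tangential derivatives there
  single-valued.
\<close>

lemma dir_deriv_zero_affine_hull:
  fixes p :: "real^'n \<Rightarrow> real"
  assumes p: "rpf p"
    and z: "\<And>x. x \<in> affine hull S \<Longrightarrow> p x = 0"
    and t: "t \<in> span (directions S)" and x: "x \<in> affine hull S"
  shows "dir_deriv t p x = 0"
  using t
proof (induction rule: span_induct)
  case base
  show ?case
    using linear_subspace_kernel[OF linear_dir_deriv[OF rpf_differentiable[OF p]]] by simp
next
  case (step t)
  then obtain u v where t: "t = u - v" "u \<in> S" "v \<in> S" by auto
  have m: "x + s *\<^sub>R t \<in> affine hull S" for s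
    unfolding t(1) by (rule mem_affine_3_minus[OF affine_affine_hull x hull_inc[OF t(2)] hull_inc[OF t(3)]])
  have "((\<lambda>s. p (x + s *\<^sub>R t)) has_real_derivative dir_deriv t p (x + 0 *\<^sub>R t)) (at 0)"
    by (rule has_real_derivative_along_line) (simp add: rpf_differentiable p)
  moreover have "(\<lambda>s. p (x + s *\<^sub>R t)) = (\<lambda>s. 0)" using z[OF m] by (rule ext)
  ultimately have "((\<lambda>s::real. 0) has_real_derivative dir_deriv t p x) (at 0)" by simp
  then show ?case using DERIV_unique[OF _ DERIV_const] by blast
qed

lemma rpf_zero_UNIV:
  fixes p :: "real^'n \<Rightarrow> real"
  assumes p: "rpf p" and K: "interior K \<noteq> {}"
    and ae: "AE x in lebesgue_on K. p x = 0" and "K \<in> sets lebesgue"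
  shows "p = (\<lambda>x. 0)"
proof -
  obtain a e where e: "e > 0" "ball a e \<subseteq> K"
    using K by (metis ex_in_conv mem_interior)
  have z: "p x = 0" if "x \<in> ball a e" for x
  proof (rule ccontr)
    assume nz: "p x \<noteq> 0"
    let ?U = "ball a e \<inter> p -` (- {0})"
    have "open ?U"
      using rpf_continuous_on[OF p, of "ball a e"] by (simp add: continuous_on_open_vimage Int_commute open_Compl)
    moreover have "?U \<noteq> {}" using that nz by auto
    moreover have "negligible ?U"
    proof -
      have "AE x in lebesgue. x \<in> K \<longrightarrow> p x = 0"
        using ae assms(4) by (simp add: AE_restrict_space_iff)
      then have "negligible {x. \<not> (x \<in> K \<longrightarrow> p x = 0)}"
        by (simp add: negligible_iff_null_sets completion.AE_iff_null_sets)
      then show ?thesis by (rule negligible_subset) (use e in auto)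
    qed
    ultimately show False using open_not_negligible by blast
  qed
  have "affine hull (ball a e) = UNIV"
    using e affine_hull_open[of "ball a e"] by simp
  then show ?thesis using rpf_zero_affine_hull[OF p convex_ball z] by auto
qed

lemma Pk_rpf: "p \<in> Pk k \<Longrightarrow> rpf (p :: real^'n \<Rightarrow> real)"
proof -
  assume "p \<in> Pk k"
  then obtain c where p: "p = (\<lambda>x. \<Sum>\<alpha> | sum \<alpha> UNIV \<le> k. c \<alpha> * (\<Prod>i\<in>UNIV. (x $ i) ^ \<alpha> i))"
    by (auto simp: Pk_def)
  show ?thesis
  proof (cases "finite {\<alpha> :: 'n \<Rightarrow> nat. sum \<alpha> UNIV \<le> k}")
    case True
    show ?thesis unfolding p
      by (rule real_polynomial_function_sum[OF True])
        (intro real_polynomial_function.intros(2-4) real_polynomial_function_prod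
          real_polynomial_function_power real_polynomial_function.intros(1)[OF bounded_linear_vec_nth] finite)
  next
    case False
    then show ?thesis unfolding p by (simp add: real_polynomial_function.intros(2))
  qed
qed

text \<open>
  Two polynomials that agree almost everywhere on a set with interior points agree on a ball,
  hence everywhere.
\<close>

lemma piece_unique:
  assumes "interior K \<noteq> {}" "K \<in> sets lebesgue" "rpf p"
    "AE x in lebesgue_on K. v x = p x"
  shows "piece v K = p"
  unfolding piece_def
proof (rule the_equality)
  show "rpf p \<and> (AE x in lebesgue_on K. v x = p x)" using assms by auto
next
  fix q assume q: "rpf q \<and> (AE x in lebesgue_on K. v x = q x)"
  have "AE x in lebesgue_on K. q x - p x = 0" using q assms(4) by auto
  then have "(\<lambda>x. q x - p x) = (\<lambda>x. 0)"
    using q assms by (intro rpf_zero_UNIV[of _ K]) auto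
  then show "q = p" by (auto simp: fun_eq_iff)
qed

section \<open>Lebesgue measure in orthonormal coordinates\<close>

abbreviation lborel_PiM :: "'i set \<Rightarrow> ('i \<Rightarrow> real) measure" where
  "lborel_PiM I \<equiv> Pi\<^sub>M I (\<lambda>_. lborel)"

definition orthonormal :: "'a::euclidean_space set \<Rightarrow> bool" where
  "orthonormal B \<longleftrightarrow> pairwise orthogonal B \<and> (\<forall>b\<in>B. norm b = 1)"

lemma orthonormal_subset: "orthonormal B \<Longrightarrow> C \<subseteq> B \<Longrightarrow> orthonormal C"
  by (auto simp: orthonormal_def intro: pairwise_subset)

lemma orthonormal_inner:
  "orthonormal B \<Longrightarrow> b \<in> B \<Longrightarrow> c \<in> B \<Longrightarrow> b \<bullet> c = (if b = c then 1 else 0)"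
  by (auto simp: orthonormal_def pairwise_def orthogonal_def norm_eq_1)

lemma orthonormal_independent: "orthonormal B \<Longrightarrow> independent B"
  by (rule pairwise_orthogonal_independent) (auto simp: orthonormal_def)

lemma orthonormal_finite: "orthonormal B \<Longrightarrow> finite B"
  using orthonormal_independent independent_imp_finite by blast

lemma orthonormal_card: "orthonormal B \<Longrightarrow> card B = dim (span B)"
  by (simp add: dim_span dim_eq_card_independent orthonormal_independent)

lemma orthonormal_expansion:
  assumes "orthonormal B" "x \<in> span B"
  shows "(\<Sum>b\<in>B. (x \<bullet> b) *\<^sub>R b) = x"
proof (rule vector_eq_dot_span[OF _ assms(2)])
  show "(\<Sum>b\<in>B. (x \<bullet> b) *\<^sub>R b) \<in> span B"
    by (intro span_sum span_scale span_base)
  fix c assume c: "c \<in> B"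
  have "c \<bullet> (\<Sum>b\<in>B. (x \<bullet> b) *\<^sub>R b) = (\<Sum>b\<in>B. if b = c then x \<bullet> b else 0)"
    unfolding inner_sum_right by (rule sum.cong) (auto simp: orthonormal_inner[OF assms(1) c])
  then show "c \<bullet> (\<Sum>b\<in>B. (x \<bullet> b) *\<^sub>R b) = c \<bullet> x"
    using c orthonormal_finite[OF assms(1)] by (simp add: inner_commute)
qed

lemma orthonormal_inner_sum:
  assumes "orthonormal B" "c \<in> B"
  shows "c \<bullet> (\<Sum>b\<in>B. y b *\<^sub>R b) = y c"
proof -
  have "c \<bullet> (\<Sum>b\<in>B. y b *\<^sub>R b) = (\<Sum>b\<in>B. if b = c then y b else 0)"
    unfolding inner_sum_right by (rule sum.cong) (auto simp: orthonormal_inner[OF assms])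
  then show ?thesis using assms orthonormal_finite[OF assms(1)] by simp
qed

text \<open>
  The image \<open>N\<close> of Lebesgue measure under an isometry is again translation invariant and
  gives the unit ball \<open>E\<close> the same measure. Uniqueness of Haar measure in its elementary form
  finishes the proof: integrating \<open>1\<^sub>A(x) 1\<^sub>E(y - x)\<close> against \<open>dx dN(y)\<close> in both orders
  yields \<open>N(E) |A| = |E| N(A)\<close>.
\<close>

lemma lborel_distr_isometry:
  fixes R :: "'a::euclidean_space \<Rightarrow> 'a"
  assumes "orthogonal_transformation R"
  shows "distr lborel borel R = lborel"
proof (rule measure_eqI)
  show s: "sets (distr lborel borel R) = sets lborel" by simp
  fix A assume "A \<in> sets (distr lborel borel R)"
  then have A[measurable]: "A \<in> sets borel" by simp
  have lin: "linear R" and [measurable]: "R \<in> borel_measurable borel"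
    using assms orthogonal_transformation_linear
    by (auto intro!: borel_measurable_continuous_onI linear_continuous_on linear_conv_bounded_linear[THEN iffD1])
  let ?N = "distr lborel borel R"
  define E :: "'a set" where "E = ball 0 1"
  have [measurable]: "E \<in> sets borel" by (simp add: E_def)
  have NE: "emeasure ?N E = emeasure lborel E"
  proof -
    have "R -` E = E" using assms by (auto simp: orthogonal_transformation E_def)
    then show ?thesis by (simp add: emeasure_distr)
  qed
  interpret N: sigma_finite_measure ?N
  proof
    have "emeasure ?N (ball 0 (real n)) \<noteq> \<infinity>" for n
    proof -
      have "R -` ball 0 (real n) = ball 0 (real n)" using assms by (auto simp: orthogonal_transformation)
      then show ?thesis using emeasure_lborel_ball_finite[of "0::'a" "real n"] by (simp add: emeasure_distr)
    qed
    moreover have "(\<Union>n. ball 0 (real n)) = (UNIV::'a set)"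
      using reals_Archimedean2 by (auto simp: dist_norm)
    ultimately show "\<exists>A. countable A \<and> A \<subseteq> sets ?N \<and> \<Union>A = space ?N \<and> (\<forall>a\<in>A. emeasure ?N a \<noteq> \<infinity>)"
      by (intro exI[of _ "range (\<lambda>n. ball 0 (real n))"]) auto
  qed
  interpret P: pair_sigma_finite "lborel :: 'a measure" ?N ..
  obtain S where RS: "\<And>x. R (S x) = x"
    using orthogonal_transformation_surj[OF assms] by (metis surjD)
  have transl: "(\<integral>\<^sup>+y. f (y + x) \<partial>lborel) = (\<integral>\<^sup>+y. f y \<partial>lborel)"
    if [measurable]: "f \<in> borel_measurable borel" for f :: "'a \<Rightarrow> ennreal" and x
    by (subst (2) lborel_distr_plus[symmetric, of x]) (simp add: nn_integral_distr add.commute)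
  have translN: "(\<integral>\<^sup>+y. f (y + x) \<partial>?N) = (\<integral>\<^sup>+y. f y \<partial>?N)"
    if [measurable]: "f \<in> borel_measurable borel" for f :: "'a \<Rightarrow> ennreal" and x
  proof -
    have "(\<integral>\<^sup>+y. f (y + x) \<partial>?N) = (\<integral>\<^sup>+y. f (R (y + S x)) \<partial>lborel)"
      by (simp add: nn_integral_distr linear_add[OF lin] RS)
    also have "\<dots> = (\<integral>\<^sup>+y. f (R y) \<partial>lborel)" by (rule transl) simp
    finally show ?thesis by (simp add: nn_integral_distr)
  qed
  \<comment> \<open>The chain integrates \<open>1\<^sub>A(x) 1\<^sub>E(y - x)\<close>; after \<open>x \<mapsto> x + y\<close> it uses \<open>E = - E\<close>.\<close>
  have "emeasure ?N E * emeasure lborel A = (\<integral>\<^sup>+x. (\<integral>\<^sup>+y. indicator E y \<partial>?N) * indicator A x \<partial>lborel)"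
    by (simp add: nn_integral_cmult)
  also have "\<dots> = (\<integral>\<^sup>+x. (\<integral>\<^sup>+y. indicator E (y + (- x)) \<partial>?N) * indicator A x \<partial>lborel)"
    by (subst translN) (auto intro!: borel_measurable_indicator)
  also have "\<dots> = (\<integral>\<^sup>+x. (\<integral>\<^sup>+y. indicator E (y - x) * indicator A x \<partial>?N) \<partial>lborel)"
  proof (intro nn_integral_cong)
    fix x :: 'a
    have "(\<lambda>y. indicator E (y - x) :: ennreal) \<in> borel_measurable ?N" by measurable
    then show "(\<integral>\<^sup>+y. indicator E (y + (- x)) \<partial>?N) * indicator A x =
        (\<integral>\<^sup>+y. indicator E (y - x) * indicator A x \<partial>?N)"
      by (simp add: nn_integral_multc)
  qed
  also have "\<dots> = (\<integral>\<^sup>+y. (\<integral>\<^sup>+x. indicator E (y - x) * indicator A x \<partial>lborel) \<partial>?N)"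
    by (subst P.Fubini') (auto simp: case_prod_beta)
  also have "\<dots> = (\<integral>\<^sup>+y. (\<integral>\<^sup>+x. indicator E (y - (x + y)) * indicator A (x + y) \<partial>lborel) \<partial>?N)"
    by (intro nn_integral_cong transl[symmetric]) auto
  also have "\<dots> = (\<integral>\<^sup>+y. (\<integral>\<^sup>+x. indicator E (x) * indicator A (x + y) \<partial>lborel) \<partial>?N)"
    by (intro nn_integral_cong) (auto simp: indicator_def E_def)
  also have "\<dots> = (\<integral>\<^sup>+x. (\<integral>\<^sup>+y. indicator E (x) * indicator A (x + y) \<partial>?N) \<partial>lborel)"
    by (subst P.Fubini') (auto simp: case_prod_beta)
  also have "\<dots> = (\<integral>\<^sup>+x. indicator E x * (\<integral>\<^sup>+y. indicator A (y + x) \<partial>?N) \<partial>lborel)"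
    by (intro nn_integral_cong) (simp add: nn_integral_cmult add.commute)
  also have "\<dots> = (\<integral>\<^sup>+x. indicator E x * (\<integral>\<^sup>+y. indicator A y \<partial>?N) \<partial>lborel)"
    by (subst translN) auto
  also have "\<dots> = emeasure lborel E * emeasure ?N A"
    by (simp add: nn_integral_multc)
  finally have "emeasure lborel E * emeasure lborel A = emeasure lborel E * emeasure ?N A"
    by (simp add: NE)
  moreover have "emeasure lborel E \<noteq> 0"
    using open_not_negligible[of E] by (auto simp: E_def negligible_iff_null_sets null_setsI)
  moreover have "emeasure lborel E \<noteq> \<infinity>" using emeasure_lborel_ball_finite[of "0::'a" 1] by (simp add: E_def)
  ultimately show "emeasure ?N A = emeasure lborel A"
    by (simp add: ennreal_mult_cancel_left)
qed

lemma sum_PiM_measurable: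
  fixes B :: "'a::euclidean_space set"
  assumes "finite B"
  shows "(\<lambda>y. a + (\<Sum>b\<in>B. y b *\<^sub>R b)) \<in> borel_measurable (lborel_PiM B)" (is "?f \<in> _")
    "(\<lambda>y. (\<Sum>b\<in>B. y b *\<^sub>R b)) \<in> borel_measurable (lborel_PiM B)"
proof -
  have *[measurable]: "(\<lambda>y. y b) \<in> borel_measurable (lborel_PiM B)" if "b \<in> B" for b
    using measurable_component_singleton[OF that, of "\<lambda>_. lborel"] by simp
  have 1: "(\<lambda>y. (\<Sum>b\<in>B. y b *\<^sub>R b)) \<in> borel_measurable (lborel_PiM B)"
    by (rule borel_measurable_sum) (rule borel_measurable_scaleR[OF * borel_measurable_const])
  show "?f \<in> borel_measurable (lborel_PiM B)"
    by (rule borel_measurable_add[OF borel_measurable_const 1])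
  show "(\<lambda>y. (\<Sum>b\<in>B. y b *\<^sub>R b)) \<in> borel_measurable (lborel_PiM B)" by (rule 1)
qed

interpretation lebesgue_product: product_sigma_finite "\<lambda>_. lborel :: real measure"
  by standard

lemma PiM_lborel_reindex:
  assumes "bij_betw \<sigma> I J" "finite I"
  shows "lborel_PiM J =
    distr (lborel_PiM I) (lborel_PiM J) (\<lambda>f. \<lambda>j\<in>J. f (inv_into I \<sigma> j))"
proof (rule lebesgue_product.PiM_eqI[symmetric])
  let ?\<tau> = "inv_into I \<sigma>"
  have \<tau>: "bij_betw ?\<tau> J I" by (rule bij_betw_inv_into[OF assms(1)])
  have m[measurable]: "(\<lambda>f. \<lambda>j\<in>J. f (?\<tau> j)) \<in> measurable (lborel_PiM I) (lborel_PiM J)"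
    using bij_betwE[OF \<tau>] by (intro measurable_restrict measurable_component_singleton) auto
  show "finite J" using assms bij_betw_finite by blast
  show "sets (distr (lborel_PiM I) (lborel_PiM J) (\<lambda>f. \<lambda>j\<in>J. f (?\<tau> j))) = sets (lborel_PiM J)"
    by simp
  fix A :: "'b \<Rightarrow> real set" assume A: "\<And>i. i \<in> J \<Longrightarrow> A i \<in> sets lborel"
  have S: "Pi\<^sub>E J A \<in> sets (lborel_PiM J)"
    using A \<open>finite J\<close> by (intro sets_PiM_I_finite) auto
  have "(\<lambda>f. \<lambda>j\<in>J. f (?\<tau> j)) -` Pi\<^sub>E J A \<inter> space (lborel_PiM I) = Pi\<^sub>E I (\<lambda>i. A (\<sigma> i))" (is "?L = ?R")
  proof (intro set_eqI iffI)
    fix f assume f: "f \<in> ?L"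
    have "f i \<in> A (\<sigma> i)" if "i \<in> I" for i
    proof -
      have "\<sigma> i \<in> J" "?\<tau> (\<sigma> i) = i" using that assms(1) by (auto simp: bij_betw_def)
      moreover have "(\<lambda>j\<in>J. f (?\<tau> j)) (\<sigma> i) \<in> A (\<sigma> i)" using f \<open>\<sigma> i \<in> J\<close> by (auto simp: PiE_iff)
      ultimately show ?thesis by simp
    qed
    then show "f \<in> ?R" using f by (auto simp: space_PiM PiE_iff)
  next
    fix f assume f: "f \<in> ?R"
    have "f (?\<tau> j) \<in> A j" if "j \<in> J" for j
    proof -
      have "?\<tau> j \<in> I" "\<sigma> (?\<tau> j) = j" using that \<tau> assms(1)
        by (auto simp: bij_betw_def f_inv_into_f inv_into_into)
      then show ?thesis using f by (metis PiE_mem)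
    qed
    then show "f \<in> ?L" using f by (auto simp: space_PiM PiE_iff)
  qed
  then have "emeasure (distr (lborel_PiM I) (lborel_PiM J) (\<lambda>f. \<lambda>j\<in>J. f (?\<tau> j))) (Pi\<^sub>E J A)
     = emeasure (lborel_PiM I) (Pi\<^sub>E I (\<lambda>i. A (\<sigma> i)))"
    by (simp add: emeasure_distr[OF m S])
  also have "\<dots> = (\<Prod>i\<in>I. emeasure lborel (A (\<sigma> i)))"
    using A assms by (intro lebesgue_product.emeasure_PiM) (auto simp: bij_betw_def)
  also have "\<dots> = (\<Prod>j\<in>J. emeasure lborel (A j))"
    by (rule prod.reindex_bij_betw[OF assms(1)])
  finally show "emeasure (distr (lborel_PiM I) (lborel_PiM J) (\<lambda>f. \<lambda>j\<in>J. f (?\<tau> j))) (Pi\<^sub>E J A)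
     = (\<Prod>j\<in>J. emeasure lborel (A j))" .
qed

text \<open>
  Lebesgue measure may be computed in the coordinates of any orthonormal basis: the standard
  basis is carried to \<open>B\<close> by an isometry. With \<open>B\<close> a tangent frame of a facet plus its
  normal, this is what relates volume integrals to the coordinate integrals by which
  \<^const>\<open>face_integral\<close> is defined.
\<close>

lemma lborel_eq_distr_orthonormal:
  fixes B :: "'a::euclidean_space set"
  assumes B: "orthonormal B" and sp: "span B = UNIV"
  shows "lborel = distr (lborel_PiM B) borel (\<lambda>y. \<Sum>b\<in>B. y b *\<^sub>R b)"
proof -
  have fin: "finite B" by (rule orthonormal_finite[OF B])
  have "card B = card (Basis :: 'a set)"
    using orthonormal_card[OF B] by (simp add: sp dim_UNIV)
  then obtain \<sigma> where \<sigma>: "bij_betw \<sigma> (Basis :: 'a set) B"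
    using finite_same_card_bij[OF finite_Basis fin] by metis
  define R where "R x = (\<Sum>i\<in>Basis. (x \<bullet> i) *\<^sub>R \<sigma> i)" for x
  have \<sigma>i: "\<sigma> i \<bullet> \<sigma> j = (if i = j then 1 else 0)" if "i \<in> Basis" "j \<in> Basis" for i j
    using orthonormal_inner[OF B, of "\<sigma> i" "\<sigma> j"] \<sigma> that by (auto simp: bij_betw_def inj_on_def)
  have "R x \<bullet> R y = x \<bullet> y" for x y
  proof -
    have "R x \<bullet> R y = (\<Sum>i\<in>Basis. \<Sum>j\<in>Basis. if i = j then (x \<bullet> i) * (y \<bullet> j) else 0)"
      unfolding R_def inner_sum_left inner_sum_right
      by (subst sum.swap) (intro sum.cong refl, auto simp: \<sigma>i)
    also have "\<dots> = x \<bullet> y" by (simp add: euclidean_inner[of x y])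
    finally show ?thesis .
  qed
  moreover have "linear R"
    by (rule linearI) (simp_all add: R_def inner_simps scaleR_add_left sum.distrib scaleR_sum_right)
  ultimately have R: "orthogonal_transformation R" by (simp add: orthogonal_transformation_def)
  have Rm[measurable]: "R \<in> borel_measurable borel"
    using \<open>linear R\<close> by (auto intro!: borel_measurable_continuous_onI linear_continuous_on linear_conv_bounded_linear[THEN iffD1])
  let ?\<tau> = "inv_into Basis \<sigma>"
  have \<tau>: "bij_betw ?\<tau> B Basis" by (rule bij_betw_inv_into[OF \<sigma>])
  have m[measurable]: "(\<lambda>f. \<lambda>j\<in>B. f (?\<tau> j)) \<in> measurable (lborel_PiM Basis) (lborel_PiM B)"
    using bij_betwE[OF \<tau>] by (intro measurable_restrict measurable_component_singleton) auto
  note [measurable] = sum_PiM_measurable[OF fin] sum_PiM_measurable[OF finite_Basis]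
  have "distr (lborel_PiM B) borel (\<lambda>y. \<Sum>b\<in>B. y b *\<^sub>R b) =
     distr (lborel_PiM Basis) borel ((\<lambda>y. \<Sum>b\<in>B. y b *\<^sub>R b) \<circ> (\<lambda>f. \<lambda>j\<in>B. f (?\<tau> j)))"
    by (subst PiM_lborel_reindex[OF \<sigma> finite_Basis]) (simp add: distr_distr)
  also have "(\<lambda>y. \<Sum>b\<in>B. y b *\<^sub>R b) \<circ> (\<lambda>f. \<lambda>j\<in>B. f (?\<tau> j)) = R \<circ> (\<lambda>f. \<Sum>b\<in>Basis. f b *\<^sub>R b)"
  proof
    fix f :: "'a \<Rightarrow> real"
    have "(\<Sum>b\<in>B. f (?\<tau> b) *\<^sub>R b) = (\<Sum>i\<in>Basis. f (?\<tau> (\<sigma> i)) *\<^sub>R \<sigma> i)"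
      by (rule sum.reindex_bij_betw[OF \<sigma>, symmetric])
    also have "\<dots> = R (\<Sum>b\<in>Basis. f b *\<^sub>R b)"
      unfolding R_def using \<sigma> by (intro sum.cong) (auto simp: bij_betw_def inner_sum_left inner_Basis if_distrib cong: if_cong)
    finally show "((\<lambda>y. \<Sum>b\<in>B. y b *\<^sub>R b) \<circ> (\<lambda>f. \<lambda>j\<in>B. f (?\<tau> j))) f = (R \<circ> (\<lambda>f. \<Sum>b\<in>Basis. f b *\<^sub>R b)) f"
      by simp
  qed
  also have "distr (lborel_PiM Basis) borel (R \<circ> (\<lambda>f. \<Sum>b\<in>Basis. f b *\<^sub>R b)) =
     distr (distr (lborel_PiM Basis) borel (\<lambda>f. \<Sum>b\<in>Basis. f b *\<^sub>R b)) borel R"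
    by (simp add: distr_distr)
  also have "\<dots> = distr lborel borel R" by (simp add: lborel_eq[symmetric])
  also have "\<dots> = lborel" by (rule lborel_distr_isometry[OF R])
  finally show ?thesis by simp
qed

lemma PiM_lborel_affine_measurable:
  "(\<lambda>y. \<lambda>i\<in>I. d i + c * y i) \<in> measurable (lborel_PiM I) (lborel_PiM I)"
proof (rule measurable_restrict)
  fix i assume "i \<in> I"
  then have [measurable]: "(\<lambda>y. y i) \<in> borel_measurable (lborel_PiM I)"
    using measurable_component_singleton[of i I "\<lambda>_. lborel"] by simp
  show "(\<lambda>y. d i + c * y i) \<in> measurable (lborel_PiM I) lborel" by measurable
qed

text \<open>
  On boxes this is the one-dimensional affine substitution in each factor.
\<close>

lemma PiM_lborel_affine:
  fixes c :: real and d :: "'i \<Rightarrow> real"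
  assumes "finite I" "c \<noteq> 0"
  shows "lborel_PiM I =
    density (distr (lborel_PiM I) (lborel_PiM I) (\<lambda>y. \<lambda>i\<in>I. d i + c * y i))
       (\<lambda>_. ennreal (\<bar>c\<bar> ^ card I))"
proof (rule lebesgue_product.PiM_eqI[OF assms(1), symmetric])
  let ?T = "\<lambda>y. \<lambda>i\<in>I. d i + c * y i"
  let ?P = "lborel_PiM I"
  note m[measurable] = PiM_lborel_affine_measurable[of d c I]
  show "sets (density (distr ?P ?P ?T) (\<lambda>_. ennreal (\<bar>c\<bar> ^ card I))) = sets ?P" by simp
  fix A :: "'i \<Rightarrow> real set" assume A: "\<And>i. i \<in> I \<Longrightarrow> A i \<in> sets lborel"
  have S: "Pi\<^sub>E I A \<in> sets ?P"
    using A assms(1) by (intro sets_PiM_I_finite) auto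
  have V: "?T -` Pi\<^sub>E I A \<inter> space ?P = Pi\<^sub>E I (\<lambda>i. (\<lambda>x. d i + c * x) -` A i)"
    by (auto simp: space_PiM PiE_iff)
  have e: "emeasure lborel (A i) = ennreal \<bar>c\<bar> * emeasure lborel ((\<lambda>x. d i + c * x) -` A i)" if "i \<in> I" for i
  proof -
    have [measurable]: "A i \<in> sets borel" using A that by auto
    show ?thesis
      by (subst lborel_real_affine[OF assms(2), of "d i"])
        (simp add: emeasure_density nn_integral_cmult emeasure_distr)
  qed
  have "emeasure (density (distr ?P ?P ?T) (\<lambda>_. ennreal (\<bar>c\<bar> ^ card I))) (Pi\<^sub>E I A) =
     ennreal (\<bar>c\<bar> ^ card I) * emeasure ?P (Pi\<^sub>E I (\<lambda>i. (\<lambda>x. d i + c * x) -` A i))"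
    using S by (simp add: emeasure_density nn_integral_cmult emeasure_distr[OF m S] V)
  also have "\<dots> = ennreal (\<bar>c\<bar> ^ card I) * (\<Prod>i\<in>I. emeasure lborel ((\<lambda>x. d i + c * x) -` A i))"
  proof -
    have "(\<lambda>x. d i + c * x) -` A i \<in> sets lborel" if "i \<in> I" for i
      using measurable_sets[of "\<lambda>x. d i + c * x" lborel lborel "A i"] A[OF that] by simp
    then show ?thesis using assms by (subst lebesgue_product.emeasure_PiM) auto
  qed
  also have "\<dots> = (\<Prod>i\<in>I. ennreal \<bar>c\<bar> * emeasure lborel ((\<lambda>x. d i + c * x) -` A i))"
    by (simp add: prod.distrib ennreal_power)
  finally show "emeasure (density (distr ?P ?P ?T) (\<lambda>_. ennreal (\<bar>c\<bar> ^ card I))) (Pi\<^sub>E I A) =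
     (\<Prod>i\<in>I. emeasure lborel (A i))"
    by (simp add: e)
qed

lemma PiM_lborel_integral_affine:
  fixes c :: real and f :: "('i \<Rightarrow> real) \<Rightarrow> real"
  assumes "finite I" "c \<noteq> 0" and f[measurable]: "f \<in> borel_measurable (lborel_PiM I)"
  shows "integral\<^sup>L (lborel_PiM I) f =
    \<bar>c\<bar> ^ card I * integral\<^sup>L (lborel_PiM I) (\<lambda>y. f (\<lambda>i\<in>I. d i + c * y i))"
proof -
  let ?T = "\<lambda>y. \<lambda>i\<in>I. d i + c * y i"
  let ?P = "lborel_PiM I"
  note m[measurable] = PiM_lborel_affine_measurable[of d c I]
  show ?thesis
    by (subst PiM_lborel_affine[OF assms(1,2), of d])
      (simp add: integral_density integral_distr)
qed

lemma PiM_lborel_integral_insert: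
  fixes f :: "('i \<Rightarrow> real) \<Rightarrow> real"
  assumes B: "finite B" "i \<notin> B" and f: "integrable (lborel_PiM (insert i B)) f"
  shows "integral\<^sup>L (lborel_PiM (insert i B)) f = (\<integral>t. (\<integral>y. f (y(i := t)) \<partial>lborel_PiM B) \<partial>lborel)"
proof -
  let ?P = "lborel_PiM B"
  interpret P: sigma_finite_measure ?P by (rule lebesgue_product.sigma_finite[OF B(1)])
  have fm[measurable]: "f \<in> borel_measurable (lborel_PiM (insert i B))" using f by (rule borel_measurable_integrable)
  have "(\<lambda>z. (snd z)(i := fst z)) \<in> measurable (lborel \<Otimes>\<^sub>M ?P) (lborel_PiM (insert i B))"
    using measurable_comp[OF measurable_pair_swap' measurable_add_dim[of i B "\<lambda>_. lborel"]]
    by (simp add: comp_def split_beta)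
  from measurable_comp[OF this fm]
  have m: "(\<lambda>(t, y). f (y(i := t))) \<in> borel_measurable (lborel \<Otimes>\<^sub>M ?P)" by (simp add: comp_def split_beta)
  have "integral\<^sup>L (lborel_PiM (insert i B)) f = integral\<^sup>L (lborel_PiM ({i} \<union> B)) f" by simp
  also have "\<dots> = (\<integral>x. (\<integral>y. f (merge {i} B (x, y)) \<partial>?P) \<partial>lborel_PiM {i})"
    by (rule lebesgue_product.product_integral_fold) (use B f in auto)
  also have "\<dots> = (\<integral>x. (\<integral>y. f (y(i := x i)) \<partial>?P) \<partial>lborel_PiM {i})"
  proof (intro Bochner_Integration.integral_cong refl)
    fix x y assume "x \<in> space (lborel_PiM {i})" "y \<in> space ?P"
    then have "merge {i} B (x, y) = y(i := x i)"
      by (intro ext) (auto simp: merge_def space_PiM PiE_def extensional_def)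
    then show "f (merge {i} B (x, y)) = f (y(i := x i))" by simp
  qed
  also have "\<dots> = (\<integral>t. (\<integral>y. f (y(i := t)) \<partial>?P) \<partial>lborel)"
    by (rule lebesgue_product.product_integral_singleton)
      (use P.borel_measurable_lebesgue_integral[OF m] in simp)
  finally show ?thesis .
qed

section \<open>Integration over cones and flat faces\<close>

text \<open>
  The integral behind \<^const>\<open>face_integral\<close>, with the orthonormal frame and the base point as
  parameters.
\<close>

definition frame_integral :: "'a::euclidean_space set \<Rightarrow> 'a \<Rightarrow> 'a set \<Rightarrow> ('a \<Rightarrow> real) \<Rightarrow> real" where
  "frame_integral B a F f = integral\<^sup>L (lborel_PiM B)
     (\<lambda>y. indicator F (a + (\<Sum>b\<in>B. y b *\<^sub>R b)) * f (a + (\<Sum>b\<in>B. y b *\<^sub>R b)))"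

lemma abs_le_interval: "\<bar>x::real\<bar> \<le> r \<Longrightarrow> x \<in> {- r..r}"
  by (simp add: abs_le_iff minus_le_iff)

lemma orthonormal_coordinate_bound:
  assumes "orthonormal B" "b \<in> B"
  shows "\<bar>y b\<bar> \<le> norm (\<Sum>b\<in>B. y b *\<^sub>R b)"
proof -
  have "\<bar>b \<bullet> (\<Sum>b\<in>B. y b *\<^sub>R b)\<bar> \<le> norm b * norm (\<Sum>b\<in>B. y b *\<^sub>R b)"
    by (rule Cauchy_Schwarz_ineq2)
  then show ?thesis using assms by (simp add: orthonormal_inner_sum orthonormal_def)
qed

lemma emeasure_PiM_lborel_box_finite:
  assumes "finite B"
  shows "emeasure (lborel_PiM B) (\<Pi>\<^sub>E b\<in>B. {l..u}) < \<infinity>"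
  using assms by (subst lebesgue_product.emeasure_PiM)
    (simp_all add: power_less_top_ennreal emeasure_lborel_Icc_eq del: emeasure_lborel_Icc)

text \<open>
  The points of a bounded set have bounded coordinates; the box \<open>D\<close> makes bounded integrands
  on \<open>F\<close> integrable.
\<close>

lemma frame_box:
  fixes F :: "'a::euclidean_space set"
  assumes B: "orthonormal B" and F: "bounded F"
  obtains D where "D \<in> sets (lborel_PiM B)"
    "emeasure (lborel_PiM B) D < \<infinity>"
    "\<And>y. y \<in> space (lborel_PiM B) \<Longrightarrow> a + (\<Sum>b\<in>B. y b *\<^sub>R b) \<in> F \<Longrightarrow> y \<in> D"
proof -
  note fin = orthonormal_finite[OF B]
  obtain r where r: "\<And>x. x \<in> F \<Longrightarrow> norm x \<le> r" using F bounded_iff by blast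
  define r' where "r' = r + norm a"
  define D where "D = (\<Pi>\<^sub>E b\<in>B. {-r'..r'})"
  show ?thesis
  proof (rule that)
    show "D \<in> sets (lborel_PiM B)"
      unfolding D_def by (rule sets_PiM_I_finite[OF fin]) auto
    show "emeasure (lborel_PiM B) D < \<infinity>"
      unfolding D_def by (rule emeasure_PiM_lborel_box_finite[OF fin])
    fix y :: "'a \<Rightarrow> real"
    assume y: "y \<in> space (lborel_PiM B)" and "a + (\<Sum>b\<in>B. y b *\<^sub>R b) \<in> F"
    then have "norm (a + (\<Sum>b\<in>B. y b *\<^sub>R b)) \<le> r" using r by blast
    then have n: "norm (\<Sum>b\<in>B. y b *\<^sub>R b) \<le> r'"
      unfolding r'_def using norm_diff_ineq[of "\<Sum>b\<in>B. y b *\<^sub>R b" a] by (simp add: add.commute)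
    have "\<bar>y b\<bar> \<le> r'" if "b \<in> B" for b
      by (rule order_trans[OF orthonormal_coordinate_bound[OF B that] n])
    then have "y b \<in> {- r'..r'}" if "b \<in> B" for b
      by (rule abs_le_interval) (use that in blast)
    then show "y \<in> D" using y unfolding D_def space_PiM PiE_iff by blast
  qed
qed

lemma frame_integrable:
  fixes F :: "'a::euclidean_space set"
  assumes B: "orthonormal B" and F: "compact F" and f: "continuous_on UNIV f"
  shows "integrable (lborel_PiM B)
     (\<lambda>y. indicator F (a + (\<Sum>b\<in>B. y b *\<^sub>R b)) * (f (a + (\<Sum>b\<in>B. y b *\<^sub>R b)) :: real))"
proof -
  note fin = orthonormal_finite[OF B]
  obtain D where D: "D \<in> sets (lborel_PiM B)"
    "emeasure (lborel_PiM B) D < \<infinity>"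
    "\<And>y. y \<in> space (lborel_PiM B) \<Longrightarrow> a + (\<Sum>b\<in>B. y b *\<^sub>R b) \<in> F \<Longrightarrow> y \<in> D"
    by (rule frame_box[OF B compact_imp_bounded[OF F], of a]) blast
  obtain C where C: "\<And>x. x \<in> F \<Longrightarrow> norm (f x) \<le> C"
    using compact_imp_bounded[OF compact_continuous_image[OF continuous_on_subset[OF f] F]]
    unfolding bounded_iff by auto
  have [measurable]: "f \<in> borel_measurable borel" using f by (rule borel_measurable_continuous_onI)
  have [measurable]: "F \<in> sets borel" using F by (simp add: borel_compact)
  note [measurable] = sum_PiM_measurable[OF fin]
  show ?thesis
  proof (rule integrableI_bounded_set[OF D(1) _ D(2), where B="\<bar>C\<bar>"])
    show "AE y in lborel_PiM B. y \<notin> D \<longrightarrow>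
        indicator F (a + (\<Sum>b\<in>B. y b *\<^sub>R b)) * f (a + (\<Sum>b\<in>B. y b *\<^sub>R b)) = 0"
      using D(3) by (intro AE_I2) (auto simp: indicator_def)
    show "AE y in lborel_PiM B. y \<in> D \<longrightarrow>
        norm (indicator F (a + (\<Sum>b\<in>B. y b *\<^sub>R b)) * f (a + (\<Sum>b\<in>B. y b *\<^sub>R b))) \<le> \<bar>C\<bar>"
      using C by (intro AE_I2) (auto simp: indicator_def intro: order_trans[OF _ abs_ge_self])
  qed measurable
qed

lemma frame_integral_cong:
  "(\<And>x. x \<in> F \<Longrightarrow> f x = g x) \<Longrightarrow> frame_integral B a F f = frame_integral B a F g"
  unfolding frame_integral_def by (intro Bochner_Integration.integral_cong) (auto simp: indicator_def)

lemma integral_translate_orthonormal: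
  fixes f :: "'a::euclidean_space \<Rightarrow> real"
  assumes B: "orthonormal B" and sp: "span B = UNIV" and [measurable]: "f \<in> borel_measurable borel"
  shows "integral\<^sup>L lborel f = integral\<^sup>L (lborel_PiM B) (\<lambda>y. f (v + (\<Sum>b\<in>B. y b *\<^sub>R b)))"
proof -
  note [measurable] = sum_PiM_measurable[OF orthonormal_finite[OF B]]
  have "integral\<^sup>L lborel f = integral\<^sup>L (distr lborel borel ((+) v)) f"
    by (simp add: lborel_distr_plus)
  also have "\<dots> = integral\<^sup>L lborel (\<lambda>x. f (v + x))" by (simp add: integral_distr)
  also have "\<dots> = integral\<^sup>L (distr (lborel_PiM B) borel (\<lambda>y. \<Sum>b\<in>B. y b *\<^sub>R b)) (\<lambda>x. f (v + x))"
    by (simp add: lborel_eq_distr_orthonormal[OF B sp, symmetric])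
  also have "\<dots> = integral\<^sup>L (lborel_PiM B) (\<lambda>y. f (v + (\<Sum>b\<in>B. y b *\<^sub>R b)))"
    by (subst integral_distr) auto
  finally show ?thesis .
qed

definition cone_over :: "'a::euclidean_space \<Rightarrow> 'a set \<Rightarrow> 'a set" where
  "cone_over v F = {v + s *\<^sub>R (y - v) | s y. s \<in> {0..1} \<and> y \<in> F}"

text \<open>
  Polar coordinates centred at the apex. The slice of the cone at height \<open>s h\<close> over the apex
  is the copy of the base \<open>F\<close> scaled by \<open>s\<close>, so it contributes the factor \<open>s\<^bsup>card B\<^esup>\<close>, and
  \<open>h\<close> is the distance of the apex from the hyperplane of the base.
\<close>

lemma cone_integral:
  fixes f :: "'a::euclidean_space \<Rightarrow> real"
  assumes on: "orthonormal (insert \<nu> B)" and \<nu>: "\<nu> \<notin> B" and sp: "span (insert \<nu> B) = UNIV"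
    and F: "compact F" "\<And>y. y \<in> F \<Longrightarrow> \<nu> \<bullet> y = \<nu> \<bullet> a" and h: "\<nu> \<bullet> (a - v) > 0"
    and K: "compact (cone_over v F)" and f: "continuous_on UNIV f"
  shows "integral\<^sup>L lborel (\<lambda>x. indicator (cone_over v F) x * f x) =
    (\<nu> \<bullet> (a - v)) * integral\<^sup>L (lborel_PiM B)
      (\<lambda>y. indicator F (a + (\<Sum>b\<in>B. y b *\<^sub>R b)) *
        integral\<^sup>L lborel (\<lambda>s. indicator {0..1} s *\<^sub>R (s ^ card B * f (v + s *\<^sub>R (a + (\<Sum>b\<in>B. y b *\<^sub>R b) - v)))))"
proof -
  let ?P = "lborel_PiM B"
  let ?K = "cone_over v F" and ?S = "\<lambda>y. \<Sum>b\<in>B. y b *\<^sub>R b"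
  define h where "h = \<nu> \<bullet> (a - v)"
  have hp: "h > 0" using h by (simp add: h_def)
  have B: "orthonormal B" by (rule orthonormal_subset[OF on]) auto
  note fin = orthonormal_finite[OF B]
  have \<nu>1: "\<nu> \<bullet> \<nu> = 1" using on by (simp add: orthonormal_def norm_eq_1)
  have \<nu>B: "\<nu> \<bullet> b = 0" if "b \<in> B" for b using orthonormal_inner[OF on, of \<nu> b] that \<nu> by auto
  have \<nu>S: "\<nu> \<bullet> ?S y = 0" for y by (simp add: inner_sum_right \<nu>B)
  have [measurable]: "f \<in> borel_measurable borel" using f by (rule borel_measurable_continuous_onI)
  have [measurable]: "F \<in> sets borel" "?K \<in> sets borel" using F K by (auto simp: borel_compact)
  note [measurable] = sum_PiM_measurable[OF fin]
  interpret P: sigma_finite_measure ?P by (rule lebesgue_product.sigma_finite[OF fin])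
  interpret Q: pair_sigma_finite "lborel :: real measure" ?P ..
  define g where "g x = indicator ?K x * f x" for x
  have [measurable]: "g \<in> borel_measurable borel" unfolding g_def by measurable
  obtain C where C: "\<And>x. x \<in> ?K \<Longrightarrow> \<bar>f x\<bar> \<le> C"
    using compact_imp_bounded[OF compact_continuous_image[OF continuous_on_subset[OF f] K]]
    unfolding bounded_iff by auto
  have int0: "integrable (lborel_PiM (insert \<nu> B)) (\<lambda>y. g (v + (\<Sum>b\<in>insert \<nu> B. y b *\<^sub>R b)))"
    unfolding g_def by (rule frame_integrable[OF on K f])
  have "integral\<^sup>L lborel g = integral\<^sup>L (lborel_PiM (insert \<nu> B)) (\<lambda>y. g (v + (\<Sum>b\<in>insert \<nu> B. y b *\<^sub>R b)))"
    by (rule integral_translate_orthonormal[OF on sp]) simp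
  also have "\<dots> = (\<integral>t. (\<integral>y. g (v + (\<Sum>b\<in>insert \<nu> B. (y(\<nu> := t)) b *\<^sub>R b)) \<partial>?P) \<partial>lborel)"
    by (rule PiM_lborel_integral_insert[OF fin \<nu> int0])
  also have "\<dots> = (\<integral>t. (\<integral>y. g (v + (t *\<^sub>R \<nu> + ?S y)) \<partial>?P) \<partial>lborel)"
  proof -
    have "(\<Sum>b\<in>insert \<nu> B. (y(\<nu> := t)) b *\<^sub>R b) = t *\<^sub>R \<nu> + ?S y" for y t
      using fin \<nu> by (simp, intro sum.cong, auto)
    then show ?thesis by simp
  qed
  also have "\<dots> = h * (\<integral>s. (\<integral>y. g (v + ((h * s) *\<^sub>R \<nu> + ?S y)) \<partial>?P) \<partial>lborel)"
    using lborel_integral_real_affine[of h "\<lambda>t. \<integral>y. g (v + (t *\<^sub>R \<nu> + ?S y)) \<partial>?P" 0] hp by simp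
  also have "(\<integral>s. (\<integral>y. g (v + ((h * s) *\<^sub>R \<nu> + ?S y)) \<partial>?P) \<partial>lborel) =
     (\<integral>s. (\<integral>y. indicator {0..1} s * (s ^ card B * (indicator F (a + ?S y) * f (v + s *\<^sub>R (a + ?S y - v)))) \<partial>?P) \<partial>lborel)"
  proof (rule integral_cong_AE)
    show "AE s in lborel. (\<integral>y. g (v + ((h * s) *\<^sub>R \<nu> + ?S y)) \<partial>?P) =
       (\<integral>y. indicator {0..1} s * (s ^ card B * (indicator F (a + ?S y) * f (v + s *\<^sub>R (a + ?S y - v)))) \<partial>?P)"
      \<comment> \<open>at \<open>s = 0\<close> the slice degenerates to the apex and cannot be rescaled\<close>
      using AE_lborel_singleton[of "0::real"]
    proof eventually_elim
      case (elim s)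
      show ?case
      proof (cases "s \<in> {0..1}")
        case False
        have "v + ((h * s) *\<^sub>R \<nu> + ?S y) \<notin> ?K" for y
        proof
          assume "v + ((h * s) *\<^sub>R \<nu> + ?S y) \<in> ?K"
          then obtain s' z where z: "(h * s) *\<^sub>R \<nu> + ?S y = s' *\<^sub>R (z - v)" "s' \<in> {0..1}" "z \<in> F"
            by (auto simp: cone_over_def)
          have "\<nu> \<bullet> ((h * s) *\<^sub>R \<nu> + ?S y) = \<nu> \<bullet> (s' *\<^sub>R (z - v))" using z(1) by simp
          then have "h * s = s' * h" using F(2)[OF z(3)] by (simp add: inner_add_right \<nu>1 \<nu>S h_def inner_diff_right)
          then show False using z(2) False hp by simp
        qed
        then show ?thesis using False by (simp add: g_def)
      next
        case True
        then have s: "0 < s" "s \<le> 1" using elim by auto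
        \<comment> \<open>The substitution \<open>y \<mapsto> d + s y\<close> maps the coordinates of \<open>F\<close> based at \<open>a\<close> to those of the
          slice based at the foot of the perpendicular from \<open>v\<close>.\<close>
        define d where "d b = s * ((a - v) \<bullet> b)" for b
        have av: "a - v = h *\<^sub>R \<nu> + (\<Sum>b\<in>B. ((a - v) \<bullet> b) *\<^sub>R b)"
          using orthonormal_expansion[OF on, of "a - v"] sp fin \<nu> by (simp add: h_def inner_commute)
        have pt: "v + ((h * s) *\<^sub>R \<nu> + ?S (\<lambda>b\<in>B. d b + s * y b)) = v + s *\<^sub>R (a + ?S y - v)" for y
        proof -
          have "?S (\<lambda>b\<in>B. d b + s * y b) = s *\<^sub>R (\<Sum>b\<in>B. ((a - v) \<bullet> b) *\<^sub>R b) + s *\<^sub>R ?S y"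
            by (simp add: d_def scaleR_sum_right sum.distrib[symmetric] scaleR_add_left)
          moreover have "s *\<^sub>R (a + ?S y - v) = s *\<^sub>R (a - v) + s *\<^sub>R ?S y" by (simp add: algebra_simps)
          ultimately show ?thesis by (subst (asm) av) (simp add: scaleR_add_right mult.commute)
        qed
        have mem: "v + s *\<^sub>R (a + ?S y - v) \<in> ?K \<longleftrightarrow> a + ?S y \<in> F" for y
        proof
          assume "v + s *\<^sub>R (a + ?S y - v) \<in> ?K"
          then obtain s' z where z: "s *\<^sub>R (a + ?S y - v) = s' *\<^sub>R (z - v)" "s' \<in> {0..1}" "z \<in> F"
            by (auto simp: cone_over_def)
          have "\<nu> \<bullet> (s *\<^sub>R (a + ?S y - v)) = \<nu> \<bullet> (s' *\<^sub>R (z - v))" using z(1) by simp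
          then have "s * h = s' * h" using F(2)[OF z(3)]
            by (simp add: inner_add_right \<nu>S h_def inner_diff_right)
          then have "s' = s" using hp by simp
          then have "a + ?S y = z" using z(1) s by simp
          then show "a + ?S y \<in> F" using z(3) by simp
        next
          assume "a + ?S y \<in> F" then show "v + s *\<^sub>R (a + ?S y - v) \<in> ?K"
            using s by (force simp: cone_over_def)
        qed
        have "(\<integral>y. g (v + ((h * s) *\<^sub>R \<nu> + ?S y)) \<partial>?P) =
            \<bar>s\<bar> ^ card B * (\<integral>y. g (v + ((h * s) *\<^sub>R \<nu> + ?S (\<lambda>b\<in>B. d b + s * y b))) \<partial>?P)"
          using s by (intro PiM_lborel_integral_affine[OF fin]) auto
        also have "\<dots> = s ^ card B * (\<integral>y. indicator F (a + ?S y) * f (v + s *\<^sub>R (a + ?S y - v)) \<partial>?P)"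
          unfolding pt using s by (simp add: g_def mem indicator_def)
        finally show ?thesis using True by simp
      qed
    qed
  qed measurable
  also have "\<dots> = (\<integral>y. (\<integral>s. indicator {0..1} s * (s ^ card B * (indicator F (a + ?S y) * f (v + s *\<^sub>R (a + ?S y - v)))) \<partial>lborel) \<partial>?P)"
  proof (rule Q.Fubini_integral[symmetric])
    obtain D' where D': "D' \<in> sets ?P" "emeasure ?P D' < \<infinity>"
      "\<And>y. y \<in> space ?P \<Longrightarrow> a + ?S y \<in> F \<Longrightarrow> y \<in> D'"
      by (rule frame_box[OF B compact_imp_bounded[OF F(1)], of a]) blast
    show "integrable (lborel \<Otimes>\<^sub>M ?P) (\<lambda>(s, y). indicator {0..1} s * (s ^ card B * (indicator F (a + ?S y) * f (v + s *\<^sub>R (a + ?S y - v)))))"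
    proof (rule integrableI_bounded_set[where A="{0..1} \<times> D'" and B="\<bar>C\<bar>"])
      have "\<bar>indicator {0..1} s * (s ^ card B * (indicator F (a + ?S y) * f (v + s *\<^sub>R (a + ?S y - v))))\<bar> \<le> \<bar>C\<bar>" for s y
      proof (cases "s \<in> {0..1} \<and> a + ?S y \<in> F")
        case True
        then have "\<bar>f (v + s *\<^sub>R (a + ?S y - v))\<bar> \<le> C" by (intro C) (force simp: cone_over_def)
        moreover have "0 \<le> s ^ card B" "s ^ card B \<le> 1" using True by (auto intro: power_le_one)
        ultimately have "s ^ card B * \<bar>f (v + s *\<^sub>R (a + ?S y - v))\<bar> \<le> 1 * C" by (intro mult_mono) auto
        then show ?thesis using True by (simp add: abs_mult)
      qed auto
      then show "AE x in lborel \<Otimes>\<^sub>M ?P. x \<in> {0..1} \<times> D' \<longrightarrow> norm (case x of (s, y) \<Rightarrow>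
          indicator {0..1} s * (s ^ card B * (indicator F (a + ?S y) * f (v + s *\<^sub>R (a + ?S y - v))))) \<le> \<bar>C\<bar>"
        by (intro AE_I2) (simp add: split_beta)
      show "AE x in lborel \<Otimes>\<^sub>M ?P. x \<notin> {0..1} \<times> D' \<longrightarrow> (case x of (s, y) \<Rightarrow>
          indicator {0..1} s * (s ^ card B * (indicator F (a + ?S y) * f (v + s *\<^sub>R (a + ?S y - v))))) = 0"
        using D'(3) by (intro AE_I2) (auto simp: indicator_def split_beta space_pair_measure)
      show "emeasure (lborel \<Otimes>\<^sub>M ?P) ({0..1::real} \<times> D') < \<infinity>"
        using D'(1,2)
        by (simp add: P.emeasure_pair_measure_Times ennreal_mult_less_top)
    qed (use D' in measurable)
  qed
  also have "\<dots> = (\<integral>y. indicator F (a + ?S y) * (\<integral>s. indicator {0..1} s *\<^sub>R (s ^ card B * f (v + s *\<^sub>R (a + ?S y - v))) \<partial>lborel) \<partial>?P)"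
    by (intro Bochner_Integration.integral_cong refl, subst integral_mult_right_zero[symmetric],
        intro Bochner_Integration.integral_cong refl) simp
  finally show ?thesis by (simp add: g_def h_def)
qed

text \<open>
  The field \<open>q(x) (x - v)\<close> has divergence \<open>n q + \<nabla>q \<bullet> (x - v)\<close> and is tangential to the
  lateral boundary of the cone, so only the base contributes. In polar coordinates the
  integrand is \<open>d/ds (s\<^sup>n q(v + s w))\<close> with \<open>n = card B + 1\<close>.
\<close>

lemma cone_divergence:
  fixes q :: "real^'n \<Rightarrow> real"
  assumes on: "orthonormal (insert \<nu> B)" and \<nu>: "\<nu> \<notin> B" and sp: "span (insert \<nu> B) = UNIV"
    and F: "compact F" "\<And>y. y \<in> F \<Longrightarrow> \<nu> \<bullet> y = \<nu> \<bullet> a" and h: "\<nu> \<bullet> (a - v) > 0"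
    and K: "compact (cone_over v F)" and q: "C1_fun q"
  shows "integral\<^sup>L lborel (\<lambda>x. indicator (cone_over v F) x *
      (real (card B + 1) * q x + dir_deriv (x - v) q x)) =
    (\<nu> \<bullet> (a - v)) * frame_integral B a F q"
proof -
  have dq: "\<And>x. q differentiable at x" using q by (simp add: C1_fun_def)
  have qc: "continuous_on UNIV q" by (rule C1_fun_continuous[OF q])
  have pc: "continuous_on UNIV (partial i q)" for i using q by (simp add: C1_fun_def partial_def)
  let ?S = "\<lambda>y. \<Sum>b\<in>B. y b *\<^sub>R b"
  have dd: "dir_deriv (x - v) q x = (\<Sum>i\<in>UNIV. (x - v) $ i * partial i q x)" for x
    by (rule dir_deriv_eq_partials[OF dq])
  have c: "continuous_on UNIV (\<lambda>x. real (card B + 1) * q x + dir_deriv (x - v) q x)"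
    unfolding dd by (intro continuous_intros qc pc)
  have FTC: "integral\<^sup>L lborel (\<lambda>s. indicator {0..1} s *\<^sub>R (s ^ card B *
      (real (card B + 1) * q (v + s *\<^sub>R w) + dir_deriv (v + s *\<^sub>R w - v) q (v + s *\<^sub>R w)))) = q (v + w)"
    for w
  proof -
    let ?F = "\<lambda>s. s ^ Suc (card B) * q (v + s *\<^sub>R w)"
    have "integral\<^sup>L lborel (\<lambda>s. indicator {0..1} s *\<^sub>R (s ^ card B *
      (real (card B + 1) * q (v + s *\<^sub>R w) + dir_deriv (v + s *\<^sub>R w - v) q (v + s *\<^sub>R w)))) = ?F 1 - ?F 0"
    proof (rule integral_FTC_atLeastAtMost)
      fix s :: real assume "0 \<le> s" "s \<le> 1"
      have "dir_deriv (s *\<^sub>R w) q (v + s *\<^sub>R w) = s * dir_deriv w q (v + s *\<^sub>R w)"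
        using linear_scale[OF linear_dir_deriv[OF dq]] by simp
      then have "(?F has_real_derivative (s ^ card B *
         (real (card B + 1) * q (v + s *\<^sub>R w) + dir_deriv (v + s *\<^sub>R w - v) q (v + s *\<^sub>R w)))) (at s)"
        using DERIV_mult[OF DERIV_pow[of "Suc (card B)" s] has_real_derivative_along_line, of q v w, OF dq]
        by (simp add: algebra_simps)
      then show "(?F has_vector_derivative (s ^ card B *
         (real (card B + 1) * q (v + s *\<^sub>R w) + dir_deriv (v + s *\<^sub>R w - v) q (v + s *\<^sub>R w)))) (at s within {0..1})"
        by (simp add: has_real_derivative_iff_has_vector_derivative has_vector_derivative_at_within)
    next
      have "continuous_on {0..1} (\<lambda>s. s ^ card B * (\<lambda>x. real (card B + 1) * q x + dir_deriv (x - v) q x) (v + s *\<^sub>R w))"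
        by (intro continuous_intros continuous_on_compose2[OF c]) auto
      then show "continuous_on {0..1} (\<lambda>s. s ^ card B *
         (real (card B + 1) * q (v + s *\<^sub>R w) + dir_deriv (v + s *\<^sub>R w - v) q (v + s *\<^sub>R w)))" by simp
    qed simp
    then show ?thesis by simp
  qed
  show ?thesis
  proof -
    have "integral\<^sup>L lborel (\<lambda>x. indicator (cone_over v F) x *
        (real (card B + 1) * q x + dir_deriv (x - v) q x)) =
      (\<nu> \<bullet> (a - v)) * integral\<^sup>L (lborel_PiM B)
       (\<lambda>y. indicator F (a + ?S y) * integral\<^sup>L lborel (\<lambda>s. indicator {0..1} s *\<^sub>R (s ^ card B *
      (real (card B + 1) * q (v + s *\<^sub>R (a + ?S y - v)) + dir_deriv (v + s *\<^sub>R (a + ?S y - v) - v) q (v + s *\<^sub>R (a + ?S y - v))))))"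
      by (rule cone_integral[OF on \<nu> sp F h K c])
    also have "\<dots> = (\<nu> \<bullet> (a - v)) * integral\<^sup>L (lborel_PiM B)
       (\<lambda>y. indicator F (a + ?S y) * q (v + (a + ?S y - v)))"
      unfolding FTC ..
    also have "\<dots> = (\<nu> \<bullet> (a - v)) * frame_integral B a F q"
      unfolding frame_integral_def by simp
    finally show ?thesis .
  qed
qed

text \<open>
  The line meets \<open>F\<close> in a segment whose end points lie on the relative boundary, where \<open>q\<close>
  is zero.
\<close>

lemma line_section_integral_zero:
  fixes q :: "real^'n \<Rightarrow> real"
  assumes F: "compact F" "convex F" and q: "C1_fun q"
    and t: "t \<in> span (directions F)"
    and z: "\<And>x. x \<in> rel_frontier F \<Longrightarrow> q x = 0"
  shows "integral\<^sup>L lborel (\<lambda>s. indicator F (x + s *\<^sub>R t) * dir_deriv t q (x + s *\<^sub>R t)) = 0"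
proof (cases "t = 0")
  case True
  have "dir_deriv 0 q y = 0" for y
    using linear_0[OF linear_dir_deriv, of q y] q by (simp add: C1_fun_def)
  then show ?thesis using True by simp
next
  case False
  define S where "S = (\<lambda>s. x + s *\<^sub>R t) -` F"
  have ind: "indicator F (x + s *\<^sub>R t) = (indicator S s :: real)" for s by (simp add: S_def indicator_def)
  have "closed S" unfolding S_def
    by (intro closed_vimage compact_imp_closed F continuous_intros)
  moreover have "bounded S"
  proof -
    obtain r where r: "\<And>x. x \<in> F \<Longrightarrow> norm x \<le> r" using compact_imp_bounded[OF F(1)] bounded_iff by blast
    have "\<bar>s\<bar> \<le> (r + norm x) / norm t" if "s \<in> S" for s
    proof -
      have "norm (s *\<^sub>R t) \<le> norm (x + s *\<^sub>R t) + norm x" by (metis add.commute add_diff_cancel_left' norm_triangle_ineq4)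
      then have "\<bar>s\<bar> * norm t \<le> r + norm x" using r[of "x + s *\<^sub>R t"] that by (simp add: S_def)
      then show ?thesis using False by (simp add: pos_le_divide_eq)
    qed
    then show ?thesis by (auto simp: bounded_iff intro!: exI)
  qed
  moreover have "convex S"
  proof -
    have "x + (u * s + w * s') *\<^sub>R t = u *\<^sub>R (x + s *\<^sub>R t) + w *\<^sub>R (x + s' *\<^sub>R t)" if "u + w = 1" for u w s s'
    proof -
      have "x = u *\<^sub>R x + w *\<^sub>R x" using that by (simp flip: scaleR_add_left)
      then show ?thesis by (simp add: scaleR_add_right scaleR_add_left)
    qed
    then show ?thesis using F(2) by (auto simp: S_def convex_def)
  qed
  ultimately obtain \<alpha> \<beta> where S: "S = {\<alpha>..\<beta>}"
    using connected_compact_interval_1[of S] convex_connected compact_eq_bounded_closed by blast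
  show ?thesis
  proof (cases "\<alpha> \<le> \<beta>")
    case False
    then show ?thesis using S by (simp add: ind)
  next
    case True
    have aff: "x + s *\<^sub>R t \<in> affine hull F" for s
    proof -
      have b: "x + \<beta> *\<^sub>R t \<in> affine hull F" using True S by (intro hull_inc) (auto simp: S_def)
      have "(x + \<beta> *\<^sub>R t) + (s - \<beta>) *\<^sub>R t \<in> affine hull F"
        by (rule affine_hull_add_direction[OF span_scale[OF t] b])
      then show ?thesis by (simp add: algebra_simps)
    qed
    \<comment> \<open>an end point of the section is no relative interior point of \<open>F\<close>\<close>
    have end_zero: "q (x + s *\<^sub>R t) = 0" if s: "s \<in> S" "\<And>e. e > 0 \<Longrightarrow> \<exists>s'. s' \<notin> S \<and> \<bar>s' - s\<bar> < e" for s
    proof (rule z, rule ccontr)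
      assume "x + s *\<^sub>R t \<notin> rel_frontier F"
      then have "x + s *\<^sub>R t \<in> rel_interior F"
        using s(1) F(1) by (auto simp: rel_frontier_def S_def compact_imp_closed)
      then obtain e where e: "e > 0" "ball (x + s *\<^sub>R t) e \<inter> affine hull F \<subseteq> F"
        by (auto simp: mem_rel_interior_ball)
      obtain s' where s': "s' \<notin> S" "\<bar>s' - s\<bar> < e / norm t" using s(2)[of "e / norm t"] e False by auto
      have "dist (x + s *\<^sub>R t) (x + s' *\<^sub>R t) = \<bar>s' - s\<bar> * norm t"
        by (simp add: dist_norm flip: scaleR_diff_left) (simp add: abs_minus_commute)
      then have "dist (x + s *\<^sub>R t) (x + s' *\<^sub>R t) < e" using s'(2) False by (simp add: pos_less_divide_eq)
      then have "x + s' *\<^sub>R t \<in> F" using e(2) aff by auto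
      then show False using s'(1) by (simp add: S_def)
    qed
    have "q (x + \<alpha> *\<^sub>R t) = 0"
    proof (rule end_zero)
      show "\<exists>s'. s' \<notin> S \<and> \<bar>s' - \<alpha>\<bar> < e" if "e > 0" for e
        using S that by (intro exI[of _ "\<alpha> - e / 2"]) auto
    qed (use S True in auto)
    moreover have "q (x + \<beta> *\<^sub>R t) = 0"
    proof (rule end_zero)
      show "\<exists>s'. s' \<notin> S \<and> \<bar>s' - \<beta>\<bar> < e" if "e > 0" for e
        using S that by (intro exI[of _ "\<beta> + e / 2"]) auto
    qed (use S True in auto)
    moreover have "integral\<^sup>L lborel (\<lambda>s. indicator {\<alpha>..\<beta>} s *\<^sub>R dir_deriv t q (x + s *\<^sub>R t)) =
      q (x + \<beta> *\<^sub>R t) - q (x + \<alpha> *\<^sub>R t)"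
    proof (rule integral_FTC_atLeastAtMost[OF True])
      fix s
      have "q differentiable at (x + s *\<^sub>R t)" using q by (simp add: C1_fun_def)
      from has_real_derivative_along_line[OF this]
      show "((\<lambda>s. q (x + s *\<^sub>R t)) has_vector_derivative dir_deriv t q (x + s *\<^sub>R t)) (at s within {\<alpha>..\<beta>})"
        by (simp add: has_real_derivative_iff_has_vector_derivative has_vector_derivative_at_within)
    next
      have "continuous_on UNIV (dir_deriv t q)" using q by (simp add: C1_fun_def)
      then show "continuous_on {\<alpha>..\<beta>} (\<lambda>s. dir_deriv t q (x + s *\<^sub>R t))"
        by (rule continuous_on_compose2) (auto intro!: continuous_intros)
    qed
    ultimately show ?thesis by (simp add: ind S)
  qed
qed

text \<open>
  Integration by parts on a face for functions that vanish on its relative boundary: slice the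
  face by the lines in direction \<open>t\<close>.
\<close>

lemma frame_integral_deriv_zero:
  fixes q :: "real^'n \<Rightarrow> real"
  assumes B: "orthonormal B" and t: "t \<in> B"
    and F: "compact F" "convex F" and q: "C1_fun q"
    and sp: "t \<in> span (directions F)"
    and z: "\<And>x. x \<in> rel_frontier F \<Longrightarrow> q x = 0"
  shows "frame_integral B a F (dir_deriv t q) = 0"
proof -
  define C where "C = B - {t}"
  have C: "t \<notin> C" "B = insert t C" "finite C" using t orthonormal_finite[OF B] by (auto simp: C_def)
  have c: "continuous_on UNIV (dir_deriv t q)" using q by (simp add: C1_fun_def)
  let ?g = "\<lambda>x. indicator F x * dir_deriv t q x"
  have e: "(\<Sum>b\<in>insert t C. (y(t := s)) b *\<^sub>R b) = s *\<^sub>R t + (\<Sum>b\<in>C. y b *\<^sub>R b)" for y s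
    using C by (simp, intro sum.cong, auto)
  have "frame_integral B a F (dir_deriv t q) =
      (\<integral>y. (\<integral>s. ?g (a + (\<Sum>b\<in>insert t C. (y(t := s)) b *\<^sub>R b)) \<partial>lborel) \<partial>lborel_PiM C)"
    unfolding frame_integral_def C(2)
    by (rule lebesgue_product.product_integral_insert[OF C(3,1)])
      (rule frame_integrable[OF B[unfolded C(2)] F(1) c])
  also have "\<dots> = (\<integral>y. (\<integral>s. ?g ((a + (\<Sum>b\<in>C. y b *\<^sub>R b)) + s *\<^sub>R t) \<partial>lborel) \<partial>lborel_PiM C)"
    by (simp only: e) (simp add: ac_simps)
  also have "\<dots> = 0"
    by (simp add: line_section_integral_zero[OF F q sp z])
  finally show ?thesis .
qed

section \<open>Facets and the divergence theorem on a simplex\<close>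

lemma dim_directions:
  fixes F :: "'a::euclidean_space set"
  assumes "F \<noteq> {}"
  shows "int (dim (span (directions F))) = aff_dim F"
proof -
  obtain a where a: "a \<in> F" using assms by blast
  have "span (directions F) = span ((\<lambda>x. x - a) ` F)"
  proof (rule antisym; rule span_minimal)
    show "directions F \<subseteq> span ((\<lambda>x. x - a) ` F)"
    proof clarify
      fix x y assume "x \<in> F" "y \<in> F"
      then have "(x - a) - (y - a) \<in> span ((\<lambda>x. x - a) ` F)"
        by (intro span_diff span_base) auto
      then show "x - y \<in> span ((\<lambda>x. x - a) ` F)" by simp
    qed
    show "(\<lambda>x. x - a) ` F \<subseteq> span (directions F)" using a by (blast intro: span_base)
  qed auto
  then show ?thesis
    unfolding aff_dim_eq_dim_subtract[OF hull_inc[OF a]] by (metis dim_span)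
qed

lemma tangent_frame:
  fixes F :: "(real^'n) set"
  shows orthonormal_tangent_frame: "orthonormal (tangent_frame F)"
    and span_tangent_frame: "span (tangent_frame F) = span (directions F)"
proof -
  let ?P = "\<lambda>B. pairwise orthogonal B \<and> (\<forall>t\<in>B. norm t = 1) \<and> span B = span (directions F)"
  obtain B where "pairwise orthogonal B" "\<And>x. x \<in> B \<Longrightarrow> norm x = 1" "span B = span (directions F)"
    by (rule orthonormal_basis_subspace[OF subspace_span, of "directions F"]) blast
  then have "?P B" by blast
  then have "?P (tangent_frame F)" unfolding tangent_frame_def by (rule someI[of ?P])
  then show "orthonormal (tangent_frame F)" "span (tangent_frame F) = span (directions F)"
    by (auto simp: orthonormal_def)
qed

lemma face_integral_eq_frame_integral:
  "face_integral F f = frame_integral (tangent_frame F) (SOME a. a \<in> F) F f"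
  by (simp add: face_integral_def frame_integral_def Let_def)

lemma face_integral_cong:
  "(\<And>x. x \<in> F \<Longrightarrow> f x = g x) \<Longrightarrow> face_integral F f = face_integral F g"
  unfolding face_integral_eq_frame_integral by (rule frame_integral_cong)

lemma face_integral_cmult:
  "face_integral F (\<lambda>x. c * f x) = c * face_integral F f"
  unfolding face_integral_eq_frame_integral frame_integral_def
  by (subst integral_mult_right_zero[symmetric]) (simp add: mult.left_commute)

lemma face_integral_add:
  assumes "compact F" "continuous_on UNIV f" "continuous_on UNIV g"
  shows "face_integral F (\<lambda>x. f x + g x) = face_integral F f + face_integral F g"
  unfolding face_integral_eq_frame_integral frame_integral_def
  by (simp add: distrib_left Bochner_Integration.integral_add frame_integrable assms orthonormal_tangent_frame)

lemma face_integral_diff: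
  assumes "compact F" "continuous_on UNIV f" "continuous_on UNIV g"
  shows "face_integral F (\<lambda>x. f x - g x) = face_integral F f - face_integral F g"
  unfolding face_integral_eq_frame_integral frame_integral_def
  by (simp add: right_diff_distrib Bochner_Integration.integral_diff frame_integrable assms orthonormal_tangent_frame)

lemma face_integral_sum:
  assumes "compact F" "\<And>i. i \<in> I \<Longrightarrow> continuous_on UNIV (f i)"
  shows "face_integral F (\<lambda>x. \<Sum>i\<in>I. f i x) = (\<Sum>i\<in>I. face_integral F (f i))"
  unfolding face_integral_eq_frame_integral frame_integral_def sum_distrib_left
  by (intro Bochner_Integration.integral_sum frame_integrable assms orthonormal_tangent_frame)

lemma face_integral_zero: "(\<And>x. x \<in> F \<Longrightarrow> f x = 0) \<Longrightarrow> face_integral F f = 0"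
  using face_integral_cong[of F f "\<lambda>_. 0"] by (simp add: face_integral_eq_frame_integral frame_integral_def)

lemma orthonormal_span_UNIV:
  fixes C :: "'a::euclidean_space set"
  assumes "orthonormal C" "card C = DIM('a)"
  shows "span C = UNIV"
  using orthonormal_card[OF assms(1)] assms(2) by (metis dim_eq_full dim_span)

lemma orthonormal_insert_normal:
  fixes F :: "(real^'n) set"
  assumes F: "F \<noteq> {}" "aff_dim F = int CARD('n) - 1"
    and \<nu>: "norm \<nu> = 1" "\<And>x y. x \<in> F \<Longrightarrow> y \<in> F \<Longrightarrow> \<nu> \<bullet> (y - x) = 0"
  shows "\<nu> \<notin> tangent_frame F" "orthonormal (insert \<nu> (tangent_frame F))"
    "span (insert \<nu> (tangent_frame F)) = UNIV" "card (tangent_frame F) + 1 = CARD('n)"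
proof -
  let ?B = "tangent_frame F"
  note on = orthonormal_tangent_frame[of F]
  have fin: "finite ?B" by (rule orthonormal_finite[OF on])
  have orth: "\<nu> \<bullet> b = 0" if "b \<in> ?B" for b
  proof -
    have "b \<in> span (directions F)" using span_base[OF that] span_tangent_frame by blast
    then have "orthogonal \<nu> b"
      by (rule orthogonal_to_span) (use \<nu>(2) in \<open>auto simp: orthogonal_def\<close>)
    then show ?thesis by (simp add: orthogonal_def)
  qed
  show n: "\<nu> \<notin> ?B" using orth[of \<nu>] \<nu>(1) by (auto simp: norm_eq_1)
  show o: "orthonormal (insert \<nu> ?B)"
    using on orth \<nu>(1) n unfolding orthonormal_def
    by (auto simp: pairwise_insert orthogonal_def inner_commute)
  have "int (card ?B) = aff_dim F"
    using dim_directions[OF F(1)] by (simp add: orthonormal_card[OF on] span_tangent_frame)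
  then show c: "card ?B + 1 = CARD('n)" using F(2) by simp
  show "span (insert \<nu> ?B) = UNIV"
    by (rule orthonormal_span_UNIV[OF o]) (use n fin c in simp)
qed

text \<open>
  The directions of a facet have codimension one.
\<close>

lemma unit_normals_eq_or_opposite:
  fixes F :: "(real^'n) set"
  assumes F: "F \<noteq> {}" "aff_dim F = int CARD('n) - 1"
    and \<nu>: "norm \<nu> = 1" "\<And>x y. x \<in> F \<Longrightarrow> y \<in> F \<Longrightarrow> \<nu> \<bullet> (y - x) = 0"
    and \<mu>: "norm \<mu> = 1" "\<And>x y. x \<in> F \<Longrightarrow> y \<in> F \<Longrightarrow> \<mu> \<bullet> (y - x) = 0"
  shows "\<mu> = \<nu> \<or> \<mu> = - \<nu>"
proof -
  note o = orthonormal_insert_normal[OF F \<nu>]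
  have z: "\<mu> \<bullet> b = 0" if "b \<in> tangent_frame F" for b
    using orthonormal_inner[OF orthonormal_insert_normal(2)[OF F \<mu>], of \<mu> b]
      orthonormal_insert_normal(1)[OF F \<mu>] that by auto
  have "\<mu> = (\<Sum>b\<in>insert \<nu> (tangent_frame F). (\<mu> \<bullet> b) *\<^sub>R b)"
    using orthonormal_expansion[OF o(2), of \<mu>] o(3) by simp
  also have "\<dots> = (\<mu> \<bullet> \<nu>) *\<^sub>R \<nu>"
    using o(1) orthonormal_finite[OF orthonormal_tangent_frame, of F] z by simp
  finally have e: "\<mu> = (\<mu> \<bullet> \<nu>) *\<^sub>R \<nu>" .
  then have "norm \<mu> = \<bar>\<mu> \<bullet> \<nu>\<bar> * norm \<nu>" by (metis norm_scaleR)
  then have "\<mu> \<bullet> \<nu> = 1 \<or> \<mu> \<bullet> \<nu> = - 1" using \<nu>(1) \<mu>(1) by auto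
  then show ?thesis using e by (metis scaleR_minus1_left scaleR_one)
qed

lemma facet_aff_dim:
  "F facet_of K \<Longrightarrow> aff_dim K = int CARD('n) \<Longrightarrow> aff_dim (F :: (real^'n) set) = int CARD('n) - 1"
  by (simp add: facet_of_def)

text \<open>
  The definite description in \<^const>\<open>outer_normal\<close> is meaningful: a facet is cut out by a
  supporting hyperplane, and of the two unit normals of that hyperplane only one points out of
  a full-dimensional \<open>K\<close>.
\<close>

lemma outer_normal:
  fixes K :: "(real^'n) set"
  assumes K: "polyhedron K" "aff_dim K = int CARD('n)" and F: "F facet_of K"
  shows outer_normal_norm: "norm (outer_normal K F) = 1"
    and outer_normal_le: "\<And>x y. x \<in> F \<Longrightarrow> y \<in> K \<Longrightarrow> outer_normal K F \<bullet> (y - x) \<le> 0"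
    and outer_normal_orthogonal: "\<And>x y. x \<in> F \<Longrightarrow> y \<in> F \<Longrightarrow> outer_normal K F \<bullet> (y - x) = 0"
    and facet_eq_outer_normal: "\<And>x. x \<in> F \<Longrightarrow> F = {y \<in> K. outer_normal K F \<bullet> (y - x) = 0}"
proof -
  let ?P = "\<lambda>\<nu>. norm \<nu> = 1 \<and> (\<forall>x\<in>F. \<forall>y\<in>K. \<nu> \<bullet> (y - x) \<le> 0)"
  have Fne: "F \<noteq> {}" and FK: "F \<subseteq> K" using F by (auto simp: facet_of_def face_of_imp_subset)
  note Fd = facet_aff_dim[OF F K(2)]
  obtain a b where ab: "a \<noteq> 0" "K \<subseteq> {x. a \<bullet> x \<le> b}" "F = K \<inter> {x. a \<bullet> x = b}"
    by (rule facet_of_polyhedron[OF K(1) F])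
  define \<nu> where "\<nu> = (1 / norm a) *\<^sub>R a"
  have P: "?P \<nu>" using ab by (auto simp: \<nu>_def inner_diff_right intro!: divide_right_mono)
  have orth: "\<mu> \<bullet> (y - x) = 0" if "?P \<mu>" "x \<in> F" "y \<in> F" for \<mu> x y
  proof -
    have "\<mu> \<bullet> (y - x) \<le> 0" "\<mu> \<bullet> (x - y) \<le> 0" using that FK by auto
    then show ?thesis by (simp add: inner_diff_right)
  qed
  have "\<mu> = \<nu>" if \<mu>: "?P \<mu>" for \<mu>
  proof -
    have "\<mu> = \<nu> \<or> \<mu> = - \<nu>"
      using P \<mu> by (intro unit_normals_eq_or_opposite[OF Fne Fd]) (auto intro: orth[of \<nu>] orth[of \<mu>])
    moreover have "\<mu> \<noteq> - \<nu>"
    proof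
      assume m: "\<mu> = - \<nu>"
      obtain x where x: "x \<in> F" using Fne by blast
      have "y \<in> F" if "y \<in> K" for y
      proof -
        have "\<nu> \<bullet> (y - x) \<le> 0" "- \<nu> \<bullet> (y - x) \<le> 0" using P \<mu> m x that by auto
        then have "\<nu> \<bullet> (y - x) = 0" by simp
        then have "a \<bullet> y = a \<bullet> x" using ab(1) by (simp add: \<nu>_def inner_diff_right)
        then show ?thesis using x ab(3) that by auto
      qed
      then have "F = K" using FK by blast
      then show False using F by simp
    qed
    ultimately show ?thesis by blast
  qed
  then have e: "outer_normal K F = \<nu>" unfolding outer_normal_def using P by (intro the_equality) blast+
  show "norm (outer_normal K F) = 1" using P e by simp
  show "\<And>x y. x \<in> F \<Longrightarrow> y \<in> K \<Longrightarrow> outer_normal K F \<bullet> (y - x) \<le> 0" using P e by simp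
  show "\<And>x y. x \<in> F \<Longrightarrow> y \<in> F \<Longrightarrow> outer_normal K F \<bullet> (y - x) = 0" unfolding e using orth[OF P] by blast
  show "F = {y \<in> K. outer_normal K F \<bullet> (y - x) = 0}" if "x \<in> F" for x
    unfolding e using that ab by (auto simp: \<nu>_def inner_diff_right)
qed

lemma facet_frame:
  fixes K :: "(real^'n) set"
  assumes K: "polyhedron K" "aff_dim K = int CARD('n)" and F: "F facet_of K"
  shows "outer_normal K F \<notin> tangent_frame F" "orthonormal (insert (outer_normal K F) (tangent_frame F))"
    "span (insert (outer_normal K F) (tangent_frame F)) = UNIV" "card (tangent_frame F) + 1 = CARD('n)"
proof -
  have "F \<noteq> {}" using F by (simp add: facet_of_def)
  note * = orthonormal_insert_normal[OF this facet_aff_dim[OF F K(2)] outer_normal_norm[OF K F] outer_normal_orthogonal[OF K F]]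
  show "outer_normal K F \<notin> tangent_frame F" "orthonormal (insert (outer_normal K F) (tangent_frame F))"
    "span (insert (outer_normal K F) (tangent_frame F)) = UNIV" "card (tangent_frame F) + 1 = CARD('n)"
    using * by blast+
qed

lemma face_integral_tangential_deriv_zero:
  fixes q :: "real^'n \<Rightarrow> real"
  assumes "compact F" "convex F" "C1_fun q" "t \<in> tangent_frame F"
    and "\<And>x. x \<in> rel_frontier F \<Longrightarrow> q x = 0"
  shows "face_integral F (dir_deriv t q) = 0"
  unfolding face_integral_eq_frame_integral
  by (rule frame_integral_deriv_zero[OF orthonormal_tangent_frame assms(4,1,2,3) _ assms(5)])
    (use span_base[OF assms(4)] span_tangent_frame in blast)+

lemma compact_facet: "compact K \<Longrightarrow> F facet_of K \<Longrightarrow> convex K \<Longrightarrow> compact F"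
  using facet_of_imp_face_of face_of_imp_compact by blast

text \<open>
  The simplex is the cone over each facet with the opposite vertex \<open>u\<close> as apex. The cone
  formula thus evaluates the integral \<open>I u\<close> of the divergence of \<open>q(x) (x - u)\<close> for every
  vertex \<open>u\<close>, and the value can be written as a sum over all facets because those through
  \<open>u\<close> have height zero. The field \<open>q(x) (x - u) - q(x) (x - w)\<close> is \<open>q\<close> times the constant
  vector \<open>w - u\<close>, so subtracting the formulas for two vertices proves the claim for
  \<open>e = w - u\<close>. These edge vectors span the space and both sides are linear in \<open>e\<close>.
\<close>

lemma simplex_divergence:
  fixes q :: "real^'n \<Rightarrow> real"
  assumes K: "int CARD('n) simplex K" and q: "C1_fun q"
  shows "integral\<^sup>L lborel (\<lambda>x. indicator K x * dir_deriv e q x) =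
    (\<Sum>F | F facet_of K. (outer_normal K F \<bullet> e) * face_integral F q)"
proof -
  obtain C where C: "finite C" "\<not> affine_dependent C" "int (card C) = int CARD('n) + 1" "K = convex hull C"
    using K by (auto simp: simplex)
  have pK: "polytope K" "polyhedron K" and aK: "aff_dim K = int CARD('n)" and cK: "compact K" "convex K"
    using K simplex_imp_polytope[OF K] simplex_imp_polyhedron[OF K] aff_dim_simplex[OF K]
      polytope_imp_compact[of K] polytope_imp_convex[of K] by auto
  have finF: "finite {F. F facet_of K}" by (rule finite_polytope_facets[OF pK(1)])
  define G where "G u = convex hull (C - {u})" for u
  have "card C > 1" using C(3) zero_less_card_finite[where 'a='n] by linarith
  have Gne: "G u \<noteq> {}" if "u \<in> C" for u
  proof -
    have "card (C - {u}) > 0" using \<open>card C > 1\<close> that C(1) by simp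
    then have "C - {u} \<noteq> {}" by (metis card.empty less_irrefl)
    then show ?thesis unfolding G_def convex_hull_eq_empty .
  qed
  have facets: "F facet_of K \<longleftrightarrow> (\<exists>u\<in>C. F = G u)" for F
    unfolding C(4) facet_of_convex_hull_affine_independent[OF C(2)] using Gne unfolding G_def by blast
  have memG: "w \<in> G u" if "w \<in> C" "u \<in> C" "w \<noteq> u" for u w
    unfolding G_def using that by (intro hull_inc) auto
  have notG: "u \<notin> G u" if "u \<in> C" for u
    unfolding G_def using C(2) that convex_hull_subset_affine_hull[of "C - {u}"] by (auto simp: affine_dependent_def)
  let ?\<nu> = "outer_normal K" and ?a = "\<lambda>F. (SOME a. a \<in> F) :: real^'n"
  have a: "?a F \<in> F" if "F facet_of K" for F
    using that by (metis facet_of_def ex_in_conv someI_ex)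
  have dq: "\<And>x. q differentiable at x" using q by (simp add: C1_fun_def)
  have qc: "continuous_on UNIV q" by (rule C1_fun_continuous[OF q])
  have pc: "continuous_on UNIV (partial i q)" for i using q by (simp add: C1_fun_def partial_def)
  define I where "I u = integral\<^sup>L lborel (\<lambda>x. indicator K x * (real CARD('n) * q x + dir_deriv (x - u) q x))" for u
  have I: "I u = (\<Sum>F | F facet_of K. (?\<nu> F \<bullet> (?a F - u)) * face_integral F q)" if u: "u \<in> C" for u
  proof -
    have GF: "G u facet_of K" using facets u by blast
    note on = facet_frame[OF pK(2) aK GF]
    have Kcone: "K = cone_over u (G u)"
    proof -
      have "C - {u} \<noteq> {}" using Gne[OF u] by (auto simp: G_def)
      have "K = convex hull (insert u (C - {u}))" using u C(4) by (simp add: insert_absorb)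
      also have "\<dots> = {x. \<exists>s\<ge>0. \<exists>t\<ge>0. \<exists>b. s + t = 1 \<and> b \<in> G u \<and> x = s *\<^sub>R u + t *\<^sub>R b}"
        unfolding G_def by (rule convex_hull_insert[OF \<open>C - {u} \<noteq> {}\<close>])
      also have "\<dots> = cone_over u (G u)"
      proof (intro set_eqI iffI; clarsimp simp: cone_over_def)
        fix s t :: real and b assume st: "0 \<le> s" "0 \<le> t" "s + t = 1" "b \<in> G u"
        then have s: "s = 1 - t" by simp
        have "s *\<^sub>R u + t *\<^sub>R b = u + t *\<^sub>R (b - u)"
          unfolding s by (simp add: algebra_simps)
        then show "\<exists>r y. s *\<^sub>R u + t *\<^sub>R b = u + r *\<^sub>R (y - u) \<and> 0 \<le> r \<and> r \<le> 1 \<and> y \<in> G u"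
          using st by (intro exI[of _ t] exI[of _ b]) auto
      next
        fix r :: real and y assume r: "0 \<le> r" "r \<le> 1" "y \<in> G u"
        have "u + r *\<^sub>R (y - u) = (1 - r) *\<^sub>R u + r *\<^sub>R y" by (simp add: algebra_simps)
        then show "\<exists>s\<ge>0. \<exists>t\<ge>0. s + t = 1 \<and> (\<exists>b. b \<in> G u \<and> u + r *\<^sub>R (y - u) = s *\<^sub>R u + t *\<^sub>R b)"
          using r by (intro exI[of _ "1 - r"] conjI exI[of _ r] exI[of _ y]) auto
      qed
      finally show ?thesis .
    qed
    have uK: "u \<in> K" using u C(4) by (simp add: hull_inc)
    have "?\<nu> (G u) \<bullet> (u - ?a (G u)) \<le> 0" by (rule outer_normal_le[OF pK(2) aK GF a[OF GF] uK])
    moreover have "?\<nu> (G u) \<bullet> (u - ?a (G u)) \<noteq> 0"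
      using facet_eq_outer_normal[OF pK(2) aK GF a[OF GF]] uK notG[OF u] by blast
    ultimately have h: "?\<nu> (G u) \<bullet> (?a (G u) - u) > 0" by (simp add: inner_diff_right)
    have "I u = (?\<nu> (G u) \<bullet> (?a (G u) - u)) * frame_integral (tangent_frame (G u)) (?a (G u)) (G u) q"
      unfolding I_def
    proof (subst Kcone, subst on(4)[symmetric], rule cone_divergence[OF on(2,1,3)])
      show "compact (G u)" by (rule compact_facet[OF cK(1) GF cK(2)])
      show "\<And>y. y \<in> G u \<Longrightarrow> ?\<nu> (G u) \<bullet> y = ?\<nu> (G u) \<bullet> ?a (G u)"
        using outer_normal_orthogonal[OF pK(2) aK GF a[OF GF]] by (simp add: inner_diff_right)
      show "compact (cone_over u (G u))" using cK Kcone by simp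
    qed (use h q in auto)
    also have "\<dots> = (?\<nu> (G u) \<bullet> (?a (G u) - u)) * face_integral (G u) q"
      by (simp add: face_integral_eq_frame_integral)
    also have "\<dots> = (\<Sum>F\<in>{G u}. (?\<nu> F \<bullet> (?a F - u)) * face_integral F q)" by simp
    also have "\<dots> = (\<Sum>F | F facet_of K. (?\<nu> F \<bullet> (?a F - u)) * face_integral F q)"
    proof (rule sum.mono_neutral_left[OF finF])
      show "{G u} \<subseteq> {F. F facet_of K}" using GF by simp
      show "\<forall>F\<in>{F. F facet_of K} - {G u}. (?\<nu> F \<bullet> (?a F - u)) * face_integral F q = 0"
      proof
        fix F assume "F \<in> {F. F facet_of K} - {G u}"
        then have F: "F facet_of K" "F \<noteq> G u" by auto
        then obtain w where "w \<in> C" "F = G w" using facets by blast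
        then have "u \<in> F" using F u memG by auto
        then have "?\<nu> F \<bullet> (?a F - u) = 0" using outer_normal_orthogonal[OF pK(2) aK F(1) _ a[OF F(1)]] by blast
        then show "(?\<nu> F \<bullet> (?a F - u)) * face_integral F q = 0" by simp
      qed
    qed
    finally show ?thesis .
  qed
  have contI: "continuous_on UNIV (\<lambda>x. real CARD('n) * q x + dir_deriv (x - u) q x)" for u
    unfolding dir_deriv_eq_partials[OF dq] by (intro continuous_intros qc pc)
  have intI: "integrable lborel (\<lambda>x. indicator K x * (real CARD('n) * q x + dir_deriv (x - u) q x))" for u
    using borel_integrable_compact[OF cK(1) continuous_on_subset[OF contI]] by simp
  have intd: "integrable lborel (\<lambda>x. indicator K x * dir_deriv e q x)" for e
    using borel_integrable_compact[OF cK(1) continuous_on_subset[of UNIV "dir_deriv e q"]] q by (simp add: C1_fun_def)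
  have vert: "integral\<^sup>L lborel (\<lambda>x. indicator K x * dir_deriv (w - u) q x) =
     (\<Sum>F | F facet_of K. (?\<nu> F \<bullet> (w - u)) * face_integral F q)" if "u \<in> C" "w \<in> C" for u w
  proof -
    have "integral\<^sup>L lborel (\<lambda>x. indicator K x * dir_deriv (w - u) q x) = I u - I w"
      unfolding I_def Bochner_Integration.integral_diff[OF intI intI, symmetric]
      by (intro Bochner_Integration.integral_cong refl) (simp add: dir_deriv_diff_direction dq algebra_simps)
    also have "\<dots> = (\<Sum>F | F facet_of K. (?\<nu> F \<bullet> (w - u)) * face_integral F q)"
      unfolding I[OF that(1)] I[OF that(2)] sum_subtractf[symmetric]
      by (intro sum.cong refl) (simp add: inner_diff_right left_diff_distrib)
    finally show ?thesis .
  qed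
  have "span (directions C) = UNIV"
  proof -
    have "C \<noteq> {}" using C(3) by auto
    have "aff_dim C = int CARD('n)" using aff_dim_affine_independent[OF C(2)] C(3) by simp
    then have "dim (directions C) = DIM(real^'n)"
      using dim_directions[OF \<open>C \<noteq> {}\<close>] unfolding dim_span by simp
    then show ?thesis unfolding dim_eq_full .
  qed
  then have e: "e \<in> span (directions C)" by simp
  have linL: "linear (\<lambda>e. integral\<^sup>L lborel (\<lambda>x. indicator K x * dir_deriv e q x))"
  proof (rule linearI)
    fix x y :: "real^'n" and c :: real
    show "(LBINT z. indicator K z * dir_deriv (x + y) q z) =
        (LBINT z. indicator K z * dir_deriv x q z) + (LBINT z. indicator K z * dir_deriv y q z)"
      unfolding Bochner_Integration.integral_add[OF intd intd, symmetric]
      by (simp add: linear_add[OF linear_dir_deriv[OF dq]] distrib_left)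
    show "(LBINT z. indicator K z * dir_deriv (c *\<^sub>R x) q z) = c *\<^sub>R (LBINT z. indicator K z * dir_deriv x q z)"
      by (simp add: linear_scale[OF linear_dir_deriv[OF dq]] mult.left_commute)
  qed
  have linR: "linear (\<lambda>e. \<Sum>F | F facet_of K. (?\<nu> F \<bullet> e) * face_integral F q)"
    by (rule linearI) (simp_all add: inner_add_right distrib_right sum.distrib sum_distrib_left mult.assoc)
  show ?thesis by (rule linear_eq_on_span[OF linL linR _ e]) (use vert in auto)
qed

lemma integral_lebesgue_on_continuous:
  fixes f :: "'a::euclidean_space \<Rightarrow> real"
  assumes "compact K" "continuous_on UNIV f"
  shows "integral\<^sup>L (lebesgue_on K) f = integral\<^sup>L lborel (\<lambda>x. indicator K x * f x)"
    and "integrable (lebesgue_on K) f"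
proof -
  have [measurable]: "f \<in> borel_measurable borel" "K \<in> sets borel"
    using assms by (auto intro: borel_measurable_continuous_onI borel_compact)
  have K: "K \<inter> space lebesgue \<in> sets lebesgue" using assms(1) by (simp add: lmeasurable_compact fmeasurableD)
  have "integral\<^sup>L (lebesgue_on K) f = integral\<^sup>L lebesgue (\<lambda>x. indicator K x * f x)"
    using integral_restrict_space[OF K, of f] by simp
  then show "integral\<^sup>L (lebesgue_on K) f = integral\<^sup>L lborel (\<lambda>x. indicator K x * f x)"
    by (simp add: integral_completion)
  have "integrable lborel (\<lambda>x. indicator K x * f x)"
    using borel_integrable_compact[OF assms(1) continuous_on_subset[OF assms(2)]] by simp
  then have "integrable lebesgue (\<lambda>x. indicator K x * f x)" by (simp add: integrable_completion)
  then show "integrable (lebesgue_on K) f" using integrable_restrict_space[OF K, of f] by simp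
qed

text \<open>
  A continuous nonnegative integrand with integral zero vanishes; around a point of the
  relative interior a small coordinate box of positive measure is mapped into \<open>F\<close>.
\<close>

lemma face_integral_weighted_square_zero:
  fixes p :: "real^'n \<Rightarrow> real"
  assumes F: "compact F" "convex F" "F \<noteq> {}"
    and b: "continuous_on UNIV b" "\<And>x. x \<in> F \<Longrightarrow> 0 \<le> b x" "\<And>x. x \<in> rel_interior F \<Longrightarrow> 0 < b x"
    and p: "continuous_on UNIV p" and z: "face_integral F (\<lambda>x. b x * (p x)\<^sup>2) = 0" and x: "x \<in> F"
  shows "p x = 0"
proof -
  let ?B = "tangent_frame F"
  let ?P = "lborel_PiM ?B"
  define a where "a = (SOME a. a \<in> F)"
  define pt where "pt y = a + (\<Sum>b\<in>?B. y b *\<^sub>R b)" for y :: "real^'n \<Rightarrow> real"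
  have aF: "a \<in> F" unfolding a_def using F(3) by (simp add: some_in_eq)
  note on = orthonormal_tangent_frame[of F]
  note fin = orthonormal_finite[OF on]
  have int: "integrable ?P (\<lambda>y. indicator F (pt y) * (b (pt y) * (p (pt y))\<^sup>2))"
    unfolding pt_def by (rule frame_integrable[OF on F(1)]) (intro continuous_intros b p)
  have "(\<integral>y. indicator F (pt y) * (b (pt y) * (p (pt y))\<^sup>2) \<partial>?P) = 0"
    using z unfolding face_integral_eq_frame_integral frame_integral_def pt_def a_def .
  then have ae: "AE y in ?P. indicator F (pt y) * (b (pt y) * (p (pt y))\<^sup>2) = 0"
    using integral_nonneg_eq_0_iff_AE[OF int] b(2) by (simp add: indicator_def)
  have ri: "p x = 0" if xi: "x \<in> rel_interior F" for x
  proof (rule ccontr)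
    assume nz: "p x \<noteq> 0"
    have xF: "x \<in> F" using xi rel_interior_subset by blast
    have cont: "continuous_on UNIV (\<lambda>x. b x * (p x)\<^sup>2)" by (intro continuous_intros b p)
    have "b x * (p x)\<^sup>2 > 0" using nz b(3)[OF xi] by simp
    then obtain e1 where e1: "e1 > 0" "\<And>y. dist y x < e1 \<Longrightarrow> b y * (p y)\<^sup>2 > 0"
      using open_Collect_less[OF continuous_on_const cont, of 0] by (auto simp: open_dist)
    obtain e2 where e2: "e2 > 0" "ball x e2 \<inter> affine hull F \<subseteq> F" using xi by (auto simp: mem_rel_interior_ball)
    define e where "e = min e1 e2"
    define \<delta> where "\<delta> = e / (real (card ?B) + 1)"
    have e: "e > 0" "\<delta> > 0" using e1 e2 by (auto simp: e_def \<delta>_def)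
    define D where "D = (\<Pi>\<^sub>E b\<in>?B. {(x - a) \<bullet> b - \<delta> .. (x - a) \<bullet> b + \<delta>})"
    have xa: "x - a \<in> span ?B" using xF aF unfolding span_tangent_frame by (blast intro: span_base)
    have sub: "indicator F (pt y) * (b (pt y) * (p (pt y))\<^sup>2) \<noteq> 0" if "y \<in> D" for y
    proof -
      have "pt y - x = (\<Sum>b\<in>?B. y b *\<^sub>R b) - (\<Sum>b\<in>?B. ((x - a) \<bullet> b) *\<^sub>R b)"
        unfolding orthonormal_expansion[OF on xa] by (simp add: pt_def)
      also have "\<dots> = (\<Sum>b\<in>?B. (y b - (x - a) \<bullet> b) *\<^sub>R b)"
        by (simp add: sum_subtractf scaleR_diff_left)
      finally have "norm (pt y - x) \<le> (\<Sum>b\<in>?B. norm ((y b - (x - a) \<bullet> b) *\<^sub>R b))" by (simp only: norm_sum)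
      also have "\<dots> \<le> (\<Sum>b\<in>?B. \<delta>)"
      proof (rule sum_mono)
        fix b assume b: "b \<in> ?B"
        then have "y b \<in> {(x - a) \<bullet> b - \<delta> .. (x - a) \<bullet> b + \<delta>}" using that by (auto simp: D_def)
        then have "\<bar>y b - (x - a) \<bullet> b\<bar> \<le> \<delta>" by auto
        then show "norm ((y b - (x - a) \<bullet> b) *\<^sub>R b) \<le> \<delta>" using b on by (simp add: orthonormal_def)
      qed
      also have "\<dots> < e" using e by (simp add: \<delta>_def field_simps)
      finally have d: "dist (pt y) x < e" by (simp add: dist_norm)
      have "pt y \<in> affine hull F"
      proof -
        have "(\<Sum>b\<in>?B. y b *\<^sub>R b) \<in> span (directions F)"
          unfolding span_tangent_frame[symmetric] by (intro span_sum span_scale span_base)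
        then show ?thesis unfolding pt_def by (rule affine_hull_add_direction[OF _ hull_inc[OF aF]])
      qed
      then have "pt y \<in> F" using e2(2) d by (auto simp: e_def dist_commute)
      moreover have "b (pt y) * (p (pt y))\<^sup>2 > 0" using e1(2) d by (auto simp: e_def)
      ultimately show ?thesis by auto
    qed
    have DS: "D \<in> sets ?P" unfolding D_def by (rule sets_PiM_I_finite[OF fin]) auto
    have "AE y in ?P. y \<notin> D" using ae by eventually_elim (use sub in blast)
    then have "emeasure ?P D = 0"
      using AE_iff_measurable[OF DS, of "\<lambda>y. y \<notin> D"] sets.sets_into_space[OF DS] by blast
    moreover have "emeasure ?P D = (\<Prod>b\<in>?B. ennreal (2 * \<delta>))"
      unfolding D_def by (subst lebesgue_product.emeasure_PiM[OF fin]) (use e in auto)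
    ultimately show False using e fin by (simp add: ennreal_eq_0_iff)
  qed
  have "x \<in> closure (rel_interior F)"
    using x F convex_closure_rel_interior[OF F(2)] closure_subset by blast
  moreover have "continuous_on (closure (rel_interior F)) p" by (rule continuous_on_subset[OF p]) simp
  ultimately show ?thesis
    using ri continuous_constant_on_closure[of "rel_interior F" p 0 x] by blast
qed

section \<open>Facets in a conforming mesh\<close>

text \<open>
  The product of the distances to the hyperplanes of the other facets. It serves to localise
  boundary integrals at one facet.
\<close>

lemma facet_bubble:
  fixes K :: "(real^'n) set"
  assumes K: "polytope K" "aff_dim K = int CARD('n)" and F: "F facet_of K"
  obtains b where "rpf b" "\<And>x. x \<in> K \<Longrightarrow> 0 \<le> b x"
    "\<And>x. x \<in> rel_interior F \<Longrightarrow> 0 < b x"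
    "\<And>G x. G facet_of K \<Longrightarrow> G \<noteq> F \<Longrightarrow> x \<in> G \<Longrightarrow> b x = 0"
proof -
  have pK: "polyhedron K" and cK: "convex K"
    using K(1) polytope_imp_polyhedron polytope_imp_convex by auto
  define S where "S = {G. G facet_of K} - {F}"
  have finS: "finite S" using finite_polytope_facets[OF K(1)] by (simp add: S_def)
  define a where "a G = (SOME a. a \<in> G)" for G :: "(real^'n) set"
  have a: "a G \<in> G" if "G facet_of K" for G
    unfolding a_def using that by (metis facet_of_def some_in_eq)
  define l where "l G x = outer_normal K G \<bullet> (a G - x)" for G x
  define b where "b x = (\<Prod>G\<in>S. l G x)" for x
  have lpoly: "rpf (l G)" for G
  proof -
    have "bounded_linear (\<lambda>x. outer_normal K G \<bullet> x)" by (rule bounded_linear_inner_right)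
    then have "rpf (\<lambda>x. outer_normal K G \<bullet> a G - outer_normal K G \<bullet> x)"
      by (intro real_polynomial_function_diff real_polynomial_function.intros(1,2))
    then show ?thesis unfolding l_def inner_diff_right .
  qed
  have l0: "0 \<le> l G x" if "G facet_of K" "x \<in> K" for G x
    using outer_normal_le[OF pK K(2) that(1) a[OF that(1)] that(2)] by (simp add: l_def inner_diff_right)
  show ?thesis
  proof (rule that)
    show "rpf b" unfolding b_def
      using real_polynomial_function_prod[OF finS lpoly] .
    show "0 \<le> b x" if "x \<in> K" for x
      unfolding b_def by (rule prod_nonneg) (use l0 that in \<open>auto simp: S_def\<close>)
    show "0 < b x" if x: "x \<in> rel_interior F" for x
      unfolding b_def
    proof (rule prod_pos, rule ccontr)
      fix G assume G: "G \<in> S" and "\<not> 0 < l G x"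
      then have GK: "G facet_of K" "G \<noteq> F" by (auto simp: S_def)
      have FK: "F \<subseteq> K" by (rule facet_of_imp_subset[OF F])
      have xK: "x \<in> K" using x FK rel_interior_subset by blast
      then have "l G x = 0" using l0[OF GK(1) xK] \<open>\<not> 0 < l G x\<close> by simp
      then have "x \<in> G" using facet_eq_outer_normal[OF pK K(2) GK(1) a[OF GK(1)]] xK
        by (auto simp: l_def inner_diff_right)
      then have "F \<subseteq> G"
        using subset_of_face_of[OF facet_of_imp_face_of[OF GK(1)] FK] x by (auto simp: disjnt_iff)
      then have "F face_of G"
        using face_of_subset[OF facet_of_imp_face_of[OF F]] facet_of_imp_subset[OF GK(1)] by blast
      moreover have "convex G" using GK(1) cK facet_of_imp_face_of face_of_imp_convex by blast
      ultimately have "aff_dim F < aff_dim G" using face_of_aff_dim_lt GK(2) by blast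
      then show False using F GK(1) by (simp add: facet_of_def)
    qed
    show "b x = 0" if "G facet_of K" "G \<noteq> F" "x \<in> G" for G x
    proof -
      have "l G x = 0"
        using outer_normal_orthogonal[OF pK K(2) that(1) that(3) a[OF that(1)]] by (simp add: l_def)
      then show ?thesis unfolding b_def using finS that by (intro prod_zero) (auto simp: S_def)
    qed
  qed
qed

lemma mesh_element:
  fixes \<Omega> :: "(real^'n) set"
  assumes "conforming_mesh \<Omega> T" "K \<in> T"
  shows mesh_simplex: "int CARD('n) simplex K" and mesh_polytope: "polytope K" and mesh_polyhedron: "polyhedron K"
    and mesh_aff_dim: "aff_dim K = int CARD('n)" and mesh_compact: "compact K" and mesh_convex: "convex K"
    and mesh_subset: "K \<subseteq> closure \<Omega>" and mesh_interior: "rel_interior K = interior K" "interior K \<noteq> {}"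
    and mesh_lebesgue: "K \<in> sets lebesgue"
proof -
  show s: "int CARD('n) simplex K" and "K \<subseteq> closure \<Omega>"
    using assms by (auto simp: conforming_mesh_def)
  show p: "polytope K" "polyhedron K" and a: "aff_dim K = int CARD('n)"
    using simplex_imp_polytope[OF s] simplex_imp_polyhedron[OF s] aff_dim_simplex[OF s] by auto
  show c: "compact K" "convex K" using polytope_imp_compact[OF p(1)] polytope_imp_convex[OF p(1)] by auto
  have "affine hull K = UNIV" using a aff_dim_eq_full[of K] by simp
  then show r: "rel_interior K = interior K" by (rule rel_interior_interior)
  have "K \<noteq> {}" using a by auto
  then show "interior K \<noteq> {}" using c r rel_interior_eq_empty by metis
  show "K \<in> sets lebesgue" using c by (simp add: lmeasurable_compact fmeasurableD)
qed

lemma mesh_interior_subset: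
  fixes \<Omega> :: "(real^'n) set"
  assumes "conforming_mesh \<Omega> T" "K \<in> T" "open \<Omega>" "convex \<Omega>"
  shows "interior K \<subseteq> \<Omega>"
  using interior_mono[OF mesh_subset[OF assms(1,2)]] convex_interior_closure[OF assms(4)] assms(3)
  by (simp add: interior_open)

text \<open>
  The intersection is a face of \<open>K\<close>; if it meets the interior it is all of \<open>K\<close>, which would
  then be a face of \<open>K'\<close> of the same dimension.
\<close>

lemma mesh_interior_disjoint:
  fixes \<Omega> :: "(real^'n) set"
  assumes m: "conforming_mesh \<Omega> T" and K: "K \<in> T" "K' \<in> T" "K \<noteq> K'"
  shows "interior K \<inter> K' = {}"
proof (rule ccontr)
  assume ne: "interior K \<inter> K' \<noteq> {}"
  have f: "(K \<inter> K') face_of K" "(K' \<inter> K) face_of K'" using m K by (auto simp: conforming_mesh_def triangulation_def)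
  have "K \<subseteq> K \<inter> K'"
    by (rule subset_of_face_of[OF f(1) order_refl])
      (use ne mesh_interior(1)[OF m K(1)] interior_subset[of K] in \<open>auto simp: disjnt_iff\<close>)
  then have "K face_of K'" using f(2) by (metis Int_commute inf.absorb_iff1 le_inf_iff)
  then have "aff_dim K < aff_dim K'"
    using face_of_aff_dim_lt mesh_convex[OF m K(2)] K(3) by blast
  then show False using mesh_aff_dim[OF m] K by simp
qed

text \<open>
  Take interior points \<open>y\<close> of \<open>K\<close> and \<open>z\<close> of \<open>L\<close>, and a point \<open>x\<close> in the relative
  interior of \<open>F\<close>. As \<open>y\<close> and \<open>z\<close> lie strictly on the same side of \<open>F\<close>, the vectors
  \<open>y - x\<close> and \<open>c (z - x)\<close> differ, for a suitable \<open>c > 0\<close>, by a tangential vector \<open>\<tau>\<close>. For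
  small \<open>s\<close> the point \<open>x + s (y - x)\<close> of the interior of \<open>K\<close> is then a convex combination
  of \<open>z\<close> and of a point \<open>w\<close> near \<open>x\<close> in the plane of \<open>F\<close>, and such a \<open>w\<close> belongs to \<open>F\<close>.
\<close>

lemma facet_same_normal_interiors_meet:
  fixes K L :: "(real^'n) set"
  assumes K: "polyhedron K" "aff_dim K = int CARD('n)" "interior K \<noteq> {}" "F facet_of K"
    and L: "polyhedron L" "aff_dim L = int CARD('n)" "interior L \<noteq> {}" "F facet_of L"
    and e: "outer_normal K F = outer_normal L F"
  shows "interior K \<inter> L \<noteq> {}"
proof -
  define \<nu> where "\<nu> = outer_normal K F"
  have cK: "convex K" "convex L" using K(1) L(1) polyhedron_imp_convex by auto
  have "F \<noteq> {}" "F face_of K" using K(4) by (auto simp: facet_of_def)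
  then have cF: "convex F" using face_of_imp_convex cK by blast
  then obtain x where x: "x \<in> rel_interior F" using \<open>F \<noteq> {}\<close> rel_interior_eq_empty by blast
  then have xF: "x \<in> F" using rel_interior_subset by blast
  have xKL: "x \<in> K" "x \<in> L"
    by (rule subsetD[OF facet_of_imp_subset[OF K(4)] xF], rule subsetD[OF facet_of_imp_subset[OF L(4)] xF])
  have side: "\<nu> \<bullet> (y - x) < 0" if yM: "y \<in> interior M" and M: "M = K \<or> M = L" for y M
  proof -
    obtain r where r: "r > 0" "cball y r \<subseteq> M" using yM unfolding mem_interior_cball by blast
    have n: "norm \<nu> = 1" unfolding \<nu>_def by (rule outer_normal_norm[OF K(1,2,4)])
    have "y + r *\<^sub>R \<nu> \<in> cball y r" using n r(1) by (simp add: dist_norm)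
    then have "y + r *\<^sub>R \<nu> \<in> M" using r(2) by blast
    then have "\<nu> \<bullet> (y + r *\<^sub>R \<nu> - x) \<le> 0"
      using M outer_normal_le[OF K(1,2,4) xF, folded \<nu>_def]
        outer_normal_le[OF L(1,2,4) xF, folded e, folded \<nu>_def] by blast
    moreover have "\<nu> \<bullet> \<nu> = 1" using n by (simp add: norm_eq_1)
    ultimately show ?thesis using r(1) by (simp add: inner_simps)
  qed
  obtain y z where y: "y \<in> interior K" and z: "z \<in> interior L" using K(3) L(3) by blast
  \<comment> \<open>\<open>c\<close> equalises the normal components\<close>
  define c where "c = (\<nu> \<bullet> (y - x)) / (\<nu> \<bullet> (z - x))"
  have cz: "\<nu> \<bullet> (y - x) < 0" "\<nu> \<bullet> (z - x) < 0" using side y z by auto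
  then have c: "c > 0" by (simp add: c_def divide_neg_neg)
  define \<tau> where "\<tau> = (y - x) - c *\<^sub>R (z - x)"
  have "\<nu> \<bullet> \<tau> = 0" using cz by (simp add: \<tau>_def c_def inner_diff_right)
  \<comment> \<open>hence \<open>\<tau>\<close> is tangential\<close>
  have \<tau>: "\<tau> \<in> span (directions F)"
  proof -
    note o = facet_frame[OF K(1,2,4), folded \<nu>_def]
    have "\<tau> = (\<Sum>b\<in>insert \<nu> (tangent_frame F). (\<tau> \<bullet> b) *\<^sub>R b)"
      using orthonormal_expansion[OF o(2), of \<tau>] o(3) by simp
    also have "\<dots> = (\<Sum>b\<in>tangent_frame F. (\<tau> \<bullet> b) *\<^sub>R b)"
      using o(1) orthonormal_finite[OF orthonormal_tangent_frame, of F] \<open>\<nu> \<bullet> \<tau> = 0\<close> by (simp add: inner_commute)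
    also have "\<dots> \<in> span (tangent_frame F)" by (intro span_sum span_scale span_base)
    finally show ?thesis by (simp add: span_tangent_frame)
  qed
  obtain e where e: "e > 0" "cball x e \<inter> affine hull F \<subseteq> F" using x by (auto simp: mem_rel_interior_cball)
  have aff: "x + r *\<^sub>R \<tau> \<in> affine hull F" for r
    by (rule affine_hull_add_direction[OF span_scale[OF \<tau>] hull_inc[OF xF]])
  \<comment> \<open>small enough for \<open>s c \<le> 1/2\<close> and for \<open>w\<close> below to stay within distance \<open>e\<close> of \<open>x\<close>\<close>
  define s where "s = min (1 / (2 * (1 + c))) (e / (2 * (1 + norm \<tau>)))"
  have np: "1 + norm \<tau> > 0" by (simp add: add_pos_nonneg)
  have s: "s > 0" using c e np by (simp add: s_def)
  have sc: "s * (1 + c) \<le> 1 / 2"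
  proof -
    have "s * (1 + c) \<le> (1 / (2 * (1 + c))) * (1 + c)" using c by (intro mult_right_mono) (auto simp: s_def)
    also have "\<dots> = 1 / 2" using c by (simp add: field_simps)
    finally show ?thesis .
  qed
  moreover have "s * c > 0" using s c by simp
  ultimately have s1: "s \<le> 1" "s * c \<le> 1 / 2" using s by (auto simp: distrib_left)
  have st: "s * norm \<tau> \<le> e / 2"
  proof -
    have "s * norm \<tau> \<le> s * (1 + norm \<tau>)" using s by (simp add: mult_left_mono)
    also have "\<dots> \<le> (e / (2 * (1 + norm \<tau>))) * (1 + norm \<tau>)" using np by (intro mult_right_mono) (auto simp: s_def)
    also have "\<dots> = e / 2" using np by (simp add: divide_simps)
    finally show ?thesis .
  qed
  define p where "p = x + s *\<^sub>R (y - x)"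
  have "p \<in> interior K"
  proof -
    have "x - s *\<^sub>R (x - y) \<in> interior K"
      by (rule mem_interior_closure_convex_shrink[OF cK(1) y _ s s1(1)]) (use xKL closure_subset in blast)
    then show ?thesis by (simp add: p_def algebra_simps)
  qed
  moreover have "p \<in> L"
  proof -
    define w where "w = x + (s / (1 - s * c)) *\<^sub>R \<tau>"
    have "\<bar>s / (1 - s * c)\<bar> * norm \<tau> \<le> e"
    proof -
      have "\<bar>s / (1 - s * c)\<bar> = s / (1 - s * c)" using s s1 by simp
      also have "\<dots> \<le> s / (1 / 2)" using s s1 by (intro divide_left_mono) auto
      finally have "\<bar>s / (1 - s * c)\<bar> * norm \<tau> \<le> s / (1 / 2) * norm \<tau>" by (rule mult_right_mono) simp
      then show ?thesis using st by simp
    qed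
    then have "w \<in> cball x e" by (simp add: w_def dist_norm)
    then have "w \<in> F" using e(2) aff unfolding w_def by blast
    then have "w \<in> L" using facet_of_imp_subset[OF L(4)] by blast
    moreover have "z \<in> L" using z interior_subset by blast
    ultimately have "(1 - s * c) *\<^sub>R w + (s * c) *\<^sub>R z \<in> L"
      using cK(2) s s1 c unfolding convex_alt by (simp add: mult_nonneg_nonneg)
    moreover have "(1 - s * c) *\<^sub>R w + (s * c) *\<^sub>R z = p"
    proof -
      have nz: "1 - s * c \<noteq> 0" using s1 by simp
      have "(1 - s * c) *\<^sub>R w = (1 - s * c) *\<^sub>R x + s *\<^sub>R \<tau>" using nz by (simp add: w_def scaleR_add_right)
      then show ?thesis by (simp add: p_def \<tau>_def algebra_simps)
    qed
    ultimately show ?thesis by simp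
  qed
  ultimately show ?thesis by blast
qed

lemma mesh_facet_opposite_normals:
  fixes \<Omega> :: "(real^'n) set"
  assumes m: "conforming_mesh \<Omega> T" and K: "K \<in> T" "L \<in> T" "K \<noteq> L" and F: "F facet_of K" "F facet_of L"
  shows "outer_normal L F = - outer_normal K F"
proof -
  note pK = mesh_polyhedron[OF m K(1)] mesh_aff_dim[OF m K(1)] and pL = mesh_polyhedron[OF m K(2)] mesh_aff_dim[OF m K(2)]
  have "F \<noteq> {}" using F by (simp add: facet_of_def)
  have "outer_normal L F = outer_normal K F \<or> outer_normal L F = - outer_normal K F"
    by (rule unit_normals_eq_or_opposite[OF \<open>F \<noteq> {}\<close> facet_aff_dim[OF F(1) pK(2)]
          outer_normal_norm[OF pK F(1)] outer_normal_orthogonal[OF pK F(1)]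
          outer_normal_norm[OF pL F(2)] outer_normal_orthogonal[OF pL F(2)]])
  moreover have "outer_normal K F \<noteq> outer_normal L F"
    using facet_same_normal_interiors_meet[OF pK mesh_interior(2)[OF m K(1)] F(1) pL mesh_interior(2)[OF m K(2)] F(2)]
      mesh_interior_disjoint[OF m K] by blast
  ultimately show ?thesis by metis
qed

text \<open>
  At a point \<open>x\<close> of the relative interior of \<open>F\<close> inside \<open>\<Omega>\<close>, moving outwards from \<open>K\<close>
  leads into other elements; since there are finitely many closed elements, one of them
  contains \<open>x\<close>. Its intersection with \<open>K\<close> is a proper face of \<open>K\<close> containing \<open>x\<close>, which
  leaves only \<open>F\<close>.
\<close>

lemma interior_face_second_element:
  fixes \<Omega> :: "(real^'n) set"
  assumes m: "conforming_mesh \<Omega> T" and \<Omega>: "open \<Omega>" and K: "K \<in> T" "F facet_of K" and F: "\<not> F \<subseteq> frontier \<Omega>"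
  obtains L where "L \<in> T" "L \<noteq> K" "F facet_of L"
proof -
  note pK = mesh_polyhedron[OF m K(1)] mesh_aff_dim[OF m K(1)]
  have FK: "F \<subseteq> K" by (rule facet_of_imp_subset[OF K(2)])
  have cF: "convex F" using K(2) facet_of_imp_face_of face_of_imp_convex mesh_convex[OF m K(1)] by blast
  obtain z where "z \<in> F" "z \<notin> frontier \<Omega>" using F by blast
  then have z: "z \<in> F" "z \<in> \<Omega>"
    using FK mesh_subset[OF m K(1)] \<Omega> by (auto simp: frontier_def interior_open)
  then have "\<Omega> \<inter> closure (rel_interior F) \<noteq> {}"
    using convex_closure_rel_interior[OF cF] closure_subset by blast
  then have "\<Omega> \<inter> rel_interior F \<noteq> {}" using open_Int_closure_eq_empty[OF \<Omega>] by blast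
  then obtain x where x: "x \<in> \<Omega>" "x \<in> rel_interior F" by blast
  then have xF: "x \<in> F" using rel_interior_subset by blast
  define \<nu> where "\<nu> = outer_normal K F"
  have n: "norm \<nu> = 1" unfolding \<nu>_def by (rule outer_normal_norm[OF pK K(2)])
  have finT: "finite T" and UT: "\<Union>T = closure \<Omega>" using m by (auto simp: conforming_mesh_def triangulation_def)
  have "x \<in> \<Union>(T - {K})"
  proof (rule ccontr)
    assume nx: "x \<notin> \<Union>(T - {K})"
    have "closed (\<Union>(T - {K}))" using finT mesh_compact[OF m] by (intro closed_Union) (auto simp: compact_imp_closed)
    then have "open (\<Omega> - \<Union>(T - {K}))" using \<Omega> by blast
    then obtain e where e: "e > 0" "cball x e \<subseteq> \<Omega> - \<Union>(T - {K})"
      using nx x(1) open_contains_cball by (metis DiffI)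
    have w: "x + e *\<^sub>R \<nu> \<in> \<Omega> - \<Union>(T - {K})" using e n by (intro subsetD[OF e(2)]) (simp add: dist_norm)
    then have "x + e *\<^sub>R \<nu> \<in> \<Union>T" using subsetD[OF closure_subset] unfolding UT by (rule DiffE)
    then have "x + e *\<^sub>R \<nu> \<in> K" using w by blast
    then have "\<nu> \<bullet> (x + e *\<^sub>R \<nu> - x) \<le> 0" unfolding \<nu>_def by (rule outer_normal_le[OF pK K(2) xF])
    then show False using e n by (simp add: dot_square_norm)
  qed
  then obtain L where L: "L \<in> T" "L \<noteq> K" "x \<in> L" by blast
  have f: "(K \<inter> L) face_of K" "(L \<inter> K) face_of L" using m K L by (auto simp: conforming_mesh_def triangulation_def)
  have "F \<subseteq> K \<inter> L"
    by (rule subset_of_face_of[OF f(1) FK]) (use x xF FK L in \<open>auto simp: disjnt_iff\<close>)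
  then have FI: "F face_of (K \<inter> L)" using face_of_subset[OF facet_of_imp_face_of[OF K(2)]] by blast
  have "K \<inter> L \<noteq> K"
    using mesh_interior_disjoint[OF m K(1) L(1)] L(2) mesh_interior(2)[OF m K(1)] interior_subset[of K] by blast
  then have "aff_dim (K \<inter> L) < aff_dim K" using face_of_aff_dim_lt[OF mesh_convex[OF m K(1)] f(1)] by blast
  then have "F = K \<inter> L"
    using face_of_aff_dim_lt[OF _ FI] K(2) convex_Int[OF mesh_convex[OF m K(1)] mesh_convex[OF m L(1)]]
    unfolding facet_of_def by linarith
  then have "F face_of L" using f(2) by (simp add: Int_commute)
  then have "F facet_of L" using K(2) pK(2) mesh_aff_dim[OF m L(1)] by (simp add: facet_of_def)
  then show ?thesis using that L by blast
qed

text \<open>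
  A third element would have a normal opposite to both of two opposite vectors.
\<close>

lemma interior_face_elements:
  fixes \<Omega> :: "(real^'n) set"
  assumes m: "conforming_mesh \<Omega> T" and \<Omega>: "open \<Omega>" and F: "F \<in> interior_faces \<Omega> T"
  obtains K L where "K \<noteq> L" "{K. K \<in> T \<and> F facet_of K} = {K, L}" "outer_normal L F = - outer_normal K F"
proof -
  obtain K where K: "K \<in> T" "F facet_of K" and nF: "\<not> F \<subseteq> frontier \<Omega>" using F by (auto simp: interior_faces_def)
  obtain L where L: "L \<in> T" "L \<noteq> K" "F facet_of L"
    by (rule interior_face_second_element[OF m \<Omega> K nF])
  have opp: "outer_normal L F = - outer_normal K F"
    using mesh_facet_opposite_normals[OF m K(1) L(1)] L K by blast
  have "M = K \<or> M = L" if M: "M \<in> T" "F facet_of M" for M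
  proof (rule ccontr)
    assume "\<not> (M = K \<or> M = L)"
    then have "outer_normal M F = - outer_normal K F" "outer_normal M F = - outer_normal L F"
      using mesh_facet_opposite_normals[OF m K(1) M(1)] mesh_facet_opposite_normals[OF m L(1) M(1)] K L M by blast+
    then have "outer_normal K F = - outer_normal K F" using opp by simp
    then have "outer_normal K F \<bullet> outer_normal K F = - outer_normal K F \<bullet> outer_normal K F" by (rule arg_cong)
    then have "outer_normal K F = 0" by simp
    then show False using outer_normal_norm[OF mesh_polyhedron[OF m K(1)] mesh_aff_dim[OF m K(1)] K(2)] by simp
  qed
  then have "{K. K \<in> T \<and> F facet_of K} = {K, L}" using K L by blast
  then show ?thesis using that L opp by metis
qed

text \<open>
  The relative boundary of a facet consists of vertices when \<open>n = 2\<close> and of edges when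
  \<open>n = 3\<close>, which is where members of \<^const>\<open>Vh\<close> are \<open>C\<^sup>1\<close>.
\<close>

lemma Vh_grad_eq_on_face_boundary:
  fixes \<Omega> :: "(real^'n) set"
  assumes n: "CARD('n) = 2 \<or> CARD('n) = 3" and m: "conforming_mesh \<Omega> T" and v: "v \<in> Vh \<Omega> T k"
    and K: "K \<in> T" "L \<in> T" and F: "F facet_of K" "F facet_of L" and x: "x \<in> rel_frontier F"
  shows "grad (piece v K) x = grad (piece v L) x"
proof -
  have pF: "polyhedron F"
    using face_of_polyhedron_polyhedron[OF mesh_polyhedron[OF m K(1)] facet_of_imp_face_of[OF F(1)]] .
  then obtain E where E: "E facet_of F" "x \<in> E" using x by (auto simp: rel_frontier_of_polyhedron)
  have EK: "E face_of K" "E \<subseteq> K" "E \<subseteq> L"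
    using face_of_trans[OF facet_of_imp_face_of[OF E(1)] facet_of_imp_face_of[OF F(1)]]
      facet_of_imp_subset[OF E(1)] facet_of_imp_subset[OF F(1)] facet_of_imp_subset[OF F(2)] by auto
  have dE: "aff_dim E = int CARD('n) - 2"
    using E(1) facet_aff_dim[OF F(1) mesh_aff_dim[OF m K(1)]] by (simp add: facet_of_def)
  have "C1_on T v E"
  proof (cases "CARD('n) = 2")
    case True
    then obtain z where "E = {z}" using dE aff_dim_eq_0 by auto
    then have "z \<in> mesh_vertices T" using EK(1) K(1) by (auto simp: mesh_vertices_def face_of_singleton)
    then show ?thesis using v True \<open>E = {z}\<close> by (auto simp: Vh_def)
  next
    case False
    then have "E \<in> mesh_edges T" using n dE EK(1) K(1) by (auto simp: mesh_edges_def)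
    then show ?thesis using v False by (auto simp: Vh_def)
  qed
  then show ?thesis using K EK(2,3) E(2) unfolding C1_on_def by blast
qed

section \<open>Traces of members of \<open>H\<^sub>0\<^sup>1(\<Omega>)\<close>\<close>

text \<open>
  Convergence in \<open>L\<^sup>2\<close> implies weak convergence against bounded weights. Young's inequality
  \<open>|h| \<le> d + h\<^sup>2/d\<close> with \<open>d\<^sup>2\<close> slightly larger than the integral of \<open>E\<close> takes the place of
  the Cauchy-Schwarz inequality.
\<close>

lemma weighted_integral_tendsto_zero:
  fixes h E :: "nat \<Rightarrow> 'a \<Rightarrow> real"
  assumes "finite_measure M" and W: "W \<in> borel_measurable M" "\<And>x. \<bar>W x\<bar> \<le> C"
    and h: "\<And>m. h m \<in> borel_measurable M" "\<And>m x. (h m x)\<^sup>2 \<le> E m x"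
    and E: "\<And>m. integrable M (E m)" "(\<lambda>m. integral\<^sup>L M (E m)) \<longlonglongrightarrow> 0"
  shows "(\<lambda>m. integral\<^sup>L M (\<lambda>x. W x * h m x)) \<longlonglongrightarrow> 0"
proof -
  interpret finite_measure M by fact
  \<comment> \<open>the term \<open>1 / (m + 1)\<close> keeps \<open>d m\<close> positive\<close>
  define d where "d m = sqrt (integral\<^sup>L M (E m) + 1 / real (Suc m))" for m
  have E0: "0 \<le> E m x" for m x using h(2)[of m x] by (meson order_trans zero_le_power2)
  have IE: "0 \<le> integral\<^sup>L M (E m)" for m by (rule integral_nonneg_AE) (use E0 in auto)
  have dp: "d m > 0" for m using IE[of m] by (simp add: d_def add_nonneg_pos)
  have d2: "integral\<^sup>L M (E m) \<le> d m * d m" for m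
    using IE[of m] by (simp add: d_def flip: power2_eq_square)
  have d0: "d \<longlonglongrightarrow> 0"
  proof -
    have "(\<lambda>m. sqrt (integral\<^sup>L M (E m) + 1 / real (Suc m))) \<longlonglongrightarrow> sqrt (0 + 0)"
      by (intro tendsto_real_sqrt tendsto_add E(2) LIMSEQ_Suc[OF lim_1_over_n])
    then show ?thesis by (simp add: d_def[abs_def])
  qed
  have C0: "0 \<le> C" using W(2)[of undefined] abs_ge_zero order_trans by blast
  have bnd: "\<bar>W x * h m x\<bar> \<le> C * (d m + E m x / d m)" for m x
  proof -
    have "0 \<le> (d m - \<bar>h m x\<bar>)\<^sup>2" by simp
    then have "2 * (d m * \<bar>h m x\<bar>) \<le> d m * d m + (h m x)\<^sup>2" by (simp add: power2_eq_square algebra_simps)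
    moreover have "0 \<le> d m * \<bar>h m x\<bar>" using dp[of m] by simp
    ultimately have "d m * \<bar>h m x\<bar> \<le> d m * d m + E m x" using h(2)[of m x] by linarith
    then have "\<bar>h m x\<bar> \<le> (d m * d m + E m x) / d m" using dp[of m] by (simp add: pos_le_divide_eq mult.commute)
    also have "\<dots> = d m + E m x / d m" using dp[of m] by (simp add: add_divide_distrib)
    finally show ?thesis unfolding abs_mult by (intro mult_mono W(2) C0) auto
  qed
  have intb: "integrable M (\<lambda>x. C * (d m + E m x / d m))" for m using E(1)[of m] by simp
  have "norm (integral\<^sup>L M (\<lambda>x. W x * h m x)) \<le> C * (measure M (space M) + 1) * d m" for m
  proof -
    have "integrable M (\<lambda>x. W x * h m x)"
      using intb[of m] by (rule Bochner_Integration.integrable_bound)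
        (auto intro!: AE_I2 borel_measurable_times W h order_trans[OF bnd abs_ge_self])
    then have "integral\<^sup>L M (\<lambda>x. norm (W x * h m x)) \<le> integral\<^sup>L M (\<lambda>x. C * (d m + E m x / d m))"
      by (intro integral_mono integrable_norm intb) (simp_all only: real_norm_def bnd)
    then have "norm (integral\<^sup>L M (\<lambda>x. W x * h m x)) \<le> integral\<^sup>L M (\<lambda>x. C * (d m + E m x / d m))"
      by (rule order_trans[OF integral_norm_bound])
    also have "\<dots> = C * (d m * measure M (space M) + integral\<^sup>L M (E m) / d m)"
      using E(1)[of m] by (simp add: mult.commute)
    also have "\<dots> \<le> C * (d m * measure M (space M) + d m)"
      using d2[of m] dp[of m] C0 by (intro mult_left_mono add_left_mono) (auto simp: pos_divide_le_eq)
    finally show ?thesis by (simp add: algebra_simps)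
  qed
  moreover have "(\<lambda>m. C * (measure M (space M) + 1) * d m) \<longlonglongrightarrow> 0"
    using tendsto_mult[OF tendsto_const d0, of "C * (measure M (space M) + 1)"] by simp
  ultimately show ?thesis by - (rule Lim_null_comparison, auto intro!: always_eventually)
qed

lemma test_function_C1_fun: "test_function \<Omega> \<phi> \<Longrightarrow> C1_fun \<phi>"
  unfolding test_function_def by (intro Ck_C1_fun) blast

lemma L2_on_continuous:
  fixes \<Omega> :: "(real^'n) set"
  assumes \<Omega>: "bounded \<Omega>" "open \<Omega>" and f: "continuous_on UNIV f"
  shows "L2_on \<Omega> f"
proof -
  let ?M = "lebesgue_on \<Omega>"
  interpret finite_measure ?M by (rule finite_measure_lebesgue_on[OF lmeasurable_open[OF \<Omega>]])
  have [measurable]: "f \<in> borel_measurable ?M"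
    using continuous_imp_measurable_on_sets_lebesgue[OF continuous_on_subset[OF f subset_UNIV]]
      lmeasurable_open[OF \<Omega>] by (simp add: fmeasurableD)
  have "compact (closure \<Omega>)" using \<Omega>(1) by simp
  then have "bounded (f ` closure \<Omega>)"
    by (intro compact_imp_bounded compact_continuous_image continuous_on_subset[OF f subset_UNIV])
  then obtain C where "\<And>x. x \<in> closure \<Omega> \<Longrightarrow> \<bar>f x\<bar> \<le> C" unfolding bounded_iff by auto
  then have C: "\<And>x. x \<in> \<Omega> \<Longrightarrow> \<bar>f x\<bar> \<le> C" using closure_subset by blast
  have "(f x)\<^sup>2 \<le> C\<^sup>2" if "x \<in> \<Omega>" for x using C[OF that] by (metis abs_ge_zero power2_abs power_mono)
  then have "integrable ?M (\<lambda>x. (f x)\<^sup>2)"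
    by (intro integrable_const_bound[where B="C\<^sup>2"]) auto
  then show ?thesis by (simp add: L2_on_def)
qed

lemma L2_on_diff:
  assumes "L2_on \<Omega> a" "L2_on \<Omega> b"
  shows "L2_on \<Omega> (\<lambda>x. a x - b x)"
proof -
  let ?M = "lebesgue_on \<Omega>"
  have [measurable]: "a \<in> borel_measurable ?M" "b \<in> borel_measurable ?M" using assms by (auto simp: L2_on_def)
  have i: "integrable ?M (\<lambda>x. 2 * (a x)\<^sup>2 + 2 * (b x)\<^sup>2)" using assms by (auto simp: L2_on_def)
  have le: "(a x - b x)\<^sup>2 \<le> 2 * (a x)\<^sup>2 + 2 * (b x)\<^sup>2" for x
  proof -
    have "0 \<le> (a x + b x)\<^sup>2" by simp
    then show ?thesis by (simp add: power2_eq_square algebra_simps)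
  qed
  have "integrable ?M (\<lambda>x. (a x - b x)\<^sup>2)" using i
  proof (rule Bochner_Integration.integrable_bound)
    show "(\<lambda>x. (a x - b x)\<^sup>2) \<in> borel_measurable ?M" by measurable
    show "AE x in ?M. norm ((a x - b x)\<^sup>2) \<le> norm (2 * (a x)\<^sup>2 + 2 * (b x)\<^sup>2)"
      unfolding real_norm_def abs_power2 by (intro AE_I2 order_trans[OF le abs_ge_self])
  qed
  then show ?thesis by (simp add: L2_on_def)
qed

text \<open>
  What the trace argument retains of convergence in \<open>H\<^sup>1(\<Omega>)\<close>: convergence of all integrals of
  the functions and of their directional derivatives against bounded weights.
\<close>

definition weak_H1_limit ::
  "(real^'n) set \<Rightarrow> (nat \<Rightarrow> real^'n \<Rightarrow> real) \<Rightarrow> (real^'n \<Rightarrow> real) \<Rightarrow> (real^'n \<Rightarrow> real^'n) \<Rightarrow> bool" where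
  "weak_H1_limit \<Omega> \<phi> v g \<longleftrightarrow> (\<forall>W C. W \<in> borel_measurable (lebesgue_on \<Omega>) \<longrightarrow> (\<forall>x. \<bar>W x\<bar> \<le> (C::real)) \<longrightarrow>
     (\<lambda>m. integral\<^sup>L (lebesgue_on \<Omega>) (\<lambda>x. W x * (\<phi> m x - v x))) \<longlonglongrightarrow> 0 \<and>
     (\<forall>e. norm e = 1 \<longrightarrow>
       (\<lambda>m. integral\<^sup>L (lebesgue_on \<Omega>) (\<lambda>x. W x * (dir_deriv e (\<phi> m) x - g x \<bullet> e))) \<longlonglongrightarrow> 0))"

lemma H10_approximation:
  fixes \<Omega> :: "(real^'n) set"
  assumes \<Omega>: "bounded \<Omega>" "open \<Omega>" and v: "H10 \<Omega> v"
  obtains \<phi> g where "\<And>m::nat. test_function \<Omega> (\<phi> m)" "\<And>i. L2_on \<Omega> (\<lambda>x. g x $ i)"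
    "weak_H1_limit \<Omega> \<phi> v g"
proof -
  let ?M = "lebesgue_on \<Omega>"
  obtain g \<phi> where g: "\<And>i. L2_on \<Omega> (\<lambda>x. g x $ i)" and \<phi>: "\<And>m::nat. test_function \<Omega> (\<phi> m)"
    and lim: "(\<lambda>m. integral\<^sup>L ?M (\<lambda>x. (\<phi> m x - v x)\<^sup>2 + (norm (grad (\<phi> m) x - g x))\<^sup>2)) \<longlonglongrightarrow> 0"
    using v unfolding H10_def by blast
  have v2: "L2_on \<Omega> v" using v unfolding H10_def by blast
  have \<Omega>m: "\<Omega> \<in> lmeasurable" by (rule lmeasurable_open[OF \<Omega>])
  interpret finite_measure ?M by (rule finite_measure_lebesgue_on[OF \<Omega>m])
  note L2_cont = L2_on_continuous[OF \<Omega>]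
  have C1: "C1_fun (\<phi> m)" for m by (rule test_function_C1_fun[OF \<phi>])
  have d0: "L2_on \<Omega> (\<lambda>x. \<phi> m x - v x)" for m by (intro L2_on_diff L2_cont C1_fun_continuous C1 v2)
  have di: "L2_on \<Omega> (\<lambda>x. partial i (\<phi> m) x - g x $ i)" for m i
    by (intro L2_on_diff g L2_cont) (use C1[of m] in \<open>simp add: C1_fun_def partial_def\<close>)
  define E where "E m x = (\<phi> m x - v x)\<^sup>2 + (norm (grad (\<phi> m) x - g x))\<^sup>2" for m x
  have nE: "(norm (grad (\<phi> m) x - g x))\<^sup>2 = (\<Sum>i\<in>UNIV. (partial i (\<phi> m) x - g x $ i)\<^sup>2)" for m x
    unfolding power2_norm_eq_inner by (simp add: inner_vec_def grad_def power2_eq_square)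
  have intE: "integrable ?M (E m)" for m
    unfolding E_def nE using d0 di by (auto simp: L2_on_def)
  have limE: "(\<lambda>m. integral\<^sup>L ?M (E m)) \<longlonglongrightarrow> 0" using lim by (simp add: E_def[abs_def])
  have "weak_H1_limit \<Omega> \<phi> v g"
    unfolding weak_H1_limit_def
  proof (intro allI impI conjI)
    fix W and C :: real assume "W \<in> borel_measurable ?M" "\<forall>x. \<bar>W x\<bar> \<le> C"
    then have W: "W \<in> borel_measurable ?M" "\<And>x. \<bar>W x\<bar> \<le> C" by auto
    show "(\<lambda>m. integral\<^sup>L ?M (\<lambda>x. W x * (\<phi> m x - v x))) \<longlonglongrightarrow> 0"
      by (rule weighted_integral_tendsto_zero[OF finite_measure_axioms W _ _ intE limE])
        (use d0 in \<open>auto simp: L2_on_def E_def\<close>)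
    fix e :: "real^'n" assume e: "norm e = 1"
    have dd: "dir_deriv e (\<phi> m) x - g x \<bullet> e = (\<Sum>i\<in>UNIV. e $ i * (partial i (\<phi> m) x - g x $ i))" for m x
    proof -
      have "\<phi> m differentiable at x" using C1[of m] by (simp add: C1_fun_def)
      then show ?thesis by (simp add: dir_deriv_eq_partials inner_vec_def right_diff_distrib sum_subtractf mult.commute)
    qed
    show "(\<lambda>m. integral\<^sup>L ?M (\<lambda>x. W x * (dir_deriv e (\<phi> m) x - g x \<bullet> e))) \<longlonglongrightarrow> 0"
    proof (rule weighted_integral_tendsto_zero[OF finite_measure_axioms W _ _ intE limE])
      show "(\<lambda>x. dir_deriv e (\<phi> m) x - g x \<bullet> e) \<in> borel_measurable ?M" for m
        unfolding dd using di[of _ m] unfolding L2_on_def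
        by (intro borel_measurable_sum borel_measurable_times borel_measurable_const) blast
      show "(dir_deriv e (\<phi> m) x - g x \<bullet> e)\<^sup>2 \<le> E m x" for m x
      proof -
        have "\<phi> m differentiable at x" using C1[of m] by (simp add: C1_fun_def)
        then have "dir_deriv e (\<phi> m) x - g x \<bullet> e = (grad (\<phi> m) x - g x) \<bullet> e"
          by (simp add: inner_diff_left grad_inner_dir_deriv)
        then have "\<bar>dir_deriv e (\<phi> m) x - g x \<bullet> e\<bar> \<le> norm (grad (\<phi> m) x - g x)"
          using Cauchy_Schwarz_ineq2[of "grad (\<phi> m) x - g x" e] e by simp
        then have "(dir_deriv e (\<phi> m) x - g x \<bullet> e)\<^sup>2 \<le> (norm (grad (\<phi> m) x - g x))\<^sup>2"
          by (metis abs_ge_zero power2_abs power_mono)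
        then show ?thesis by (simp add: E_def add_increasing)
      qed
    qed
  qed
  then show ?thesis by (rule that[OF \<phi> g])
qed

lemma Vh_piece:
  fixes \<Omega> :: "(real^'n) set"
  assumes "v \<in> Vh \<Omega> T k" "conforming_mesh \<Omega> T" "K \<in> T"
  shows "rpf (piece v K)" "AE x in lebesgue_on K. v x = piece v K x"
proof -
  obtain p where p: "p \<in> Pk k" "AE x in lebesgue_on K. v x = p x" using assms by (auto simp: Vh_def)
  have "piece v K = p"
    by (rule piece_unique[OF mesh_interior(2)[OF assms(2,3)] mesh_lebesgue[OF assms(2,3)] Pk_rpf[OF p(1)] p(2)])
  then show "rpf (piece v K)" "AE x in lebesgue_on K. v x = piece v K x"
    using p Pk_rpf by auto
qed

text \<open>
  Membership in \<open>H\<^sub>0\<^sup>1(\<Omega>)\<close> speaks about integrals over \<open>\<Omega>\<close>, which contains the interior of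
  an element but possibly not all of it; the boundary of a convex set is a null set.
\<close>

lemma lebesgue_on_interior_weight:
  fixes f :: "real^'n \<Rightarrow> real"
  assumes K: "compact K" "convex K" "interior K \<subseteq> \<Omega>" and \<Omega>: "\<Omega> \<in> sets lebesgue" and f: "continuous_on UNIV f"
  shows "integral\<^sup>L (lebesgue_on \<Omega>) (\<lambda>x. indicator (interior K) x * f x) =
    integral\<^sup>L lborel (\<lambda>x. indicator K x * f x)"
proof -
  have [measurable]: "f \<in> borel_measurable borel" "K \<in> sets borel" "interior K \<in> sets borel"
    using f K by (auto intro: borel_measurable_continuous_onI borel_compact)
  have "integral\<^sup>L (lebesgue_on \<Omega>) (\<lambda>x. indicator (interior K) x * f x) =
      integral\<^sup>L lebesgue (\<lambda>x. indicator \<Omega> x * (indicator (interior K) x * f x))"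
    using \<Omega> by (subst integral_restrict_space) auto
  also have "\<dots> = integral\<^sup>L lebesgue (\<lambda>x. indicator (interior K) x * f x)"
    using K(3) by (intro Bochner_Integration.integral_cong refl) (auto simp: indicator_def)
  also have "\<dots> = integral\<^sup>L lborel (\<lambda>x. indicator (interior K) x * f x)"
    by (rule integral_completion) measurable
  also have "\<dots> = integral\<^sup>L lborel (\<lambda>x. indicator K x * f x)"
  proof (rule integral_cong_AE)
    have "negligible (frontier K)" by (rule negligible_convex_frontier[OF K(2)])
    then have "frontier K \<in> null_sets lebesgue" by (simp add: negligible_iff_null_sets)
    then have "frontier K \<in> null_sets lborel"
      by (simp add: null_sets_completion_iff)
    then have "AE x in lborel. x \<notin> frontier K" by (rule AE_not_in)
    then show "AE x in lborel. indicator (interior K) x * f x = indicator K x * f x"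
      by eventually_elim (use K(1) interior_subset in \<open>auto simp: indicator_def frontier_def compact_imp_closed\<close>)
  qed measurable
  finally show ?thesis .
qed

lemma interior_weight:
  fixes f :: "real^'n \<Rightarrow> real"
  assumes "compact K" "\<Omega> \<in> sets lebesgue" and f: "continuous_on UNIV f"
  shows "(\<lambda>x. indicator (interior K) x * f x) \<in> borel_measurable (lebesgue_on \<Omega>)"
    and "\<exists>C. \<forall>x. \<bar>indicator (interior K) x * f x\<bar> \<le> C"
proof -
  have "indicator (interior K) \<in> borel_measurable (lebesgue_on \<Omega>)"
    using borel_measurable_indicator[of "interior K" lebesgue] by (intro measurable_restrict_space1) auto
  then show "(\<lambda>x. indicator (interior K) x * f x) \<in> borel_measurable (lebesgue_on \<Omega>)"
    by (rule borel_measurable_times)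
      (rule continuous_imp_measurable_on_sets_lebesgue[OF continuous_on_subset[OF f subset_UNIV] assms(2)])
  have "bounded (f ` K)"
    by (intro compact_imp_bounded compact_continuous_image continuous_on_subset[OF f subset_UNIV] assms(1))
  then obtain C where "\<And>x. x \<in> K \<Longrightarrow> \<bar>f x\<bar> \<le> C" unfolding bounded_iff by auto
  then have "\<bar>indicator (interior K) x * f x\<bar> \<le> \<bar>C\<bar>" for x
    using interior_subset[of K] by (force simp: indicator_def)
  then show "\<exists>C. \<forall>x. \<bar>indicator (interior K) x * f x\<bar> \<le> C" by blast
qed

lemma integrable_interior_weight:
  fixes f h :: "real^'n \<Rightarrow> real"
  assumes K: "compact K" and \<Omega>: "\<Omega> \<in> lmeasurable" and f: "continuous_on UNIV f" and h: "L2_on \<Omega> h"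
  shows "integrable (lebesgue_on \<Omega>) (\<lambda>x. indicator (interior K) x * f x * h x)"
proof -
  let ?M = "lebesgue_on \<Omega>"
  interpret finite_measure ?M by (rule finite_measure_lebesgue_on[OF \<Omega>])
  note w = interior_weight[OF K fmeasurableD[OF \<Omega>] f]
  obtain C where C: "\<And>x. \<bar>indicator (interior K) x * f x\<bar> \<le> C" using w(2) by blast
  have h2: "h \<in> borel_measurable ?M" "integrable ?M (\<lambda>x. (h x)\<^sup>2)"
    using h unfolding L2_on_def by simp_all
  have "integrable ?M (\<lambda>x. C * h x)" using square_integrable_imp_integrable[OF h2] by simp
  then show ?thesis
  proof (rule Bochner_Integration.integrable_bound)
    show "(\<lambda>x. indicator (interior K) x * f x * h x) \<in> borel_measurable ?M"
      by (rule borel_measurable_times[OF w(1) h2(1)])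
    show "AE x in ?M. norm (indicator (interior K) x * f x * h x) \<le> norm (C * h x)"
    proof (rule AE_I2)
      fix x
      show "norm (indicator (interior K) x * f x * h x) \<le> norm (C * h x)"
        unfolding real_norm_def abs_mult[of C] abs_mult[of "indicator (interior K) x * f x"]
        by (rule mult_right_mono[OF order_trans[OF C abs_ge_self] abs_ge_zero])
    qed
  qed
qed

lemma facet_divergence:
  fixes K :: "(real^'n) set"
  assumes K: "int CARD('n) simplex K" "F facet_of K" and q: "C1_fun q"
    and z: "\<And>G x. G facet_of K \<Longrightarrow> G \<noteq> F \<Longrightarrow> x \<in> G \<Longrightarrow> q x = 0"
  shows "integral\<^sup>L lborel (\<lambda>x. indicator K x * dir_deriv (outer_normal K F) q x) = face_integral F q"
proof -
  let ?\<nu> = "outer_normal K F"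
  have "norm ?\<nu> = 1"
    by (rule outer_normal_norm[OF simplex_imp_polyhedron[OF K(1)] aff_dim_simplex[OF K(1)] K(2)])
  then have "(\<Sum>G | G facet_of K. (outer_normal K G \<bullet> ?\<nu>) * face_integral G q) =
      (\<Sum>G | G facet_of K. if G = F then face_integral F q else 0)"
    using face_integral_zero[of _ q] z by (intro sum.cong) (auto simp: norm_eq_1)
  also have "\<dots> = face_integral F q"
    using K(2) finite_polytope_facets[OF simplex_imp_polytope[OF K(1)]] by simp
  finally show ?thesis by (simp add: simplex_divergence[OF K(1) q])
qed

text \<open>
  The traces on a facet of approximating test functions converge, in the sense of integrals
  against polynomials \<open>\<psi>\<close> that vanish on the other facets, to the trace of the polynomial
  piece.

  By the divergence theorem the integral of \<open>\<phi>\<^sub>m \<psi>\<close> over \<open>F\<close> is the integral over \<open>K\<close> of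
  \<open>\<phi>\<^sub>m \<partial>\<^sub>\<nu>\<psi> + \<psi> \<partial>\<^sub>\<nu>\<phi>\<^sub>m\<close>, and this tends to the integral of \<open>v \<partial>\<^sub>\<nu>\<psi> + \<psi> (g \<bullet> \<nu>)\<close>. The
  divergence theorem for the piece \<open>p\<close> has the same right-hand side except that \<open>\<partial>\<^sub>\<nu>p\<close>
  replaces the weak derivative \<open>g \<bullet> \<nu>\<close>. The limit is therefore off by the defect \<open>R \<psi>\<close>, the
  integral of \<open>\<psi> (g \<bullet> \<nu> - \<partial>\<^sub>\<nu>p)\<close> over \<open>K\<close>.

  The defect is zero. For a polynomial that vanishes on \<open>F\<close> too, all boundary terms are zero,
  hence so is its defect. With \<open>l\<close> the distance to \<open>F\<close>, normalised to values in \<open>[0, 1]\<close> on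
  \<open>K\<close>, the polynomials \<open>\<psi> (1 - (1 - l)\<^bsup>j+1\<^esup>)\<close> are of this kind and tend to \<open>\<psi>\<close> boundedly,
  so that dominated convergence yields \<open>R \<psi> = 0\<close>.
\<close>

lemma facet_trace_tendsto:
  fixes \<Omega> :: "(real^'n) set" and \<phi> :: "nat \<Rightarrow> real^'n \<Rightarrow> real"
  assumes \<Omega>: "bounded \<Omega>" "open \<Omega>" "convex \<Omega>" and m: "conforming_mesh \<Omega> T" and v: "v \<in> Vh \<Omega> T k"
    and K: "K \<in> T" and F: "F facet_of K"
    and \<phi>: "\<And>m. test_function \<Omega> (\<phi> m)" and g: "\<And>i. L2_on \<Omega> (\<lambda>x. g x $ i)"
    and lim: "weak_H1_limit \<Omega> \<phi> v g"
    and \<psi>: "rpf \<psi>" "\<And>G x. G facet_of K \<Longrightarrow> G \<noteq> F \<Longrightarrow> x \<in> G \<Longrightarrow> \<psi> x = 0"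
  shows "(\<lambda>m. face_integral F (\<lambda>x. \<phi> m x * \<psi> x)) \<longlonglongrightarrow> face_integral F (\<lambda>x. piece v K x * \<psi> x)"
proof -
  let ?M = "lebesgue_on \<Omega>"
  define D where "D = interior K"
  define p where "p = piece v K"
  define \<nu> where "\<nu> = outer_normal K F"
  note pK = mesh_polyhedron[OF m K] mesh_aff_dim[OF m K]
  note cK = mesh_compact[OF m K] mesh_convex[OF m K]
  have n: "norm \<nu> = 1" unfolding \<nu>_def by (rule outer_normal_norm[OF pK F])
  have p: "rpf p" unfolding p_def by (rule Vh_piece[OF v m K])
  have D\<Omega>: "D \<subseteq> \<Omega>" unfolding D_def by (rule mesh_interior_subset[OF m K \<Omega>(2,3)])
  have DK: "D \<subseteq> K" unfolding D_def by (rule interior_subset)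
  have \<Omega>m: "\<Omega> \<in> lmeasurable" by (rule lmeasurable_open[OF \<Omega>(1,2)])
  then have \<Omega>l: "\<Omega> \<in> sets lebesgue" by (rule fmeasurableD)
  note weight = interior_weight[OF cK(1) \<Omega>l, folded D_def]
  note wint = integrable_interior_weight[OF cK(1) \<Omega>m, folded D_def]
  have L2_v: "L2_on \<Omega> v" using v by (auto simp: Vh_def H10_def)
  have vp: "AE x in ?M. x \<in> D \<longrightarrow> v x = p x"
  proof -
    have "AE x in lebesgue. x \<in> K \<longrightarrow> v x = p x"
      using Vh_piece(2)[OF v m K] AE_restrict_space_iff[of K lebesgue] mesh_lebesgue[OF m K] by (simp add: p_def)
    then have "AE x in lebesgue. x \<in> \<Omega> \<longrightarrow> (x \<in> D \<longrightarrow> v x = p x)" by eventually_elim (use DK in blast)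
    then show ?thesis using AE_restrict_space_iff[of \<Omega> lebesgue] \<Omega>l by simp
  qed
  have cp: "continuous_on UNIV p" "continuous_on UNIV (dir_deriv \<nu> p)"
    using rpf_continuous_on[OF p] rpf_continuous_on[OF rpf_dir_deriv[OF p]] by auto
  have div: "integral\<^sup>L ?M (\<lambda>x. indicator D x * dir_deriv \<nu> q x) = face_integral F q"
    if q: "C1_fun q" "\<And>G x. G facet_of K \<Longrightarrow> G \<noteq> F \<Longrightarrow> x \<in> G \<Longrightarrow> q x = 0" for q
    unfolding D_def \<nu>_def
    by (rule trans[OF lebesgue_on_interior_weight[OF cK D\<Omega>[unfolded D_def] \<Omega>l] facet_divergence[OF mesh_simplex[OF m K] F q]])
      (use q(1) in \<open>simp_all add: C1_fun_def\<close>)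
  let ?I = "\<lambda>f h. integral\<^sup>L ?M (\<lambda>x. indicator D x * f x * h x)"
  define R where "R \<eta> = integral\<^sup>L ?M (\<lambda>x. indicator D x * \<eta> x * (g x \<bullet> \<nu> - dir_deriv \<nu> p x))" for \<eta>
  note L2_cont = L2_on_continuous[OF \<Omega>(1,2)]
  have gint: "integrable ?M (\<lambda>x. indicator D x * f x * (g x \<bullet> \<nu>))" if f: "continuous_on UNIV f" for f
  proof -
    have "integrable ?M (\<lambda>x. \<Sum>i\<in>UNIV. \<nu> $ i * (indicator D x * f x * g x $ i))"
      by (intro Bochner_Integration.integrable_sum integrable_mult_right wint f g)
    then show ?thesis by (simp add: inner_vec_def sum_distrib_left mult_ac)
  qed
  have key: "(\<lambda>m. face_integral F (\<lambda>x. \<phi> m x * \<eta> x)) \<longlonglongrightarrow> R \<eta> + face_integral F (\<lambda>x. p x * \<eta> x)"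
    if \<eta>: "rpf \<eta>" "\<And>G x. G facet_of K \<Longrightarrow> G \<noteq> F \<Longrightarrow> x \<in> G \<Longrightarrow> \<eta> x = 0" for \<eta>
  proof -
    have c: "continuous_on UNIV \<eta>" "continuous_on UNIV (dir_deriv \<nu> \<eta>)"
      using rpf_continuous_on[OF \<eta>(1)] rpf_continuous_on[OF rpf_dir_deriv[OF \<eta>(1)]] by auto
    have d\<eta>: "\<eta> differentiable at x" for x by (rule rpf_differentiable[OF \<eta>(1)])
    have dp: "p differentiable at x" for x by (rule rpf_differentiable[OF p])
    have C1\<phi>: "C1_fun (\<phi> m)" for m by (rule test_function_C1_fun[OF \<phi>])
    have d\<phi>: "\<phi> m differentiable at x" for m x using C1\<phi>[of m] by (simp add: C1_fun_def)
    let ?A = "\<lambda>m. integral\<^sup>L ?M (\<lambda>x. (indicator D x * \<eta> x) * (dir_deriv \<nu> (\<phi> m) x - g x \<bullet> \<nu>))"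
    let ?B = "\<lambda>m. integral\<^sup>L ?M (\<lambda>x. (indicator D x * dir_deriv \<nu> \<eta> x) * (\<phi> m x - v x))"
    obtain C0 C1 where C: "\<And>x. \<bar>indicator D x * \<eta> x\<bar> \<le> C0" "\<And>x. \<bar>indicator D x * dir_deriv \<nu> \<eta> x\<bar> \<le> C1"
      using weight(2)[OF c(1)] weight(2)[OF c(2)] by blast
    have "?A \<longlonglongrightarrow> 0" using lim weight(1)[OF c(1)] C(1) n unfolding weak_H1_limit_def by blast
    moreover have "?B \<longlonglongrightarrow> 0" using lim weight(1)[OF c(2)] C(2) unfolding weak_H1_limit_def by blast
    ultimately have AB: "(\<lambda>m. ?A m + ?B m) \<longlonglongrightarrow> 0" using tendsto_add by fastforce
    have "face_integral F (\<lambda>x. \<phi> m x * \<eta> x) = (?A m + ?B m) + (R \<eta> + face_integral F (\<lambda>x. p x * \<eta> x))" for m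
    proof -
      have i\<phi>: "L2_on \<Omega> (\<phi> m)" "L2_on \<Omega> (dir_deriv \<nu> (\<phi> m))"
        by (rule L2_cont[OF C1_fun_continuous[OF C1\<phi>]]) (rule L2_cont, use C1\<phi>[of m] in \<open>simp add: C1_fun_def\<close>)
      have lhs: "face_integral F (\<lambda>x. \<phi> m x * \<eta> x) =
          ?I \<eta> (dir_deriv \<nu> (\<phi> m)) + ?I (dir_deriv \<nu> \<eta>) (\<phi> m)"
      proof -
        have "face_integral F (\<lambda>x. \<phi> m x * \<eta> x) = integral\<^sup>L ?M (\<lambda>x. indicator D x * dir_deriv \<nu> (\<lambda>x. \<phi> m x * \<eta> x) x)"
          by (rule div[symmetric]) (rule C1_fun_mult[OF C1\<phi> rpf_C1_fun[OF \<eta>(1)]], simp add: \<eta>(2))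
        also have "\<dots> = integral\<^sup>L ?M (\<lambda>x. indicator D x * \<eta> x * dir_deriv \<nu> (\<phi> m) x + indicator D x * dir_deriv \<nu> \<eta> x * \<phi> m x)"
          by (simp add: dir_deriv_mult d\<phi> d\<eta> algebra_simps)
        also have "\<dots> = ?I \<eta> (dir_deriv \<nu> (\<phi> m)) + ?I (dir_deriv \<nu> \<eta>) (\<phi> m)"
          by (intro Bochner_Integration.integral_add wint c i\<phi>)
        finally show ?thesis .
      qed
      have pp: "face_integral F (\<lambda>x. p x * \<eta> x) =
          ?I \<eta> (dir_deriv \<nu> p) + ?I (dir_deriv \<nu> \<eta>) v"
      proof -
        have "face_integral F (\<lambda>x. p x * \<eta> x) = integral\<^sup>L ?M (\<lambda>x. indicator D x * dir_deriv \<nu> (\<lambda>x. p x * \<eta> x) x)"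
          by (rule div[symmetric]) (rule C1_fun_mult[OF rpf_C1_fun[OF p] rpf_C1_fun[OF \<eta>(1)]], simp add: \<eta>(2))
        also have "\<dots> = integral\<^sup>L ?M (\<lambda>x. indicator D x * \<eta> x * dir_deriv \<nu> p x + indicator D x * dir_deriv \<nu> \<eta> x * p x)"
          by (simp add: dir_deriv_mult dp d\<eta> algebra_simps)
        also have "\<dots> = ?I \<eta> (dir_deriv \<nu> p) + ?I (dir_deriv \<nu> \<eta>) p"
          by (intro Bochner_Integration.integral_add wint c L2_cont cp)
        also have "?I (dir_deriv \<nu> \<eta>) p = ?I (dir_deriv \<nu> \<eta>) v"
        proof (rule integral_cong_AE)
          show "(\<lambda>x. indicator D x * dir_deriv \<nu> \<eta> x * p x) \<in> borel_measurable ?M"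
            using wint[OF c(2) L2_cont[OF cp(1)]] by (rule borel_measurable_integrable)
          show "(\<lambda>x. indicator D x * dir_deriv \<nu> \<eta> x * v x) \<in> borel_measurable ?M"
            using wint[OF c(2) L2_v] by (rule borel_measurable_integrable)
          show "AE x in ?M. indicator D x * dir_deriv \<nu> \<eta> x * p x = indicator D x * dir_deriv \<nu> \<eta> x * v x"
            using vp by eventually_elim (auto simp: indicator_def)
        qed
        finally show ?thesis .
      qed
      have A: "?A m = ?I \<eta> (dir_deriv \<nu> (\<phi> m)) - ?I \<eta> (\<lambda>x. g x \<bullet> \<nu>)"
        unfolding right_diff_distrib by (intro Bochner_Integration.integral_diff wint gint c i\<phi>)
      have B: "?B m = ?I (dir_deriv \<nu> \<eta>) (\<phi> m) - ?I (dir_deriv \<nu> \<eta>) v"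
        unfolding right_diff_distrib by (intro Bochner_Integration.integral_diff wint c i\<phi> L2_v)
      have Re: "R \<eta> = ?I \<eta> (\<lambda>x. g x \<bullet> \<nu>) - ?I \<eta> (dir_deriv \<nu> p)"
        unfolding R_def right_diff_distrib by (intro Bochner_Integration.integral_diff wint gint c L2_cont cp)
      show ?thesis unfolding lhs pp A B Re by simp
    qed
    then show ?thesis using tendsto_add[OF AB tendsto_const] by simp
  qed
  \<comment> \<open>For polynomials vanishing on \<open>F\<close> as well, both sides of the previous limit are free of boundary terms.\<close>
  have R0: "R \<eta> = 0" if \<eta>: "rpf \<eta>" "\<And>G x. G facet_of K \<Longrightarrow> x \<in> G \<Longrightarrow> \<eta> x = 0" for \<eta>
  proof -
    have "face_integral F (\<lambda>x. f x * \<eta> x) = 0" for f by (rule face_integral_zero) (use \<eta>(2) F in auto)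
    then have "(\<lambda>m::nat. 0::real) \<longlonglongrightarrow> R \<eta>" using key[of \<eta>] \<eta> by simp
    then show ?thesis using LIMSEQ_unique tendsto_const by metis
  qed
  obtain a where a: "a \<in> F" using F by (auto simp: facet_of_def)
  obtain H where H: "H > 0" "\<And>x. x \<in> K \<Longrightarrow> \<nu> \<bullet> (a - x) \<le> H"
  proof -
    obtain r where r: "\<And>x. x \<in> K \<Longrightarrow> norm x \<le> r" using compact_imp_bounded[OF cK(1)] bounded_iff by blast
    have "\<nu> \<bullet> (a - x) \<le> \<bar>r\<bar> + norm a + 1" if "x \<in> K" for x
    proof -
      have "\<nu> \<bullet> (a - x) \<le> norm \<nu> * norm (a - x)" by (rule norm_cauchy_schwarz)
      also have "\<dots> \<le> norm a + norm x" using n norm_triangle_ineq4[of a x] by simp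
      finally show ?thesis using r[OF that] by linarith
    qed
    then show ?thesis by (intro that[of "\<bar>r\<bar> + norm a + 1"]) (auto simp: add_nonneg_pos)
  qed
  define l where "l x = (\<nu> \<bullet> a - \<nu> \<bullet> x) / H" for x
  have lpoly: "rpf l"
    unfolding l_def by (intro real_polynomial_function_divide real_polynomial_function_diff
        real_polynomial_function.intros(1,2) bounded_linear_inner_right)
  have lF: "l x = 0" if "x \<in> F" for x
    using outer_normal_orthogonal[OF pK F a that] by (simp add: l_def \<nu>_def inner_diff_right)
  have l01: "0 \<le> l x \<and> l x \<le> 1" if "x \<in> K" for x
    using outer_normal_le[OF pK F a that] H that by (auto simp: l_def \<nu>_def inner_diff_right pos_divide_le_eq)
  have lpos: "0 < l x" if xD: "x \<in> D" for x
  proof -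
    obtain r where r: "r > 0" "cball x r \<subseteq> K" using xD unfolding D_def mem_interior_cball by blast
    have "x + r *\<^sub>R \<nu> \<in> cball x r" using n r(1) by (simp add: dist_norm)
    then have "x + r *\<^sub>R \<nu> \<in> K" using r(2) by blast
    then have "\<nu> \<bullet> (x + r *\<^sub>R \<nu> - a) \<le> 0" unfolding \<nu>_def by (rule outer_normal_le[OF pK F a])
    moreover have "\<nu> \<bullet> \<nu> = 1" using n by (simp add: norm_eq_1)
    ultimately show ?thesis using r(1) H(1) by (simp add: l_def inner_simps)
  qed
  define \<eta> where "\<eta> j x = \<psi> x * (1 - (1 - l x) ^ Suc j)" for j x
  have "R (\<eta> j) = 0" for j
  proof (rule R0)
    show "rpf (\<eta> j)" unfolding \<eta>_def
      by (intro real_polynomial_function.intros(2,4) real_polynomial_function_diff real_polynomial_function_power \<psi> lpoly)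
    show "\<eta> j x = 0" if "G facet_of K" "x \<in> G" for G x
      using \<psi>(2)[OF that(1) _ that(2)] lF[of x] that(2) by (cases "G = F") (auto simp: \<eta>_def)
  qed
  moreover have "(\<lambda>j. R (\<eta> j)) \<longlonglongrightarrow> R \<psi>"
    unfolding R_def
  proof (rule integral_dominated_convergence[where w="\<lambda>x. \<bar>indicator D x * \<psi> x * (g x \<bullet> \<nu>)\<bar> + \<bar>indicator D x * \<psi> x * dir_deriv \<nu> p x\<bar>"])
    have c\<psi>: "continuous_on UNIV \<psi>" by (rule rpf_continuous_on[OF \<psi>(1)])
    have c\<eta>: "continuous_on UNIV (\<eta> j)" for j unfolding \<eta>_def
      by (intro continuous_intros c\<psi> rpf_continuous_on[OF lpoly])
    have i: "integrable ?M (\<lambda>x. indicator D x * f x * (g x \<bullet> \<nu> - dir_deriv \<nu> p x))" if "continuous_on UNIV f" for f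
      unfolding right_diff_distrib by (intro Bochner_Integration.integrable_diff gint wint that L2_cont cp)
    show "(\<lambda>x. indicator D x * \<psi> x * (g x \<bullet> \<nu> - dir_deriv \<nu> p x)) \<in> borel_measurable ?M"
      by (rule borel_measurable_integrable[OF i[OF c\<psi>]])
    show "(\<lambda>x. indicator D x * \<eta> j x * (g x \<bullet> \<nu> - dir_deriv \<nu> p x)) \<in> borel_measurable ?M" for j
      by (rule borel_measurable_integrable[OF i[OF c\<eta>]])
    show "integrable ?M (\<lambda>x. \<bar>indicator D x * \<psi> x * (g x \<bullet> \<nu>)\<bar> + \<bar>indicator D x * \<psi> x * dir_deriv \<nu> p x\<bar>)"
      by (intro Bochner_Integration.integrable_add integrable_abs gint wint c\<psi> L2_cont cp)
    have bd: "\<bar>indicator D x * \<eta> j x\<bar> \<le> \<bar>indicator D x * \<psi> x\<bar>" for j x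
    proof (cases "x \<in> D")
      case True
      then have "0 \<le> (1 - l x) ^ Suc j" "(1 - l x) ^ Suc j \<le> 1"
        using l01[of x] DK by (auto intro!: zero_le_power power_le_one simp del: power_Suc)
      then have "\<bar>1 - (1 - l x) ^ Suc j\<bar> \<le> 1" by (simp del: power_Suc)
      then have "\<bar>\<psi> x\<bar> * \<bar>1 - (1 - l x) ^ Suc j\<bar> \<le> \<bar>\<psi> x\<bar> * 1" by (rule mult_left_mono) simp
      then show ?thesis using True by (simp add: \<eta>_def abs_mult del: power_Suc)
    qed simp
    show "AE x in ?M. norm (indicator D x * \<eta> j x * (g x \<bullet> \<nu> - dir_deriv \<nu> p x)) \<le>
        \<bar>indicator D x * \<psi> x * (g x \<bullet> \<nu>)\<bar> + \<bar>indicator D x * \<psi> x * dir_deriv \<nu> p x\<bar>" for j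
    proof (rule AE_I2)
      fix x
      have "norm (indicator D x * \<eta> j x * (g x \<bullet> \<nu> - dir_deriv \<nu> p x)) \<le>
         \<bar>indicator D x * \<psi> x\<bar> * \<bar>g x \<bullet> \<nu> - dir_deriv \<nu> p x\<bar>"
        unfolding real_norm_def abs_mult[of "indicator D x * \<eta> j x"] by (rule mult_right_mono[OF bd]) simp
      also have "\<dots> \<le> \<bar>indicator D x * \<psi> x\<bar> * (\<bar>g x \<bullet> \<nu>\<bar> + \<bar>dir_deriv \<nu> p x\<bar>)"
        by (rule mult_left_mono) auto
      finally show "norm (indicator D x * \<eta> j x * (g x \<bullet> \<nu> - dir_deriv \<nu> p x)) \<le>
        \<bar>indicator D x * \<psi> x * (g x \<bullet> \<nu>)\<bar> + \<bar>indicator D x * \<psi> x * dir_deriv \<nu> p x\<bar>"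
        unfolding abs_mult[of "indicator D x * \<psi> x"] distrib_left .
    qed
    show "AE x in ?M. (\<lambda>j. indicator D x * \<eta> j x * (g x \<bullet> \<nu> - dir_deriv \<nu> p x)) \<longlonglongrightarrow>
        indicator D x * \<psi> x * (g x \<bullet> \<nu> - dir_deriv \<nu> p x)"
    proof (rule AE_I2)
      fix x
      show "(\<lambda>j. indicator D x * \<eta> j x * (g x \<bullet> \<nu> - dir_deriv \<nu> p x)) \<longlonglongrightarrow>
        indicator D x * \<psi> x * (g x \<bullet> \<nu> - dir_deriv \<nu> p x)"
      proof (cases "x \<in> D")
        case True
        then have "norm (1 - l x) < 1" using lpos[of x] l01[of x] DK by auto
        then have "(\<lambda>j. (1 - l x) ^ Suc j) \<longlonglongrightarrow> 0" by (intro LIMSEQ_Suc LIMSEQ_power_zero)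
        then have "(\<lambda>j. \<psi> x * (1 - (1 - l x) ^ Suc j)) \<longlonglongrightarrow> \<psi> x * (1 - 0)"
          by (intro tendsto_mult tendsto_diff tendsto_const)
        then have "(\<lambda>j. \<eta> j x) \<longlonglongrightarrow> \<psi> x" by (simp add: \<eta>_def del: power_Suc)
        then show ?thesis by (intro tendsto_mult tendsto_const)
      qed simp
    qed
  qed
  ultimately have "(\<lambda>j::nat. 0::real) \<longlonglongrightarrow> R \<psi>" by simp
  then have "R \<psi> = 0" using LIMSEQ_unique tendsto_const by metis
  then show ?thesis using key[OF \<psi>] by (simp add: p_def)
qed

text \<open>
  Test functions are zero on the boundary of \<open>\<Omega>\<close>, hence so are the limits of their traces;
  test these against the bubble times the piece itself.
\<close>

lemma boundary_facet_piece_zero: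
  fixes \<Omega> :: "(real^'n) set"
  assumes \<Omega>: "bounded \<Omega>" "open \<Omega>" "convex \<Omega>" and m: "conforming_mesh \<Omega> T" and v: "v \<in> Vh \<Omega> T k"
    and K: "K \<in> T" and F: "F facet_of K" and bd: "F \<subseteq> frontier \<Omega>" and x: "x \<in> F"
  shows "piece v K x = 0"
proof -
  have h: "H10 \<Omega> v" using v by (simp add: Vh_def)
  obtain \<phi> g where \<phi>: "\<And>m::nat. test_function \<Omega> (\<phi> m)" "\<And>i. L2_on \<Omega> (\<lambda>x. g x $ i)"
    "weak_H1_limit \<Omega> \<phi> v g"
    by (rule H10_approximation[OF \<Omega>(1,2) h]) blast
  obtain b where b: "rpf b" "\<And>x. x \<in> K \<Longrightarrow> 0 \<le> b x" "\<And>x. x \<in> rel_interior F \<Longrightarrow> 0 < b x"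
    "\<And>G x. G facet_of K \<Longrightarrow> G \<noteq> F \<Longrightarrow> x \<in> G \<Longrightarrow> b x = 0"
    by (rule facet_bubble[OF mesh_polytope[OF m K] mesh_aff_dim[OF m K] F]) blast
  let ?p = "piece v K"
  have p: "rpf ?p" by (rule Vh_piece[OF v m K])
  have "(\<lambda>m. face_integral F (\<lambda>x. \<phi> m x * (b x * ?p x))) \<longlonglongrightarrow> face_integral F (\<lambda>x. ?p x * (b x * ?p x))"
    by (rule facet_trace_tendsto[OF \<Omega> m v K F \<phi>]) (use b p in \<open>auto intro: real_polynomial_function.intros(4)\<close>)
  moreover have "face_integral F (\<lambda>x. \<phi> m x * (b x * ?p x)) = 0" for m
  proof (rule face_integral_zero)
    fix x assume "x \<in> F"
    then have "x \<notin> \<Omega>" using bd \<Omega>(2) by (auto simp: frontier_def interior_open)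
    then have "\<phi> m x = 0" using \<phi>(1)[of m] unfolding test_function_def by blast
    then show "\<phi> m x * (b x * ?p x) = 0" by simp
  qed
  ultimately have "(\<lambda>m::nat. 0::real) \<longlonglongrightarrow> face_integral F (\<lambda>x. ?p x * (b x * ?p x))" by simp
  then have "face_integral F (\<lambda>x. ?p x * (b x * ?p x)) = 0" using LIMSEQ_unique tendsto_const by metis
  then have z: "face_integral F (\<lambda>x. b x * (?p x)\<^sup>2) = 0" by (simp add: power2_eq_square mult_ac)
  have FK: "F \<subseteq> K" by (rule facet_of_imp_subset[OF F])
  show ?thesis
  proof (rule face_integral_weighted_square_zero[OF _ _ _ _ _ b(3) _ z x])
    show "compact F" by (rule compact_facet[OF mesh_compact[OF m K] F mesh_convex[OF m K]])
    show "convex F" using face_of_imp_convex[OF facet_of_imp_face_of[OF F]] mesh_convex[OF m K] by blast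
    show "F \<noteq> {}" using x by blast
    show "continuous_on UNIV b" "continuous_on UNIV ?p" using b(1) p rpf_continuous_on by auto
    show "\<And>x. x \<in> F \<Longrightarrow> 0 \<le> b x" using b(2) FK by blast
  qed
qed

text \<open>
  The limit of the traces of the test functions can be computed from either side. The product
  of the bubbles of both elements is an admissible factor of the test polynomial on both
  sides; the other factor is the difference of the pieces.
\<close>

lemma interior_facet_pieces_eq:
  fixes \<Omega> :: "(real^'n) set"
  assumes \<Omega>: "bounded \<Omega>" "open \<Omega>" "convex \<Omega>" and m: "conforming_mesh \<Omega> T" and v: "v \<in> Vh \<Omega> T k"
    and K: "K \<in> T" "L \<in> T" and F: "F facet_of K" "F facet_of L" and x: "x \<in> F"
  shows "piece v K x = piece v L x"
proof -
  have h: "H10 \<Omega> v" using v by (simp add: Vh_def)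
  obtain \<phi> g where \<phi>: "\<And>m::nat. test_function \<Omega> (\<phi> m)" "\<And>i. L2_on \<Omega> (\<lambda>x. g x $ i)"
    "weak_H1_limit \<Omega> \<phi> v g"
    by (rule H10_approximation[OF \<Omega>(1,2) h]) blast
  obtain b where b: "rpf b" "\<And>x. x \<in> K \<Longrightarrow> 0 \<le> b x" "\<And>x. x \<in> rel_interior F \<Longrightarrow> 0 < b x"
    "\<And>G x. G facet_of K \<Longrightarrow> G \<noteq> F \<Longrightarrow> x \<in> G \<Longrightarrow> b x = 0"
    by (rule facet_bubble[OF mesh_polytope[OF m K(1)] mesh_aff_dim[OF m K(1)] F(1)]) blast
  obtain c where c: "rpf c" "\<And>x. x \<in> L \<Longrightarrow> 0 \<le> c x" "\<And>x. x \<in> rel_interior F \<Longrightarrow> 0 < c x"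
    "\<And>G x. G facet_of L \<Longrightarrow> G \<noteq> F \<Longrightarrow> x \<in> G \<Longrightarrow> c x = 0"
    by (rule facet_bubble[OF mesh_polytope[OF m K(2)] mesh_aff_dim[OF m K(2)] F(2)]) blast
  let ?p = "piece v K" and ?q = "piece v L"
  have p: "rpf ?p" "rpf ?q" using Vh_piece[OF v m] K by auto
  define \<psi> where "\<psi> x = (b x * c x) * (?p x - ?q x)" for x
  have \<psi>: "rpf \<psi>" unfolding \<psi>_def
    by (intro real_polynomial_function.intros(4) real_polynomial_function_diff p b(1) c(1))
  have FK: "F \<subseteq> K" "F \<subseteq> L" using facet_of_imp_subset F by auto
  have cF: "compact F" by (rule compact_facet[OF mesh_compact[OF m K(1)] F(1) mesh_convex[OF m K(1)]])
  have "(\<lambda>m. face_integral F (\<lambda>x. \<phi> m x * \<psi> x)) \<longlonglongrightarrow> face_integral F (\<lambda>x. ?p x * \<psi> x)"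
    by (rule facet_trace_tendsto[OF \<Omega> m v K(1) F(1) \<phi> \<psi>]) (use b(4) in \<open>auto simp: \<psi>_def\<close>)
  moreover have "(\<lambda>m. face_integral F (\<lambda>x. \<phi> m x * \<psi> x)) \<longlonglongrightarrow> face_integral F (\<lambda>x. ?q x * \<psi> x)"
    by (rule facet_trace_tendsto[OF \<Omega> m v K(2) F(2) \<phi> \<psi>]) (use c(4) in \<open>auto simp: \<psi>_def\<close>)
  ultimately have "face_integral F (\<lambda>x. ?p x * \<psi> x) = face_integral F (\<lambda>x. ?q x * \<psi> x)"
    by (rule LIMSEQ_unique)
  then have "face_integral F (\<lambda>x. ?p x * \<psi> x - ?q x * \<psi> x) = 0"
    using rpf_continuous_on p \<psi> by (subst face_integral_diff[OF cF]) (auto intro!: continuous_on_mult)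
  moreover have "(\<lambda>x. ?p x * \<psi> x - ?q x * \<psi> x) = (\<lambda>x. (b x * c x) * (?p x - ?q x)\<^sup>2)"
    by (auto simp: \<psi>_def power2_eq_square algebra_simps)
  ultimately have z: "face_integral F (\<lambda>x. (b x * c x) * (?p x - ?q x)\<^sup>2) = 0" by simp
  have "?p x - ?q x = 0"
  proof (rule face_integral_weighted_square_zero[OF cF _ _ _ _ _ _ z x])
    show "convex F" using face_of_imp_convex[OF facet_of_imp_face_of[OF F(1)]] mesh_convex[OF m K(1)] by blast
    show "F \<noteq> {}" using x by blast
    show "continuous_on UNIV (\<lambda>x. b x * c x)" "continuous_on UNIV (\<lambda>x. ?p x - ?q x)"
      using b(1) c(1) p rpf_continuous_on by (auto intro!: continuous_on_mult continuous_on_diff)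
    show "\<And>x. x \<in> F \<Longrightarrow> 0 \<le> b x * c x" using b(2) c(2) FK by (simp add: subset_iff)
    show "\<And>x. x \<in> rel_interior F \<Longrightarrow> 0 < b x * c x" using b(3) c(3) by simp
  qed
  then show ?thesis by simp
qed

section \<open>The discrete Miranda-Talenti identity\<close>

lemma orthonormal_Parseval:
  assumes "orthonormal C" "span C = UNIV"
  shows "(\<Sum>c\<in>C. (a \<bullet> c) * (b \<bullet> c)) = a \<bullet> b"
proof -
  have "a \<bullet> b = a \<bullet> (\<Sum>c\<in>C. (b \<bullet> c) *\<^sub>R c)"
    using orthonormal_expansion[OF assms(1), of b] assms(2) by simp
  then show ?thesis by (simp add: inner_sum_right mult.commute)
qed

lemma laplacian_orthonormal:
  fixes p :: "real^'n \<Rightarrow> real"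
  assumes p: "rpf p" and C: "orthonormal C" "span C = UNIV"
  shows "laplacian p x = (\<Sum>c\<in>C. dir_deriv c (dir_deriv c p) x)"
proof -
  have d: "dir_deriv c (dir_deriv c p) x = (\<Sum>i\<in>UNIV. \<Sum>j\<in>UNIV. c $ i * c $ j * partial j (partial i p) x)" for c
  proof -
    have "dir_deriv c p = (\<lambda>x. \<Sum>i\<in>UNIV. c $ i * partial i p x)"
      by (rule ext) (rule dir_deriv_eq_partials[OF rpf_differentiable[OF p]])
    have "dir_deriv c (dir_deriv c p) x = (\<Sum>i\<in>UNIV. c $ i * partial i (dir_deriv c p) x)"
      by (rule dir_deriv_eq_partials) (intro rpf_differentiable rpf_dir_deriv p)
    also have "\<dots> = (\<Sum>i\<in>UNIV. c $ i * dir_deriv c (partial i p) x)"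
      unfolding partial_def by (simp add: dir_deriv_commute[OF p])
    also have "\<dots> = (\<Sum>i\<in>UNIV. c $ i * (\<Sum>j\<in>UNIV. c $ j * partial j (partial i p) x))"
      by (subst dir_deriv_eq_partials) (auto intro: rpf_differentiable rpf_partial p)
    finally show ?thesis by (simp add: sum_distrib_left mult.assoc)
  qed
  have "(\<Sum>c\<in>C. dir_deriv c (dir_deriv c p) x) =
      (\<Sum>i\<in>UNIV. \<Sum>j\<in>UNIV. (\<Sum>c\<in>C. c $ i * c $ j) * partial j (partial i p) x)"
    unfolding d sum_distrib_right by (subst sum.swap, intro sum.cong refl, rule sum.swap)
  also have "\<dots> = (\<Sum>i\<in>UNIV. \<Sum>j\<in>UNIV. if i = j then partial j (partial i p) x else 0)"
  proof -
    have "(\<Sum>c\<in>C. c $ i * c $ j) = axis j 1 $ i" for i j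
      using orthonormal_Parseval[OF C, of "axis i 1" "axis j 1"] by (simp add: inner_axis')
    then have "(\<Sum>c\<in>C. c $ i * c $ j) = (if i = j then 1 else 0)" for i j
      by (simp add: axis_def)
    then show ?thesis by (intro sum.cong refl) simp
  qed
  finally show ?thesis by (simp add: laplacian_def)
qed

lemma grad_inner_orthonormal:
  fixes p :: "real^'n \<Rightarrow> real"
  assumes "p differentiable at x" "q differentiable at x" and C: "orthonormal C" "span C = UNIV"
  shows "(\<Sum>i\<in>UNIV. partial i p x * partial i q x) = (\<Sum>c\<in>C. dir_deriv c p x * dir_deriv c q x)"
proof -
  have "(\<Sum>i\<in>UNIV. partial i p x * partial i q x) = grad p x \<bullet> grad q x"
    by (simp add: grad_def inner_vec_def)
  then show ?thesis
    using orthonormal_Parseval[OF C, of "grad p x" "grad q x"] assms(1,2) by (simp add: grad_inner_dir_deriv)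
qed

text \<open>
  The flux of the field \<open>\<Delta>p \<nabla>p - D\<^sup>2p \<nabla>p\<close> through \<open>F\<close> in the direction of a unit normal
  \<open>\<nu>\<close>. In a tangent frame plus normal the two terms with \<open>\<partial>\<^sub>\<nu>\<partial>\<^sub>\<nu>p\<close> cancel, and the integrand
  takes this form.
\<close>

definition facet_flux :: "(real^'n \<Rightarrow> real) \<Rightarrow> (real^'n) set \<Rightarrow> real^'n \<Rightarrow> real" where
  "facet_flux p F \<nu> = face_integral F (\<lambda>x. tangential_laplacian F p x * dir_deriv \<nu> p x -
     (\<Sum>t\<in>tangent_frame F. dir_deriv t p x * dir_deriv t (dir_deriv \<nu> p) x))"

lemma rpf_laplacian: "rpf p \<Longrightarrow> rpf (laplacian p)"
  unfolding laplacian_def[abs_def] by (intro real_polynomial_function_sum finite rpf_partial)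

lemma rpf_tangential_laplacian:
  "rpf p \<Longrightarrow> rpf (tangential_laplacian F p)"
  unfolding tangential_laplacian_def[abs_def]
  by (intro real_polynomial_function_sum orthonormal_finite[OF orthonormal_tangent_frame] rpf_dir_deriv)

lemma norm_hess_square: "(norm (hess p x))\<^sup>2 = (\<Sum>i\<in>UNIV. \<Sum>j\<in>UNIV. (partial i (partial j p) x)\<^sup>2)"
  unfolding power2_norm_eq_inner by (simp add: inner_vec_def hess_def power2_eq_square)

text \<open>
  The integrand is the divergence of \<open>\<Delta>p \<nabla>p - D\<^sup>2p \<nabla>p\<close>; below, \<open>U i j\<close> and \<open>V i j\<close> are the
  summands of the components of its two parts. The third derivatives cancel by symmetry.
\<close>

lemma simplex_Miranda_Talenti:
  fixes p :: "real^'n \<Rightarrow> real"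
  assumes K: "int CARD('n) simplex K" and p: "rpf p"
  shows "integral\<^sup>L lborel (\<lambda>x. indicator K x * ((laplacian p x)\<^sup>2 - (norm (hess p x))\<^sup>2)) =
    (\<Sum>F | F facet_of K. facet_flux p F (outer_normal K F))"
proof -
  have pK: "polyhedron K" "polytope K" and aK: "aff_dim K = int CARD('n)"
    using simplex_imp_polyhedron[OF K] simplex_imp_polytope[OF K] aff_dim_simplex[OF K] by auto
  have cK: "compact K" "convex K" using polytope_imp_compact[OF pK(2)] polytope_imp_convex[OF pK(2)] by auto
  note rp = rpf_partial[OF p] rpf_partial[OF rpf_partial[OF p]]
  define U where "U i j x = partial i p x * partial j (partial j p) x" for i j x
  define V where "V i j x = partial i p x * partial i (partial j p) x" for i j x
  have rU: "rpf (U i j)" and rV: "rpf (V i j)" for i j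
    unfolding U_def V_def by (intro real_polynomial_function.intros(4) rp)+
  have cm: "partial j (partial i q) = partial i (partial j q)" if "rpf q" for i j q
    unfolding partial_def by (rule dir_deriv_commute[OF that])
  have div: "(laplacian p x)\<^sup>2 - (norm (hess p x))\<^sup>2 =
      (\<Sum>i\<in>UNIV. \<Sum>j\<in>UNIV. dir_deriv (axis i 1) (U i j) x - dir_deriv (axis j 1) (V i j) x)" for x
  proof -
    have dU: "dir_deriv (axis i 1) (U i j) x = partial i p x * partial i (partial j (partial j p)) x
        + partial i (partial i p) x * partial j (partial j p) x" for i j
      unfolding U_def by (subst dir_deriv_mult[OF rpf_differentiable[OF rp(1)] rpf_differentiable[OF rp(2)]]) (simp add: partial_def)
    have dV: "dir_deriv (axis j 1) (V i j) x = partial i p x * partial j (partial i (partial j p)) x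
        + partial j (partial i p) x * partial i (partial j p) x" for i j
      unfolding V_def by (subst dir_deriv_mult[OF rpf_differentiable[OF rp(1)] rpf_differentiable[OF rp(2)]]) (simp add: partial_def)
    have "dir_deriv (axis i 1) (U i j) x - dir_deriv (axis j 1) (V i j) x =
        partial i (partial i p) x * partial j (partial j p) x - (partial i (partial j p) x)\<^sup>2" for i j
      unfolding dU dV cm[OF rp(1), of j i j] cm[OF p, of j i] by (simp add: power2_eq_square)
    then have "(\<Sum>i\<in>UNIV. \<Sum>j\<in>UNIV. dir_deriv (axis i 1) (U i j) x - dir_deriv (axis j 1) (V i j) x) =
        (\<Sum>i\<in>UNIV. \<Sum>j\<in>UNIV. partial i (partial i p) x * partial j (partial j p) x) - (norm (hess p x))\<^sup>2"
      by (simp add: norm_hess_square sum_subtractf)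
    then show ?thesis by (simp add: laplacian_def power2_eq_square sum_product)
  qed
  have int: "integrable lborel (\<lambda>x. indicator K x * dir_deriv e q x)" if "rpf q" for e q
    using borel_integrable_compact[OF cK(1) rpf_continuous_on[OF rpf_dir_deriv[OF that]]] by simp
  have "integral\<^sup>L lborel (\<lambda>x. indicator K x * ((laplacian p x)\<^sup>2 - (norm (hess p x))\<^sup>2)) =
      (\<Sum>i\<in>UNIV. \<Sum>j\<in>UNIV. integral\<^sup>L lborel (\<lambda>x. indicator K x * dir_deriv (axis i 1) (U i j) x)
         - integral\<^sup>L lborel (\<lambda>x. indicator K x * dir_deriv (axis j 1) (V i j) x))"
    unfolding div sum_distrib_left right_diff_distrib
    by (simp add: Bochner_Integration.integral_sum Bochner_Integration.integral_diff int rU rV)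
  also have "\<dots> = (\<Sum>i\<in>UNIV. \<Sum>j\<in>UNIV. (\<Sum>F | F facet_of K. (outer_normal K F $ i) * face_integral F (U i j))
         - (\<Sum>F | F facet_of K. (outer_normal K F $ j) * face_integral F (V i j)))"
    by (simp add: simplex_divergence[OF K rpf_C1_fun[OF rU]] simplex_divergence[OF K rpf_C1_fun[OF rV]] inner_axis)
  also have "\<dots> = (\<Sum>F | F facet_of K. \<Sum>i\<in>UNIV. \<Sum>j\<in>UNIV.
      outer_normal K F $ i * face_integral F (U i j) - outer_normal K F $ j * face_integral F (V i j))"
    unfolding sum_subtractf[symmetric] by (subst (2) sum.swap, subst sum.swap) simp
  also have "\<dots> = (\<Sum>F | F facet_of K. facet_flux p F (outer_normal K F))"
  proof (rule sum.cong[OF refl])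
    fix F assume "F \<in> {F. F facet_of K}"
    then have F: "F facet_of K" by simp
    define \<nu> where "\<nu> = outer_normal K F"
    note fr = facet_frame[OF pK(1) aK F, folded \<nu>_def]
    let ?B = "tangent_frame F"
    have finB: "finite ?B" by (rule orthonormal_finite[OF orthonormal_tangent_frame])
    have cF: "compact F" by (rule compact_facet[OF cK(1) F cK(2)])
    have cont: "continuous_on UNIV q" if "rpf q" for q by (rule rpf_continuous_on[OF that])
    have "(\<Sum>i\<in>UNIV. \<Sum>j\<in>UNIV. \<nu> $ i * face_integral F (U i j) - \<nu> $ j * face_integral F (V i j)) =
       face_integral F (\<lambda>x. \<Sum>i\<in>UNIV. \<Sum>j\<in>UNIV. \<nu> $ i * U i j x - \<nu> $ j * V i j x)"
    proof -
      have c1: "continuous_on UNIV (\<lambda>x. \<nu> $ i * U i j x)" "continuous_on UNIV (\<lambda>x. \<nu> $ j * V i j x)" for i j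
        by (intro continuous_intros cont rU rV)+
      have c2: "continuous_on UNIV (\<lambda>x. \<nu> $ i * U i j x - \<nu> $ j * V i j x)" for i j
        by (intro continuous_on_diff c1)
      have c3: "continuous_on UNIV (\<lambda>x. \<Sum>j\<in>UNIV. \<nu> $ i * U i j x - \<nu> $ j * V i j x)" for i
        by (intro continuous_on_sum c2)
      show ?thesis
        by (simp only: face_integral_sum[OF cF c3] face_integral_sum[OF cF c2]
            face_integral_diff[OF cF c1] face_integral_cmult)
    qed
    also have "\<dots> = facet_flux p F \<nu>"
      unfolding facet_flux_def
    proof (rule face_integral_cong)
      fix x
      let ?q = "dir_deriv \<nu> p"
      have rq: "rpf ?q" by (rule rpf_dir_deriv[OF p])
      have "(\<Sum>i\<in>UNIV. \<Sum>j\<in>UNIV. \<nu> $ i * U i j x - \<nu> $ j * V i j x) =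
         (\<Sum>i\<in>UNIV. \<nu> $ i * partial i p x) * laplacian p x -
         (\<Sum>i\<in>UNIV. partial i p x * (\<Sum>j\<in>UNIV. \<nu> $ j * partial j (partial i p) x))"
        unfolding sum_subtractf
        by (simp add: U_def V_def laplacian_def sum_product sum_distrib_left mult_ac cm[OF p])
      also have "(\<Sum>i\<in>UNIV. \<nu> $ i * partial i p x) = ?q x"
        by (rule dir_deriv_eq_partials[OF rpf_differentiable[OF p], symmetric])
      also have "(\<Sum>i\<in>UNIV. partial i p x * (\<Sum>j\<in>UNIV. \<nu> $ j * partial j (partial i p) x)) =
          (\<Sum>i\<in>UNIV. partial i p x * partial i ?q x)"
        using dir_deriv_eq_partials[OF rpf_differentiable[OF rp(1)], of \<nu> _ x] dir_deriv_commute[OF p]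
        unfolding partial_def by simp
      also have "\<dots> = (\<Sum>c\<in>insert \<nu> ?B. dir_deriv c p x * dir_deriv c ?q x)"
        by (rule grad_inner_orthonormal[OF rpf_differentiable[OF p] rpf_differentiable[OF rq] fr(2,3)])
      also have "\<dots> = ?q x * dir_deriv \<nu> ?q x + (\<Sum>t\<in>?B. dir_deriv t p x * dir_deriv t ?q x)"
        using fr(1) finB by simp
      also have "laplacian p x = dir_deriv \<nu> ?q x + tangential_laplacian F p x"
        unfolding laplacian_orthonormal[OF p fr(2,3)] tangential_laplacian_def using fr(1) finB by simp
      finally show "(\<Sum>i\<in>UNIV. \<Sum>j\<in>UNIV. \<nu> $ i * U i j x - \<nu> $ j * V i j x) =
        tangential_laplacian F p x * ?q x - (\<Sum>t\<in>?B. dir_deriv t p x * dir_deriv t ?q x)"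
        by (simp add: algebra_simps)
    qed
    finally show "(\<Sum>i\<in>UNIV. \<Sum>j\<in>UNIV. outer_normal K F $ i * face_integral F (U i j) -
        outer_normal K F $ j * face_integral F (V i j)) = facet_flux p F (outer_normal K F)"
      by (simp add: \<nu>_def)
  qed
  finally show ?thesis .
qed

lemma tangential_derivs_zero:
  fixes r :: "real^'n \<Rightarrow> real"
  assumes r: "rpf r" and F: "convex F" "\<And>x. x \<in> F \<Longrightarrow> r x = 0"
    and t: "t \<in> tangent_frame F" and x: "x \<in> F"
  shows "dir_deriv t r x = 0" "dir_deriv t (dir_deriv t r) x = 0"
proof -
  have ts: "t \<in> span (directions F)" using span_base[OF t] span_tangent_frame by blast
  have z0: "\<And>x. x \<in> affine hull F \<Longrightarrow> r x = 0" by (rule rpf_zero_affine_hull[OF r F])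
  have z1: "\<And>x. x \<in> affine hull F \<Longrightarrow> dir_deriv t r x = 0"
    by (rule dir_deriv_zero_affine_hull[OF r z0 ts])
  have z2: "\<And>x. x \<in> affine hull F \<Longrightarrow> dir_deriv t (dir_deriv t r) x = 0"
    by (rule dir_deriv_zero_affine_hull[OF rpf_dir_deriv[OF r] z1 ts])
  show "dir_deriv t r x = 0" "dir_deriv t (dir_deriv t r) x = 0" using z1 z2 hull_inc[OF x] by auto
qed

lemma tangential_derivs_eq:
  fixes p q :: "real^'n \<Rightarrow> real"
  assumes p: "rpf p" "rpf q"
    and F: "convex F" "\<And>x. x \<in> F \<Longrightarrow> p x = q x" and t: "t \<in> tangent_frame F" and x: "x \<in> F"
  shows "dir_deriv t p x = dir_deriv t q x" "dir_deriv t (dir_deriv t p) x = dir_deriv t (dir_deriv t q) x"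
proof -
  let ?r = "\<lambda>x. p x - q x"
  have r: "rpf ?r" by (intro real_polynomial_function_diff p)
  have "dir_deriv t ?r = (\<lambda>x. dir_deriv t p x - dir_deriv t q x)"
    by (rule ext) (rule dir_deriv_diff; intro rpf_differentiable p)
  then have 1: "dir_deriv t (dir_deriv t ?r) x = dir_deriv t (dir_deriv t p) x - dir_deriv t (dir_deriv t q) x"
    and 2: "dir_deriv t ?r x = dir_deriv t p x - dir_deriv t q x"
    by (auto simp: dir_deriv_diff rpf_differentiable rpf_dir_deriv p)
  have "dir_deriv t ?r x = 0" "dir_deriv t (dir_deriv t ?r) x = 0"
    by (rule tangential_derivs_zero[OF r F(1) _ t x]; simp add: F(2))+
  then show "dir_deriv t p x = dir_deriv t q x" "dir_deriv t (dir_deriv t p) x = dir_deriv t (dir_deriv t q) x"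
    unfolding 1 2 by simp_all
qed

lemma facet_flux_zero:
  fixes p :: "real^'n \<Rightarrow> real"
  assumes p: "rpf p" and F: "convex F" "\<And>x. x \<in> F \<Longrightarrow> p x = 0"
  shows "facet_flux p F \<nu> = 0"
  unfolding facet_flux_def
proof (rule face_integral_zero)
  fix x assume x: "x \<in> F"
  have "tangential_laplacian F p x = 0"
    unfolding tangential_laplacian_def
    by (intro sum.neutral ballI) (rule tangential_derivs_zero(2)[OF p F _ x])
  moreover have "(\<Sum>t\<in>tangent_frame F. dir_deriv t p x * dir_deriv t (dir_deriv \<nu> p) x) = 0"
    by (intro sum.neutral ballI) (simp add: tangential_derivs_zero(1)[OF p F _ x])
  ultimately show "tangential_laplacian F p x * dir_deriv \<nu> p x -
     (\<Sum>t\<in>tangent_frame F. dir_deriv t p x * dir_deriv t (dir_deriv \<nu> p) x) = 0" by simp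
qed

text \<open>
  Seen from the two sides of an interior facet the tangential derivatives of the pieces agree,
  so the fluxes add up to the integral of \<open>w \<Delta>\<^sub>Tp - \<nabla>\<^sub>Tp \<bullet> \<nabla>\<^sub>Tw\<close>, where \<open>w\<close> is the jump of
  the normal derivative. As \<open>w\<close> vanishes on the relative boundary of \<open>F\<close>, integration by
  parts on \<open>F\<close> turns the second term into the first.
\<close>

lemma facet_flux_pair:
  fixes p q :: "real^'n \<Rightarrow> real"
  assumes p: "rpf p" and q: "rpf q"
    and F: "compact F" "convex F" and eq: "\<And>x. x \<in> F \<Longrightarrow> p x = q x"
    and bd: "\<And>x. x \<in> rel_frontier F \<Longrightarrow> dir_deriv \<nu> p x = dir_deriv \<nu> q x"
  shows "facet_flux p F \<nu> + facet_flux q F (- \<nu>) =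
    2 * face_integral F (\<lambda>x. (dir_deriv \<nu> p x - dir_deriv \<nu> q x) * tangential_laplacian F p x)"
proof -
  let ?B = "tangent_frame F"
  have finB: "finite ?B" by (rule orthonormal_finite[OF orthonormal_tangent_frame])
  define w where "w x = dir_deriv \<nu> p x - dir_deriv \<nu> q x" for x
  have rp: "rpf (dir_deriv \<nu> p)" "rpf (dir_deriv \<nu> q)"
    by (intro rpf_dir_deriv p q)+
  have rw: "rpf w" unfolding w_def by (intro real_polynomial_function_diff rp)
  have dw: "dir_deriv t w x = dir_deriv t (dir_deriv \<nu> p) x - dir_deriv t (dir_deriv \<nu> q) x" for t x
    unfolding w_def by (rule dir_deriv_diff; intro rpf_differentiable rp)
  have neg: "dir_deriv (- \<nu>) q = (\<lambda>x. - dir_deriv \<nu> q x)"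
    by (rule ext) (rule dir_deriv_minus_direction[OF rpf_differentiable[OF q]])
  have dneg: "dir_deriv t (dir_deriv (- \<nu>) q) x = - dir_deriv t (dir_deriv \<nu> q) x" for t x
  proof -
    have "dir_deriv t (dir_deriv (- \<nu>) q) x = dir_deriv t (\<lambda>x. 0 - dir_deriv \<nu> q x) x" by (simp add: neg)
    also have "\<dots> = dir_deriv t (\<lambda>x. 0) x - dir_deriv t (dir_deriv \<nu> q) x"
      by (rule dir_deriv_diff) (auto intro: rpf_differentiable rp)
    finally show ?thesis by (simp add: dir_deriv_const)
  qed
  have flux: "facet_flux p F \<nu> + facet_flux q F (- \<nu>) =
      face_integral F (\<lambda>x. w x * tangential_laplacian F p x - (\<Sum>t\<in>?B. dir_deriv t p x * dir_deriv t w x))"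
  proof -
    have c: "continuous_on UNIV (\<lambda>x. tangential_laplacian F p x * dir_deriv \<nu> p x -
       (\<Sum>t\<in>?B. dir_deriv t p x * dir_deriv t (dir_deriv \<nu> p) x))" if p: "rpf p" for p \<nu>
      by (intro rpf_continuous_on real_polynomial_function_diff real_polynomial_function_sum finB
          real_polynomial_function.intros(4) rpf_tangential_laplacian rpf_dir_deriv p)
    show ?thesis
      unfolding facet_flux_def face_integral_add[OF F(1) c[OF p] c[OF q], symmetric]
    proof (rule face_integral_cong)
      fix x assume x: "x \<in> F"
      have t1: "dir_deriv t p x = dir_deriv t q x" if "t \<in> ?B" for t
        by (rule tangential_derivs_eq(1)[OF p q F(2) eq that x])
      have "dir_deriv t (dir_deriv t p) x = dir_deriv t (dir_deriv t q) x" if "t \<in> ?B" for t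
        by (rule tangential_derivs_eq(2)[OF p q F(2) eq that x])
      then have t2: "tangential_laplacian F q x = tangential_laplacian F p x"
        unfolding tangential_laplacian_def by simp
      have s: "(\<Sum>t\<in>?B. dir_deriv t q x * dir_deriv t (dir_deriv (- \<nu>) q) x) =
          - (\<Sum>t\<in>?B. dir_deriv t p x * dir_deriv t (dir_deriv \<nu> q) x)"
        unfolding sum_negf[symmetric] by (intro sum.cong refl) (simp add: t1 dneg)
      have s2: "(\<Sum>t\<in>?B. dir_deriv t p x * dir_deriv t w x) =
         (\<Sum>t\<in>?B. dir_deriv t p x * dir_deriv t (dir_deriv \<nu> p) x) - (\<Sum>t\<in>?B. dir_deriv t p x * dir_deriv t (dir_deriv \<nu> q) x)"
        by (simp add: dw right_diff_distrib sum_subtractf)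
      show "(tangential_laplacian F p x * dir_deriv \<nu> p x - (\<Sum>t\<in>?B. dir_deriv t p x * dir_deriv t (dir_deriv \<nu> p) x)) +
         (tangential_laplacian F q x * dir_deriv (- \<nu>) q x - (\<Sum>t\<in>?B. dir_deriv t q x * dir_deriv t (dir_deriv (- \<nu>) q) x)) =
         w x * tangential_laplacian F p x - (\<Sum>t\<in>?B. dir_deriv t p x * dir_deriv t w x)"
        unfolding s s2 t2 unfolding neg by (simp add: w_def algebra_simps)
    qed
  qed
  have rdt: "rpf (\<lambda>x. dir_deriv t p x * w x)" for t
    by (intro real_polynomial_function.intros(4) rpf_dir_deriv p rw)
  \<comment> \<open>integration by parts on \<open>F\<close>, where \<open>w\<close> vanishes on the relative boundary\<close>
  have "face_integral F (dir_deriv t (\<lambda>x. dir_deriv t p x * w x)) = 0" if "t \<in> ?B" for t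
    by (rule face_integral_tangential_deriv_zero[OF F rpf_C1_fun[OF rdt] that]) (simp add: w_def bd)
  then have "0 = (\<Sum>t\<in>?B. face_integral F (dir_deriv t (\<lambda>x. dir_deriv t p x * w x)))" by simp
  also have "\<dots> = face_integral F (\<lambda>x. \<Sum>t\<in>?B. dir_deriv t (\<lambda>x. dir_deriv t p x * w x) x)"
    by (rule face_integral_sum[OF F(1), symmetric]) (rule rpf_continuous_on[OF rpf_dir_deriv[OF rdt]])
  also have "\<dots> = face_integral F (\<lambda>x. w x * tangential_laplacian F p x + (\<Sum>t\<in>?B. dir_deriv t p x * dir_deriv t w x))"
  proof (rule face_integral_cong)
    fix x
    have "dir_deriv t (\<lambda>x. dir_deriv t p x * w x) x = dir_deriv t p x * dir_deriv t w x + dir_deriv t (dir_deriv t p) x * w x" for t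
      by (rule dir_deriv_mult; intro rpf_differentiable rpf_dir_deriv p rw)
    then show "(\<Sum>t\<in>?B. dir_deriv t (\<lambda>x. dir_deriv t p x * w x) x) =
        w x * tangential_laplacian F p x + (\<Sum>t\<in>?B. dir_deriv t p x * dir_deriv t w x)"
      by (simp add: sum.distrib tangential_laplacian_def sum_distrib_left mult.commute)
  qed
  finally have IBP: "0 = face_integral F (\<lambda>x. w x * tangential_laplacian F p x + (\<Sum>t\<in>?B. dir_deriv t p x * dir_deriv t w x))" .
  have c1: "continuous_on UNIV (\<lambda>x. w x * tangential_laplacian F p x)"
    by (intro rpf_continuous_on real_polynomial_function.intros(4) rpf_tangential_laplacian rw p)
  have c2: "continuous_on UNIV (\<lambda>x. \<Sum>t\<in>?B. dir_deriv t p x * dir_deriv t w x)"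
    by (intro rpf_continuous_on real_polynomial_function_sum finB real_polynomial_function.intros(4) rpf_dir_deriv rw p)
  show ?thesis
    using IBP unfolding flux face_integral_add[OF F(1) c1 c2] face_integral_diff[OF F(1) c1 c2]
    by (simp add: w_def)
qed

text \<open>
  Sum the identity for one simplex over the mesh and collect the fluxes facet by facet. On a
  boundary facet the piece vanishes and so does its flux; the two fluxes on an interior facet
  combine to the jump term.
\<close>

theorem discrete_Miranda_Talenti:
  fixes \<Omega> :: "(real^'n) set"
  assumes n: "CARD('n) = 2 \<or> CARD('n) = 3"
    and \<Omega>: "bounded \<Omega>" "open \<Omega>" "convex \<Omega>" and m: "conforming_mesh \<Omega> T" and v: "v \<in> Vh \<Omega> T k"
  shows "(\<Sum>K\<in>T. integral\<^sup>L lborel (\<lambda>x. indicator K x *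
        ((laplacian (piece v K) x)\<^sup>2 - (norm (hess (piece v K) x))\<^sup>2))) =
    2 * (\<Sum>F\<in>interior_faces \<Omega> T. face_integral F (\<lambda>x. jump_grad T v F x * face_laplacian T v F x))"
proof -
  let ?p = "piece v"
  let ?N = "\<lambda>K F. facet_flux (?p K) F (outer_normal K F)"
  have finT: "finite T" using m by (auto simp: conforming_mesh_def triangulation_def)
  define \<F> where "\<F> = {F. \<exists>K\<in>T. F facet_of K}"
  have fin: "finite \<F>"
  proof -
    have "\<F> = (\<Union>K\<in>T. {F. F facet_of K})" by (auto simp: \<F>_def)
    then show ?thesis using finT finite_polytope_facets mesh_polytope[OF m] by auto
  qed
  have p: "rpf (?p K)" if "K \<in> T" for K by (rule Vh_piece[OF v m that])
  have cF: "convex F" "compact F" if "K \<in> T" "F facet_of K" for K F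
    using face_of_imp_convex[OF facet_of_imp_face_of[OF that(2)]] mesh_convex[OF m that(1)]
      compact_facet[OF mesh_compact[OF m that(1)] that(2)] by auto
  have "(\<Sum>K\<in>T. integral\<^sup>L lborel (\<lambda>x. indicator K x *
        ((laplacian (?p K) x)\<^sup>2 - (norm (hess (?p K) x))\<^sup>2))) = (\<Sum>K\<in>T. \<Sum>F | F facet_of K. ?N K F)"
    by (intro sum.cong refl simplex_Miranda_Talenti mesh_simplex[OF m] p)
  also have "\<dots> = (\<Sum>K\<in>T. \<Sum>F | F \<in> \<F> \<and> F facet_of K. ?N K F)"
    by (intro sum.cong refl) (auto simp: \<F>_def)
  also have "\<dots> = (\<Sum>F\<in>\<F>. \<Sum>K | K \<in> T \<and> F facet_of K. ?N K F)"
    by (rule sum.swap_restrict[OF finT fin])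
  also have "\<dots> = (\<Sum>F\<in>interior_faces \<Omega> T. \<Sum>K | K \<in> T \<and> F facet_of K. ?N K F)"
  proof (rule sum.mono_neutral_right[OF fin])
    show "interior_faces \<Omega> T \<subseteq> \<F>" by (auto simp: interior_faces_def \<F>_def)
    show "\<forall>F\<in>\<F> - interior_faces \<Omega> T. (\<Sum>K | K \<in> T \<and> F facet_of K. ?N K F) = 0"
    proof (intro ballI sum.neutral)
      fix F K assume F: "F \<in> \<F> - interior_faces \<Omega> T" and "K \<in> {K \<in> T. F facet_of K}"
      then have K: "K \<in> T" "F facet_of K" by auto
      then have bd: "F \<subseteq> frontier \<Omega>" using F by (auto simp: interior_faces_def)
      show "?N K F = 0"
        by (rule facet_flux_zero[OF p[OF K(1)] cF(1)[OF K]])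
          (rule boundary_facet_piece_zero[OF \<Omega> m v K bd])
    qed
  qed
  also have "\<dots> = (\<Sum>F\<in>interior_faces \<Omega> T. 2 * face_integral F (\<lambda>x. jump_grad T v F x * face_laplacian T v F x))"
  proof (rule sum.cong[OF refl])
    fix F assume F: "F \<in> interior_faces \<Omega> T"
    obtain K L where KL: "K \<noteq> L" "{K. K \<in> T \<and> F facet_of K} = {K, L}" "outer_normal L F = - outer_normal K F"
      by (rule interior_face_elements[OF m \<Omega>(2) F])
    then have K: "K \<in> T" "F facet_of K" and L: "L \<in> T" "F facet_of L" by auto
    define \<nu> where "\<nu> = outer_normal K F"
    define M where "M = (SOME K. K \<in> T \<and> F facet_of K)"
    have M: "M \<in> T" "F facet_of M" using someI[of "\<lambda>K. K \<in> T \<and> F facet_of K", OF conjI[OF K]] by (auto simp: M_def)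
    have dd: "grad (?p J) x \<bullet> e = dir_deriv e (?p J) x" if "J \<in> T" for J e x
      by (rule grad_inner_dir_deriv[OF rpf_differentiable[OF p[OF that]]])
    have jump: "jump_grad T v F x = dir_deriv \<nu> (?p K) x - dir_deriv \<nu> (?p L) x" for x
      unfolding jump_grad_def KL(2) using KL(1,3) dd K L
      by (simp add: \<nu>_def dir_deriv_minus_direction rpf_differentiable p)
    have "(\<Sum>K | K \<in> T \<and> F facet_of K. ?N K F) = facet_flux (?p K) F \<nu> + facet_flux (?p L) F (- \<nu>)"
      unfolding KL(2) using KL(1,3) by (simp add: \<nu>_def)
    also have "\<dots> = 2 * face_integral F (\<lambda>x. (dir_deriv \<nu> (?p K) x - dir_deriv \<nu> (?p L) x) * tangential_laplacian F (?p K) x)"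
    proof (rule facet_flux_pair[OF p[OF K(1)] p[OF L(1)] cF(2,1)[OF K]])
      show "\<And>x. x \<in> F \<Longrightarrow> ?p K x = ?p L x"
        by (rule interior_facet_pieces_eq[OF \<Omega> m v K(1) L(1) K(2) L(2)])
      show "dir_deriv \<nu> (?p K) x = dir_deriv \<nu> (?p L) x" if "x \<in> rel_frontier F" for x
        using Vh_grad_eq_on_face_boundary[OF n m v K(1) L(1) K(2) L(2) that] dd K(1) L(1) by metis
    qed
    also have "\<dots> = 2 * face_integral F (\<lambda>x. jump_grad T v F x * face_laplacian T v F x)"
    proof -
      have "face_laplacian T v F x = tangential_laplacian F (?p K) x" if x: "x \<in> F" for x
        unfolding face_laplacian_def M_def[symmetric] tangential_laplacian_def
        by (intro sum.cong refl tangential_derivs_eq(2)[OF p[OF M(1)] p[OF K(1)] cF(1)[OF K] _ _ x]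
            interior_facet_pieces_eq[OF \<Omega> m v M(1) K(1) M(2) K(2)])
      then show ?thesis by (simp add: jump cong: face_integral_cong)
    qed
    finally show "(\<Sum>K | K \<in> T \<and> F facet_of K. ?N K F) =
      2 * face_integral F (\<lambda>x. jump_grad T v F x * face_laplacian T v F x)" .
  qed
  finally show ?thesis by (simp add: sum_distrib_left)
qed

section \<open>The Cordes condition and coercivity\<close>

text \<open>
  Lebesgue measure is complete, so values on null sets do not affect measurability.
\<close>

lemma borel_measurable_lebesgue_on_spike:
  fixes f :: "'a::euclidean_space \<Rightarrow> 'b::euclidean_space"
  assumes f: "f \<in> borel_measurable (lebesgue_on \<Omega>)" and \<Omega>: "\<Omega> \<in> sets lebesgue"
    and K: "K \<in> sets lebesgue" and n: "negligible (K - \<Omega>)"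
  shows "f \<in> borel_measurable (lebesgue_on K)"
proof -
  have "(\<lambda>x. indicator \<Omega> x *\<^sub>R f x) \<in> borel_measurable lebesgue"
    using f \<Omega> by (simp add: borel_measurable_restrict_space_iff)
  then have "(\<lambda>x. indicator K x *\<^sub>R (indicator \<Omega> x *\<^sub>R f x)) \<in> borel_measurable lebesgue"
    by (rule borel_measurable_scaleR[OF borel_measurable_indicator[OF K]])
  moreover have "AE x in lebesgue. indicator K x *\<^sub>R (indicator \<Omega> x *\<^sub>R f x) = indicator K x *\<^sub>R f x"
  proof -
    have "AE x in lebesgue. x \<notin> K - \<Omega>" using n by (intro AE_not_in) (simp add: negligible_iff_null_sets)
    then show ?thesis by eventually_elim (auto simp: indicator_def)
  qed
  ultimately have "(\<lambda>x. indicator K x *\<^sub>R f x) \<in> borel_measurable lebesgue"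
    by (rule borel_measurable_AE)
  then show ?thesis using K by (simp add: borel_measurable_restrict_space_iff)
qed

lemma AE_lebesgue_on_spike:
  assumes ae: "AE x in lebesgue_on \<Omega>. P x" and \<Omega>: "\<Omega> \<in> sets lebesgue"
    and K: "K \<in> sets lebesgue" and n: "negligible (K - \<Omega>)"
  shows "AE x in lebesgue_on K. P x"
proof -
  have "AE x in lebesgue. x \<in> \<Omega> \<longrightarrow> P x" using ae \<Omega> by (simp add: AE_restrict_space_iff)
  moreover have "AE x in lebesgue. x \<notin> K - \<Omega>" using n by (intro AE_not_in) (simp add: negligible_iff_null_sets)
  ultimately have "AE x in lebesgue. x \<in> K \<longrightarrow> P x" by eventually_elim blast
  then show ?thesis using K by (simp add: AE_restrict_space_iff)
qed

lemma inner_mat_1: "(mat 1 :: real^'n^'n) \<bullet> H = trace H"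
  by (simp add: inner_vec_def mat_def trace_def if_distrib[of "\<lambda>x. x * _"] cong: if_cong)

lemma trace_hess: "trace (hess p x) = laplacian p x"
  by (simp add: trace_def hess_def laplacian_def)

lemma trace_pos_of_elliptic:
  fixes M :: "real^'n^'n"
  assumes "\<nu> > 0" "\<And>\<xi>. \<nu> * (norm \<xi>)\<^sup>2 \<le> \<xi> \<bullet> (M *v \<xi>)"
  shows "trace M > 0"
proof -
  have "\<nu> \<le> M $ i $ i" for i
    using assms(2)[of "axis i 1"] by (simp add: matrix_vector_mult_basis inner_axis' column_def)
  then have "0 < M $ i $ i" for i using assms(1) by (meson less_le_trans)
  then show ?thesis unfolding trace_def by (intro sum_pos) auto
qed

text \<open>
  The normalisation \<open>\<gamma> = tr M / |M|\<^sup>2\<close> minimises \<open>|\<gamma> M - I|\<close>; the minimum is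
  \<open>|\<gamma> M - I|\<^sup>2 = n - (tr M)\<^sup>2 / |M|\<^sup>2\<close>, which is at most \<open>1 - \<epsilon>\<close> by the Cordes condition.
  The left-hand side is \<open>|(\<gamma> M - I) : H| |tr H|\<close>.
\<close>

lemma cordes_pointwise:
  fixes M H :: "real^'n^'n"
  assumes tr: "trace M > 0" and \<epsilon>: "0 < \<epsilon>" "\<epsilon> \<le> 1"
    and cordes: "(norm M)\<^sup>2 / (trace M)\<^sup>2 \<le> 1 / (real CARD('n) - 1 + \<epsilon>)"
  shows "\<bar>trace M / (norm M)\<^sup>2 * (M \<bullet> H) * trace H - (trace H)\<^sup>2\<bar> \<le> sqrt (1 - \<epsilon>) * (norm H * \<bar>trace H\<bar>)"
proof -
  define g where "g = trace M / (norm M)\<^sup>2"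
  have "M \<noteq> 0" using tr by (auto simp: trace_def)
  then have nM: "(norm M)\<^sup>2 > 0" by simp
  have n: "real CARD('n) - 1 + \<epsilon> > 0" using \<epsilon>(1) zero_less_card_finite[where 'a='n] by (simp add: Suc_leI add_nonneg_pos)
  have "(norm (g *\<^sub>R M - mat 1))\<^sup>2 = g\<^sup>2 * (norm M)\<^sup>2 - 2 * g * trace M + real CARD('n)"
    unfolding power2_norm_eq_inner
    by (simp add: inner_diff_left inner_diff_right inner_mat_1 trace_I inner_commute[of M "mat 1"]
        power2_eq_square algebra_simps)
  also have "\<dots> = real CARD('n) - (trace M)\<^sup>2 / (norm M)\<^sup>2"
    using nM by (simp add: g_def field_simps power2_eq_square)
  also have "\<dots> \<le> 1 - \<epsilon>"
  proof -
    have "(norm M)\<^sup>2 * (real CARD('n) - 1 + \<epsilon>) \<le> (trace M)\<^sup>2"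
      using cordes n tr by (simp add: divide_simps mult.commute split: if_splits)
    then have "real CARD('n) - 1 + \<epsilon> \<le> (trace M)\<^sup>2 / (norm M)\<^sup>2"
      using nM by (simp add: pos_le_divide_eq mult.commute)
    then show ?thesis by simp
  qed
  finally have dist: "norm (g *\<^sub>R M - mat 1) \<le> sqrt (1 - \<epsilon>)" by (rule real_le_rsqrt)
  have "g * (M \<bullet> H) - trace H = (g *\<^sub>R M - mat 1) \<bullet> H" by (simp add: inner_diff_left inner_mat_1)
  then have "\<bar>g * (M \<bullet> H) - trace H\<bar> \<le> norm (g *\<^sub>R M - mat 1) * norm H"
    using Cauchy_Schwarz_ineq2 by metis
  also have "\<dots> \<le> sqrt (1 - \<epsilon>) * norm H" using dist by (rule mult_right_mono) simp
  finally have "\<bar>g * (M \<bullet> H) - trace H\<bar> * \<bar>trace H\<bar> \<le> sqrt (1 - \<epsilon>) * norm H * \<bar>trace H\<bar>"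
    by (rule mult_right_mono) simp
  moreover have "\<bar>g * (M \<bullet> H) - trace H\<bar> * \<bar>trace H\<bar> = \<bar>g * (M \<bullet> H) * trace H - (trace H)\<^sup>2\<bar>"
    by (simp add: abs_mult[symmetric] power2_eq_square algebra_simps)
  ultimately show ?thesis by (simp add: g_def mult.assoc)
qed

lemma continuous_on_hess: "rpf p \<Longrightarrow> continuous_on S (hess p)"
  unfolding hess_def[abs_def] by (intro continuous_on_vec_lambda rpf_continuous_on rpf_partial)

text \<open>
  Integrate the pointwise bound, after splitting \<open>|D\<^sup>2p| |\<Delta>p|\<close> by Young's inequality. The
  conditions on \<open>A\<close> hold almost everywhere in \<open>\<Omega>\<close> and pass to \<open>K\<close>, which exceeds \<open>\<Omega>\<close> by a
  null set at most.
\<close>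

lemma element_coercivity:
  fixes \<Omega> :: "(real^'n) set"
  assumes A: "A \<in> borel_measurable (lebesgue_on \<Omega>)" "uniformly_elliptic \<Omega> A" "cordes \<Omega> A \<epsilon>"
    and \<epsilon>: "0 < \<epsilon>" "\<epsilon> \<le> 1" and \<Omega>: "\<Omega> \<in> sets lebesgue"
    and K: "compact K" "negligible (K - \<Omega>)" and p: "rpf p"
  defines "s \<equiv> sqrt (1 - \<epsilon>)"
  shows "integral\<^sup>L lborel (\<lambda>x. indicator K x * ((1 - s / 2) * (laplacian p x)\<^sup>2 - s / 2 * (norm (hess p x))\<^sup>2))
    \<le> integral\<^sup>L (lebesgue_on K) (\<lambda>x. cordes_gamma A x * (A x \<bullet> hess p x) * laplacian p x)"
proof -
  let ?M = "lebesgue_on K"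
  let ?f = "\<lambda>x. cordes_gamma A x * (A x \<bullet> hess p x) * laplacian p x"
  let ?l = "\<lambda>x. (1 - s / 2) * (laplacian p x)\<^sup>2 - s / 2 * (norm (hess p x))\<^sup>2"
  let ?b = "\<lambda>x. (laplacian p x)\<^sup>2 + s * (norm (hess p x) * \<bar>laplacian p x\<bar>)"
  have Kl: "K \<in> sets lebesgue" using K(1) by (simp add: lmeasurable_compact fmeasurableD)
  have s0: "0 \<le> s" using \<epsilon> by (simp add: s_def)
  have cl: "continuous_on S (laplacian p)" and ch: "continuous_on S (hess p)" for S
    by (auto intro: rpf_continuous_on rpf_laplacian continuous_on_hess p)
  have c: "continuous_on UNIV ?l" "continuous_on UNIV ?b" by (intro continuous_intros cl ch)+
  obtain \<nu> where \<nu>: "\<nu> > 0" "AE x in lebesgue_on \<Omega>. \<forall>\<xi>. \<nu> * (norm \<xi>)\<^sup>2 \<le> \<xi> \<bullet> (A x *v \<xi>)"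
    using A(2) unfolding uniformly_elliptic_def by (blast intro: AE_mp[OF _ AE_I2])
  have "AE x in lebesgue_on \<Omega>. \<bar>?f x - (laplacian p x)\<^sup>2\<bar> \<le> s * (norm (hess p x) * \<bar>laplacian p x\<bar>)"
    using \<nu>(2) A(3)[unfolded cordes_def]
  proof eventually_elim
    case (elim x)
    have "trace (A x) > 0" by (rule trace_pos_of_elliptic[OF \<nu>(1)]) (use elim(1) in blast)
    from cordes_pointwise[OF this \<epsilon> elim(2), of "hess p x"]
    show ?case by (simp add: s_def cordes_gamma_def trace_hess)
  qed
  then have ae: "AE x in ?M. \<bar>?f x - (laplacian p x)\<^sup>2\<bar> \<le> s * (norm (hess p x) * \<bar>laplacian p x\<bar>)"
    by (rule AE_lebesgue_on_spike[OF _ \<Omega> Kl K(2)])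
  have Am[measurable]: "A \<in> borel_measurable ?M"
    by (rule borel_measurable_lebesgue_on_spike[OF A(1) \<Omega> Kl K(2)])
  have [measurable]: "hess p \<in> borel_measurable ?M" "laplacian p \<in> borel_measurable ?M"
    using continuous_imp_measurable_on_sets_lebesgue[OF ch Kl] continuous_imp_measurable_on_sets_lebesgue[OF cl Kl] by auto
  have [measurable]: "(\<lambda>x. trace (A x)) \<in> borel_measurable ?M"
  proof -
    have "trace (A x) = mat 1 \<bullet> A x" for x by (simp add: inner_mat_1)
    then show ?thesis by simp
  qed
  have fm[measurable]: "?f \<in> borel_measurable ?M"
    unfolding cordes_gamma_def by measurable
  have int: "integrable ?M ?f"
  proof (rule Bochner_Integration.integrable_bound[OF integral_lebesgue_on_continuous(2)[OF K(1) c(2)] fm])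
    show "AE x in ?M. norm (?f x) \<le> norm (?b x)"
      using ae
    proof eventually_elim
      case (elim x)
      have "\<bar>?f x\<bar> \<le> \<bar>?f x - (laplacian p x)\<^sup>2\<bar> + (laplacian p x)\<^sup>2"
        using abs_triangle_ineq[of "?f x - (laplacian p x)\<^sup>2" "(laplacian p x)\<^sup>2"] by simp
      also have "\<dots> \<le> ?b x" using elim by simp
      finally show ?case by simp
    qed
  qed
  have "integral\<^sup>L ?M ?l \<le> integral\<^sup>L ?M ?f"
  proof (rule integral_mono_AE[OF integral_lebesgue_on_continuous(2)[OF K(1) c(1)] int])
    show "AE x in ?M. ?l x \<le> ?f x"
      using ae
    proof eventually_elim
      case (elim x)
      have "0 \<le> (norm (hess p x) - \<bar>laplacian p x\<bar>)\<^sup>2" by simp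
      then have "norm (hess p x) * \<bar>laplacian p x\<bar> \<le> ((norm (hess p x))\<^sup>2 + (laplacian p x)\<^sup>2) / 2"
        by (simp add: power2_diff)
      then have "s * (norm (hess p x) * \<bar>laplacian p x\<bar>) \<le> s * (((norm (hess p x))\<^sup>2 + (laplacian p x)\<^sup>2) / 2)"
        using s0 by (rule mult_left_mono)
      also have "\<dots> = s / 2 * (norm (hess p x))\<^sup>2 + s / 2 * (laplacian p x)\<^sup>2" by (simp add: algebra_simps)
      finally have "(laplacian p x)\<^sup>2 - (s / 2 * (norm (hess p x))\<^sup>2 + s / 2 * (laplacian p x)\<^sup>2) \<le> ?f x"
        using elim by linarith
      then show ?case by (simp add: algebra_simps)
    qed
  qed
  then show ?thesis using integral_lebesgue_on_continuous(1)[OF K(1) c(1)] by simp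
qed

theorem lemma4p1:
  fixes \<Omega> :: "(real^'n) set"
    and T :: "(real^'n) set set"
    and A :: "real^'n \<Rightarrow> real^'n^'n"
    and \<epsilon> \<sigma> :: real
    and k :: nat
  assumes "CARD('n) = 2 \<and> 3 \<le> k \<or> CARD('n) = 3 \<and> 5 \<le> k"
    and "bounded \<Omega>" and "open \<Omega>" and "convex \<Omega>" and "polytope (closure \<Omega>)"
    and "conforming_mesh \<Omega> T" and "shape_regular \<sigma> T"
    and "ess_bounded \<Omega> A" and "uniformly_elliptic \<Omega> A"
    and "0 < \<epsilon>" and "\<epsilon> \<le> 1" and "cordes \<Omega> A \<epsilon>"
  shows "\<forall>v\<in>Vh \<Omega> T k. (1 - sqrt (1 - \<epsilon>)) * (norm0h T v)\<^sup>2 \<le> B0h \<Omega> T A \<epsilon> v v"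
proof
  fix v assume v: "v \<in> Vh \<Omega> T k"
  note m = \<open>conforming_mesh \<Omega> T\<close>
  define s where "s = sqrt (1 - \<epsilon>)"
  let ?p = "piece v"
  have n: "CARD('n) = 2 \<or> CARD('n) = 3" using assms(1) by blast
  have \<Omega>l: "\<Omega> \<in> sets lebesgue" using lmeasurable_open[OF assms(2,3)] by (rule fmeasurableD)
  have Am: "A \<in> borel_measurable (lebesgue_on \<Omega>)" using \<open>ess_bounded \<Omega> A\<close> by (simp add: ess_bounded_def)
  have p: "rpf (?p K)" if "K \<in> T" for K by (rule Vh_piece[OF v m that])
  define X where "X K = integral\<^sup>L lborel (\<lambda>x. indicator K x * (laplacian (?p K) x)\<^sup>2)" for K
  define Y where "Y K = integral\<^sup>L lborel (\<lambda>x. indicator K x * (norm (hess (?p K) x))\<^sup>2)" for K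
  define J where "J = (\<Sum>F\<in>interior_faces \<Omega> T. face_integral F (\<lambda>x. jump_grad T v F x * face_laplacian T v F x))"
  have int: "integrable lborel (\<lambda>x. indicator K x * (laplacian (?p K) x)\<^sup>2)"
    "integrable lborel (\<lambda>x. indicator K x * (norm (hess (?p K) x))\<^sup>2)" if K: "K \<in> T" for K
  proof -
    have "continuous_on K (\<lambda>x. (laplacian (?p K) x)\<^sup>2)" "continuous_on K (\<lambda>x. (norm (hess (?p K) x))\<^sup>2)"
      by (intro continuous_intros rpf_continuous_on rpf_laplacian continuous_on_hess p[OF K])+
    from this[THEN borel_integrable_compact[OF mesh_compact[OF m K]]]
    show "integrable lborel (\<lambda>x. indicator K x * (laplacian (?p K) x)\<^sup>2)"
      "integrable lborel (\<lambda>x. indicator K x * (norm (hess (?p K) x))\<^sup>2)" by simp_all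
  qed
  have MT: "(\<Sum>K\<in>T. X K) - (\<Sum>K\<in>T. Y K) = 2 * J"
  proof -
    have "(\<Sum>K\<in>T. X K) - (\<Sum>K\<in>T. Y K) = (\<Sum>K\<in>T. integral\<^sup>L lborel (\<lambda>x. indicator K x *
        ((laplacian (?p K) x)\<^sup>2 - (norm (hess (?p K) x))\<^sup>2)))"
      unfolding sum_subtractf[symmetric] X_def Y_def right_diff_distrib
      by (intro sum.cong refl) (simp add: Bochner_Integration.integral_diff int)
    then show ?thesis unfolding discrete_Miranda_Talenti[OF n assms(2-4) m v] by (simp add: J_def)
  qed
  have elem: "(1 - s / 2) * X K - s / 2 * Y K \<le>
      integral\<^sup>L (lebesgue_on K) (\<lambda>x. cordes_gamma A x * (A x \<bullet> hess (?p K) x) * laplacian (?p K) x)"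
    if K: "K \<in> T" for K
  proof -
    have "K - \<Omega> \<subseteq> frontier \<Omega>" using mesh_subset[OF m K] assms(3) by (auto simp: frontier_def interior_open)
    then have "negligible (K - \<Omega>)" using negligible_convex_frontier[OF assms(4)] negligible_subset by blast
    from element_coercivity[OF Am assms(9,12,10,11) \<Omega>l mesh_compact[OF m K] this p[OF K], folded s_def]
    have "integral\<^sup>L lborel (\<lambda>x. indicator K x * ((1 - s / 2) * (laplacian (?p K) x)\<^sup>2 - s / 2 * (norm (hess (?p K) x))\<^sup>2)) \<le>
      integral\<^sup>L (lebesgue_on K) (\<lambda>x. cordes_gamma A x * (A x \<bullet> hess (?p K) x) * laplacian (?p K) x)" .
    moreover have "integral\<^sup>L lborel (\<lambda>x. indicator K x * ((1 - s / 2) * (laplacian (?p K) x)\<^sup>2 - s / 2 * (norm (hess (?p K) x))\<^sup>2)) =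
      (1 - s / 2) * X K - s / 2 * Y K"
    proof -
      have "(\<lambda>x. indicator K x * ((1 - s / 2) * (laplacian (?p K) x)\<^sup>2 - s / 2 * (norm (hess (?p K) x))\<^sup>2)) =
        (\<lambda>x. (1 - s / 2) * (indicator K x * (laplacian (?p K) x)\<^sup>2) - s / 2 * (indicator K x * (norm (hess (?p K) x))\<^sup>2))"
        by (auto simp: algebra_simps)
      then show ?thesis unfolding X_def Y_def
        by (simp only: Bochner_Integration.integral_diff[OF integrable_mult_right[OF int(1)[OF K]] integrable_mult_right[OF int(2)[OF K]]]
            integral_mult_right_zero)
    qed
    ultimately show ?thesis by simp
  qed
  have normY: "(norm0h T v)\<^sup>2 = (\<Sum>K\<in>T. Y K)"
  proof -
    have "integral\<^sup>L (lebesgue_on K) (\<lambda>x. (norm (hess (?p K) x))\<^sup>2) = Y K" if K: "K \<in> T" for K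
      unfolding Y_def
      by (rule integral_lebesgue_on_continuous[OF mesh_compact[OF m K]])
        (intro continuous_intros continuous_on_hess p[OF K])
    moreover have "0 \<le> Y K" for K unfolding Y_def by (rule integral_nonneg_AE) simp
    ultimately show ?thesis by (simp add: norm0h_def sum_nonneg)
  qed
  \<comment> \<open>the factor \<open>2 - s\<close> of the jump term is the one for which all multiples of \<open>X\<close> cancel\<close>
  have "(1 - s) * (\<Sum>K\<in>T. Y K) = (\<Sum>K\<in>T. (1 - s / 2) * X K - s / 2 * Y K) - (2 - s) * J"
  proof -
    have X: "(\<Sum>K\<in>T. X K) = (\<Sum>K\<in>T. Y K) + 2 * J" using MT by simp
    have "(\<Sum>K\<in>T. (1 - s / 2) * X K - s / 2 * Y K) = (1 - s / 2) * (\<Sum>K\<in>T. X K) - s / 2 * (\<Sum>K\<in>T. Y K)"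
      by (simp only: sum_subtractf sum_distrib_left)
    then show ?thesis unfolding X by (simp add: algebra_simps)
  qed
  also have "\<dots> \<le> (\<Sum>K\<in>T. integral\<^sup>L (lebesgue_on K) (\<lambda>x. cordes_gamma A x * (A x \<bullet> hess (?p K) x) * laplacian (?p K) x))
      - (2 - s) * J"
    by (intro diff_right_mono sum_mono elem)
  also have "\<dots> = B0h \<Omega> T A \<epsilon> v v" by (simp add: B0h_def J_def s_def)
  finally show "(1 - sqrt (1 - \<epsilon>)) * (norm0h T v)\<^sup>2 \<le> B0h \<Omega> T A \<epsilon> v v"
    by (simp add: normY s_def)
qed

end
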